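(* Let $E/\mathbb{F}_q$ be an elliptic function field. Let $T$ be a subgroup of the translation group $T_E$ and let $A$ be a subgroup of $\mathrm{Aut}(E,O)$. Then $TA=\{\tau\alpha:\tau\in T,\alpha\in A\}$ is a subgroup of $\mathrm{Aut}(E/\mathbb{F}_q)$ if and only if $\tau_{\sigma^{-1}(Q)}\in T$ for all $\sigma\in A$ and all $\tau_Q\in T$.
   Context: $\mathbb{F}_q$ is a finite field of characteristic $p$. An elliptic function field $E/\mathbb{F}_q$ is the function field $\mathbb{F}_q(x,y)$ of an elliptic curve over $\mathbb{F}_q$ given by a nonsingular Weierstrass equation; $O$ is the common pole of $x$ and $y$ (the infinite place). $\mathbb{P}_E^1$ is the set of rational (degree one) places of $E$; it is an abelian group with zero $O$ and with $P\oplus Q=R$ iff the divisors $P+Q$ and $R+O$ are linearly equivalent. $\mathrm{Aut}(E/\mathbb{F}_q)$ is the group of field automorphisms of $E$ fixing $\mathbb{F}_q$ elementwise, acting on places by $\sigma(P)=\{\sigma(z):z\in P\}$. $\mathrm{Aut}(E,O)=\{\sigma\in\mathrm{Aut}(E/\mathbb{F}_q):\sigma(O)=O\}$. For $Q\in\mathbb{P}_E^1$, $\tau_Q\in\mathrm{Aut}(E/\mathbb{F}_q)$ is the automorphism induced by translation by $Q$: its extension to $E\overline{\mathbb{F}}_q$ sends every rational place $P$ of $E\overline{\mathbb{F}}_q$ to $P\oplus Q$. $T_E=\{\tau_Q:Q\in\mathbb{P}_E^1\}$ is the translation group. *)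

theory Defs
  imports "HOL-Algebra.Algebra" "HOL-Algebra.Algebraic_Closure_Type"
begin

text \<open>
  The function field \<open>E\<close> is the universe of a type \<open>'a\<close> of sort \<open>field\<close>, and everything else lives
  inside \<open>E\<close> or inside its algebraic closure \<open>'a alg_closure\<close>, where \<open>E\<close> embeds through \<open>to_ac\<close>.
  Since places are needed both for \<open>E/\<bbbF>\<^sub>q\<close> and for its constant field extension, the notions
  below are stated for a subfield \<open>F\<close> of a type of sort \<open>field\<close> over a field of constants \<open>k \<subseteq> F\<close>.
\<close>

abbreviation on_carrier :: "'a::field set \<Rightarrow> 'a ring" where
  "on_carrier S \<equiv> ring_of_type_algebra \<lparr>carrier := S\<rparr>"


section \<open>Places\<close>

definition valuation_rings :: "'a::field set \<Rightarrow> 'a set \<Rightarrow> 'a set set" where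
  "valuation_rings k F =
     {V. subring V ring_of_type_algebra \<and> k \<subset> V \<and> V \<subset> F \<and> (\<forall>z\<in>F. z \<in> V \<or> inverse z \<in> V)}"

definition places :: "'a::field set \<Rightarrow> 'a set \<Rightarrow> 'a set set" where
  "places k F = {P. \<exists>V\<in>valuation_rings k F. maximalideal P (on_carrier V)}"

text \<open>
  The valuation ring with maximal ideal \<open>P\<close> consists of the \<open>z\<close> with \<open>1/z \<notin> P\<close>; as \<open>inverse 0 = 0\<close>
  is an element of \<open>P\<close>, the element \<open>0\<close> has to be listed separately.
\<close>

definition ring_of_place :: "'a::field set \<Rightarrow> 'a set \<Rightarrow> 'a set" where
  "ring_of_place F P = {z\<in>F. z = 0 \<or> inverse z \<notin> P}"

definition residue_field :: "'a::field set \<Rightarrow> 'a set \<Rightarrow> 'a set ring" where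
  "residue_field F P = on_carrier (ring_of_place F P) Quot P"

definition place_degree_is :: "'a::field set \<Rightarrow> 'a set \<Rightarrow> 'a set \<Rightarrow> nat \<Rightarrow> bool" where
  "place_degree_is k F P n \<longleftrightarrow>
     ring.dimension (residue_field F P) n
       ((\<lambda>c. P +>\<^bsub>on_carrier (ring_of_place F P)\<^esub> c) ` k) (carrier (residue_field F P))"

definition rational_places :: "'a::field set \<Rightarrow> 'a set \<Rightarrow> 'a set set" where
  "rational_places k F = {P\<in>places k F. place_degree_is k F P 1}"

text \<open>The normalised valuation at \<open>P\<close>, meaningful for \<open>z \<noteq> 0\<close> only.\<close>

definition valuation :: "'a::field set \<Rightarrow> 'a set \<Rightarrow> 'a \<Rightarrow> int" where
  "valuation F P z =
     (THE n. \<exists>t u. t \<in> P \<and> P = (\<lambda>w. t * w) ` ring_of_place F P \<and>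
                   u \<in> ring_of_place F P - P \<and> z = t powi n * u)"


section \<open>Linear equivalence and the addition of rational places\<close>

text \<open>A divisor is an element of the free abelian group over the places, hence of type \<open>'a set \<Rightarrow>\<^sub>0 int\<close>.\<close>

definition linearly_equivalent ::
    "'a::field set \<Rightarrow> 'a set \<Rightarrow> ('a set \<Rightarrow>\<^sub>0 int) \<Rightarrow> ('a set \<Rightarrow>\<^sub>0 int) \<Rightarrow> bool" where
  "linearly_equivalent k F D D' \<longleftrightarrow>
     (\<exists>f\<in>F - {0}. \<forall>P\<in>places k F. Poly_Mapping.lookup (D - D') P = valuation F P f)"

definition infinite_place :: "'a::field set \<Rightarrow> 'a set \<Rightarrow> 'a \<Rightarrow> 'a \<Rightarrow> 'a set" where
  "infinite_place k F x y =
     (THE P. P \<in> places k F \<and> valuation F P x < 0 \<and> valuation F P y < 0)"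

text \<open>\<open>P \<oplus> Q = R\<close>, for the group law whose zero is the place \<open>Oinf\<close>.\<close>

definition place_sum_is ::
    "'a::field set \<Rightarrow> 'a set \<Rightarrow> 'a set \<Rightarrow> 'a set \<Rightarrow> 'a set \<Rightarrow> 'a set \<Rightarrow> bool" where
  "place_sum_is k F Oinf P Q R \<longleftrightarrow>
     linearly_equivalent k F (frag_of P + frag_of Q) (frag_of R + frag_of Oinf)"


section \<open>Automorphisms\<close>

definition field_auts :: "'a::field set \<Rightarrow> 'a set \<Rightarrow> ('a \<Rightarrow> 'a) set" where
  "field_auts k F =
     ring_iso (on_carrier F) (on_carrier F) \<inter> extensional F \<inter> {\<sigma>. \<forall>c\<in>k. \<sigma> c = c}"

definition aut_group :: "'a::field set \<Rightarrow> 'a set \<Rightarrow> ('a \<Rightarrow> 'a) monoid" where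
  "aut_group k F = BijGroup F \<lparr>carrier := field_auts k F\<rparr>"

definition place_stabilizer :: "'a::field set \<Rightarrow> 'a set \<Rightarrow> 'a set \<Rightarrow> ('a \<Rightarrow> 'a) set" where
  "place_stabilizer k F P = {\<sigma> \<in> carrier (aut_group k F). \<sigma> ` P = P}"


section \<open>Elliptic function fields\<close>

text \<open>The algebraic closure of \<open>K\<close> in \<open>'a alg_closure\<close>, i.e. \<open>\<bbbF>\<^sub>q\<close>-bar if \<open>K = \<bbbF>\<^sub>q\<close>.\<close>

definition const_closure :: "'a::field set \<Rightarrow> 'a alg_closure set" where
  "const_closure K = {z. (ring.algebraic ring_of_type_algebra over (to_ac ` K)) z}"

text \<open>The compositum of \<open>E\<close> and the algebraic closure of \<open>K\<close>.\<close>

definition const_extension :: "'a::field set \<Rightarrow> 'a alg_closure set" where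
  "const_extension K = generate_field ring_of_type_algebra (const_closure K \<union> range to_ac)"

definition weierstrass :: "'a::field \<Rightarrow> 'a \<Rightarrow> 'a \<Rightarrow> 'a \<Rightarrow> 'a \<Rightarrow> 'a \<Rightarrow> 'a \<Rightarrow> 'a" where
  "weierstrass a1 a2 a3 a4 a6 u v =
     v^2 + a1 * u * v + a3 * v - (u^3 + a2 * u^2 + a4 * u + a6)"

definition weierstrass_singular :: "'a::field \<Rightarrow> 'a \<Rightarrow> 'a \<Rightarrow> 'a \<Rightarrow> 'a \<Rightarrow> 'a \<Rightarrow> 'a \<Rightarrow> bool" where
  "weierstrass_singular a1 a2 a3 a4 a6 u v \<longleftrightarrow>
     weierstrass a1 a2 a3 a4 a6 u v = 0 \<and>
     a1 * v - (3 * u^2 + 2 * a2 * u + a4) = 0 \<and>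
     2 * v + a1 * u + a3 = 0"

text \<open>
  Nonsingularity is tested at the affine points over the algebraic closure of \<open>K\<close>; the point at
  infinity of a Weierstrass curve is always smooth.
\<close>

definition nonsingular_weierstrass ::
    "'a::field set \<Rightarrow> 'a \<Rightarrow> 'a \<Rightarrow> 'a \<Rightarrow> 'a \<Rightarrow> 'a \<Rightarrow> bool" where
  "nonsingular_weierstrass K a1 a2 a3 a4 a6 \<longleftrightarrow>
     (\<forall>u\<in>const_closure K. \<forall>v\<in>const_closure K.
        \<not> weierstrass_singular (to_ac a1) (to_ac a2) (to_ac a3) (to_ac a4) (to_ac a6) u v)"

text \<open>
  A Weierstrass polynomial is irreducible in \<open>v\<close> over \<open>K(u)\<close> (the cubic has odd degree in \<open>u\<close>).
  Hence if \<open>x\<close> is transcendental over \<open>K\<close> and \<open>y\<close> satisfies the equation, then \<open>K(x, y)\<close> is indeed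
  the function field of the curve.
\<close>

definition elliptic_function_field :: "'a::field set \<Rightarrow> 'a \<Rightarrow> 'a \<Rightarrow> bool" where
  "elliptic_function_field K x y \<longleftrightarrow>
     subfield K ring_of_type_algebra \<and> finite K \<and>
     (ring.transcendental ring_of_type_algebra over K) x \<and>
     generate_field ring_of_type_algebra (K \<union> {x, y}) = UNIV \<and>
     (\<exists>a1\<in>K. \<exists>a2\<in>K. \<exists>a3\<in>K. \<exists>a4\<in>K. \<exists>a6\<in>K.
        nonsingular_weierstrass K a1 a2 a3 a4 a6 \<and> weierstrass a1 a2 a3 a4 a6 x y = 0)"


section \<open>Translations\<close>

text \<open>
  \<open>\<tau>\<close> is the automorphism of \<open>E/K\<close> induced by translation by \<open>Q\<close>: its extension \<open>\<tau>'\<close> to the constant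
  field extension, which fixes the algebraic closure of \<open>K\<close>, sends every rational place \<open>P\<close> to
  \<open>P \<oplus> Q'\<close>. Here \<open>Q'\<close> is the rational place lying over \<open>Q\<close>, with which \<open>Q\<close> is identified.
\<close>

definition is_translation_by :: "'a::field set \<Rightarrow> 'a \<Rightarrow> 'a \<Rightarrow> 'a set \<Rightarrow> ('a \<Rightarrow> 'a) \<Rightarrow> bool" where
  "is_translation_by K x y Q \<tau> \<longleftrightarrow>
     \<tau> \<in> carrier (aut_group K UNIV) \<and>
     (let k' = const_closure K; F' = const_extension K;
          O' = infinite_place k' F' (to_ac x) (to_ac y)
      in \<exists>\<tau>' \<in> carrier (aut_group k' F'). (\<forall>z. \<tau>' (to_ac z) = to_ac (\<tau> z)) \<and>
           (\<exists>Q' \<in> rational_places k' F'. to_ac -` Q' = Q \<and>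
              (\<forall>P \<in> rational_places k' F'. place_sum_is k' F' O' P Q' (\<tau>' ` P))))"

definition translation :: "'a::field set \<Rightarrow> 'a \<Rightarrow> 'a \<Rightarrow> 'a set \<Rightarrow> ('a \<Rightarrow> 'a)" where
  "translation K x y Q = (THE \<tau>. is_translation_by K x y Q \<tau>)"

definition translation_group :: "'a::field set \<Rightarrow> 'a \<Rightarrow> 'a \<Rightarrow> ('a \<Rightarrow> 'a) set" where
  "translation_group K x y = {\<tau>. \<exists>Q \<in> rational_places K UNIV. is_translation_by K x y Q \<tau>}"

end

theory Submission
  imports Defs
begin

text \<open>
  Conjugating the translation by \<open>Q\<close> with \<open>\<sigma> \<in> A\<close> gives the translation by \<open>\<sigma>\<^sup>-\<^sup>1(Q)\<close>, so the
  condition on the right says that \<open>A\<close> normalises \<open>T\<close>; hence \<open>TA\<close> is a subgroup. Conversely, if \<open>TA\<close>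
  is a subgroup then \<open>\<sigma>\<^sup>-\<^sup>1\<tau>\<sigma> = \<tau>'\<alpha>\<close> with \<open>\<tau>' \<in> T\<close> and \<open>\<alpha> \<in> A\<close>, and \<open>\<alpha>\<close> is trivial because a
  translation that fixes \<open>O\<close> is the identity.

  To compare translations one passes to \<open>F'\<close>, the compositum with the algebraic closure \<open>k'\<close> of the
  constants, whose places are the points of the curve: \<open>O\<close>, and one place for each affine
  point, with an explicit uniformizer there. The affine coordinate ring is normal, so
  a function without zeros and poles is constant, and an automorphism fixing all places multiplies
  every function by a constant and therefore is the identity. Moreover no function has a single
  simple pole, so sums of places are unique. An automorphism of \<open>E\<close> extends to \<open>F'\<close> because
  \<open>y\<close> has degree two over \<open>k'(x)\<close>; that the extension fixes \<open>O\<close> if the given one does follows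
  since \<open>O\<close> is the only place at which \<open>x\<close> has a pole.
\<close>

text \<open>Translations are specified on \<open>F'\<close> while \<open>T\<close> and
  \<open>A\<close> act on \<open>E\<close>, so statements about them are made for an automorphism
  together with an extension of it and brought back through \<open>to_ac\<close>. That the lift
  \<open>Q'\<close> of \<open>Q\<close> is determined by \<open>Q\<close> rests on \<open>Q\<close>
  having degree one. Two definite descriptions shape the development. \<open>infinite_place\<close>
  ranges over all places of \<open>E\<close>, but \<open>valuation\<close> is meaningful only at a
  place with a uniformizer. So the places of \<open>E\<close> at which \<open>x\<close> is regular
  must be known to be discrete; this is obtained by extending a valuation ring of \<open>E\<close>
  to \<open>F'\<close>, where all places are listed, and contracting a uniformizer.
  \<open>translation\<close> is a description whose existence part is never established: the
  statement ranges over all rational \<open>Q\<close>, and a \<open>Q\<close> without a translation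
  is handled by showing that its image under \<sigma>^-1 has none either. Finiteness of
  \<open>K\<close> enters through the fact that an element is algebraic over \<open>K\<close> iff it
  lies in a finite field containing \<open>K\<close>. This makes \<open>k'\<close> a field closed
  under taking roots without any degree theory.\<close>

lemma ring_of_type_algebra_simps [simp]:
  "carrier (ring_of_type_algebra :: 'a::field ring) = UNIV"
  "monoid.mult (ring_of_type_algebra :: 'a ring) = (*)"
  "monoid.one (ring_of_type_algebra :: 'a ring) = 1"
  "ring.zero (ring_of_type_algebra :: 'a ring) = 0"
  "ring.add (ring_of_type_algebra :: 'a ring) = (+)"
  by (auto simp: ring_of_type_algebra_def fun_eq_iff)

lemma a_inv_type_algebra [simp]: "a_inv (ring_of_type_algebra :: 'a::field ring) z = - z"
proof -
  interpret ring "ring_of_type_algebra :: 'a ring" by (rule ring_from_type_algebra)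
  show ?thesis
    by (rule minus_equality) auto
qed

lemma m_inv_type_algebra [simp]:
  assumes "z \<noteq> 0"
  shows "m_inv (ring_of_type_algebra :: 'a::field ring) z = inverse z"
proof -
  interpret cring "ring_of_type_algebra :: 'a ring" by (rule cring_from_type_algebra)
  show ?thesis
    using comm_inv_char[of z "inverse z"] assms by auto
qed

section \<open>Subrings and subfields of a field type\<close>

abbreviation subrng :: "'a::field set \<Rightarrow> bool" where
  "subrng S \<equiv> subring S ring_of_type_algebra"

abbreviation subfld :: "'a::field set \<Rightarrow> bool" where
  "subfld S \<equiv> subfield S ring_of_type_algebra"

lemma subrngI:
  fixes S :: "'a::field set"
  assumes "1 \<in> S" "\<And>a b. a \<in> S \<Longrightarrow> b \<in> S \<Longrightarrow> a - b \<in> S" "\<And>a b. a \<in> S \<Longrightarrow> b \<in> S \<Longrightarrow> a * b \<in> S"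
  shows "subrng S"
proof -
  interpret ring "ring_of_type_algebra :: 'a ring" by (rule ring_from_type_algebra)
  have 0: "0 \<in> S" using assms(2)[OF assms(1,1)] by simp
  have m: "- a \<in> S" if "a \<in> S" for a using assms(2)[OF 0 that] by simp
  have "a + b \<in> S" if "a \<in> S" "b \<in> S" for a b using assms(2)[OF that(1) m[OF that(2)]] by simp
  then show ?thesis by (intro subringI) (use assms m in auto)
qed

lemma subrngD:
  fixes S :: "'a::field set"
  assumes "subrng S"
  shows "0 \<in> S" "1 \<in> S" "a \<in> S \<Longrightarrow> - a \<in> S" "a \<in> S \<Longrightarrow> b \<in> S \<Longrightarrow> a + b \<in> S"
    "a \<in> S \<Longrightarrow> b \<in> S \<Longrightarrow> a * b \<in> S" "a \<in> S \<Longrightarrow> b \<in> S \<Longrightarrow> a - b \<in> S"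
proof -
  show *: "0 \<in> S" "1 \<in> S" "a \<in> S \<Longrightarrow> - a \<in> S" "a \<in> S \<Longrightarrow> b \<in> S \<Longrightarrow> a + b \<in> S"
    "a \<in> S \<Longrightarrow> b \<in> S \<Longrightarrow> a * b \<in> S" for a b
    using subringE[OF assms] by auto
  show "a \<in> S \<Longrightarrow> b \<in> S \<Longrightarrow> a - b \<in> S"
    using *(4)[of a "- b"] *(3)[of b] by simp
qed

lemma subrng_power: "subrng S \<Longrightarrow> a \<in> S \<Longrightarrow> a ^ n \<in> S"
  by (induction n) (auto intro: subrngD)

lemma subrng_numeral: "subrng S \<Longrightarrow> numeral n \<in> S"
proof (induction n rule: num_induct)
  case One
  then show ?case by (simp add: subrngD(2))
next
  case (inc n)
  then show ?case using subrngD(4)[of S "numeral n" 1] subrngD(2)[of S] by (simp only: numeral_inc)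
qed

lemma subrng_sum:
  assumes "subrng S" "\<And>i. i \<in> I \<Longrightarrow> f i \<in> S"
  shows "sum f I \<in> S"
  using assms(2) by (induction I rule: infinite_finite_induct) (auto intro: subrngD[OF assms(1)])

lemma subfldI:
  fixes S :: "'a::field set"
  assumes "1 \<in> S" "\<And>a b. a \<in> S \<Longrightarrow> b \<in> S \<Longrightarrow> a - b \<in> S" "\<And>a b. a \<in> S \<Longrightarrow> b \<in> S \<Longrightarrow> a * b \<in> S"
    "\<And>a. a \<in> S \<Longrightarrow> a \<noteq> 0 \<Longrightarrow> inverse a \<in> S"
  shows "subfld S"
proof -
  interpret field "ring_of_type_algebra :: 'a ring" by (rule field_from_type_algebra)
  show ?thesis
    by (rule subfieldI') (use assms subrngI[of S] in auto)
qed

lemma subfld_subrng: "subfld S \<Longrightarrow> subrng S"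
  by (rule subfieldE(1))

lemma subfldD:
  fixes S :: "'a::field set"
  assumes "subfld S"
  shows "a \<in> S \<Longrightarrow> inverse a \<in> S" "a \<in> S \<Longrightarrow> b \<in> S \<Longrightarrow> a / b \<in> S"
proof -
  interpret field "ring_of_type_algebra :: 'a ring" by (rule field_from_type_algebra)
  show *: "a \<in> S \<Longrightarrow> inverse a \<in> S" for a
    using subfield_m_inv(1)[OF assms, of a] subrngD(1)[OF subfld_subrng[OF assms]]
    by (cases "a = 0") auto
  show "a \<in> S \<Longrightarrow> b \<in> S \<Longrightarrow> a / b \<in> S"
    using *[of b] subrngD(5)[OF subfld_subrng[OF assms]] by (simp add: divide_inverse)
qed

lemma subfld_powi: "subfld S \<Longrightarrow> a \<in> S \<Longrightarrow> a powi n \<in> S"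
  using subrng_power[OF subfld_subrng, of S a] subrng_power[OF subfld_subrng, of S "inverse a"]
    subfldD(1)[of S a] by (auto simp: power_int_def)

lemma subfld_UNIV: "subfld (UNIV :: 'a::field set)"
  by (rule subfldI) auto

lemma generate_field_subfld: "subfld (generate_field ring_of_type_algebra H)"
proof -
  interpret field "ring_of_type_algebra :: 'a ring" by (rule field_from_type_algebra)
  show ?thesis by (rule generate_field_is_subfield) auto
qed

lemma generate_field_minimal:
  assumes "subfld S" "H \<subseteq> S"
  shows "generate_field ring_of_type_algebra H \<subseteq> (S :: 'a::field set)"
proof -
  interpret field "ring_of_type_algebra :: 'a ring" by (rule field_from_type_algebra)
  show ?thesis by (rule generate_field_min_subfield1) (use assms in auto)
qed


section \<open>Polynomials with coefficients in a subring\<close>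

definition polys :: "'a::zero set \<Rightarrow> 'a poly set" where
  "polys S = {p. \<forall>i. Polynomial.coeff p i \<in> S}"

lemma polys_mono: "S \<subseteq> S' \<Longrightarrow> polys S \<subseteq> polys S'"
  by (auto simp: polys_def)

context
  fixes S :: "'a::field set"
  assumes S: "subrng S"
begin

lemma polys_0: "0 \<in> polys S"
  using subrngD(1)[OF S] by (simp add: polys_def)

lemma polys_pCons_iff: "pCons a p \<in> polys S \<longleftrightarrow> a \<in> S \<and> p \<in> polys S"
  by (auto simp: polys_def coeff_pCons split: nat.splits)

lemma polys_add: "p \<in> polys S \<Longrightarrow> q \<in> polys S \<Longrightarrow> p + q \<in> polys S"
  using subrngD(4)[OF S] by (auto simp: polys_def)

lemma polys_uminus: "p \<in> polys S \<Longrightarrow> - p \<in> polys S"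
  using subrngD(3)[OF S] by (auto simp: polys_def)

lemma polys_diff: "p \<in> polys S \<Longrightarrow> q \<in> polys S \<Longrightarrow> p - q \<in> polys S"
  using subrngD(6)[OF S] by (auto simp: polys_def)

lemma polys_mult: "p \<in> polys S \<Longrightarrow> q \<in> polys S \<Longrightarrow> p * q \<in> polys S"
  by (auto simp: polys_def coeff_mult intro!: subrng_sum[OF S] subrngD(5)[OF S])

lemma polys_smult: "a \<in> S \<Longrightarrow> q \<in> polys S \<Longrightarrow> smult a q \<in> polys S"
  using subrngD(5)[OF S] by (auto simp: polys_def)

lemma polys_1: "1 \<in> polys S"
  using subrngD(1,2)[OF S] by (simp add: polys_def one_pCons coeff_pCons split: nat.split)

lemma polys_monom: "a \<in> S \<Longrightarrow> Polynomial.monom a n \<in> polys S"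
  using subrngD(1)[OF S] by (simp add: polys_def)

lemma poly_in_subrng:
  assumes "p \<in> polys S" "z \<in> S"
  shows "poly p z \<in> S"
  using assms
  by (auto simp: poly_altdef polys_def intro!: subrng_sum[OF S] subrngD(5)[OF S] subrng_power[OF S])

end

lemmas polys_closed = polys_0 polys_1 polys_add polys_uminus polys_diff polys_mult polys_smult
  polys_monom polys_pCons_iff[THEN iffD2]

text \<open>The polynomials of \<open>HOL-Algebra\<close> are lists with the leading coefficient first.\<close>

lemma eval_list_eq_poly:
  fixes z :: "'a::field"
  shows "ring.eval ring_of_type_algebra ps z = poly (Poly (rev ps)) z"
proof -
  interpret ring "ring_of_type_algebra :: 'a ring" by (rule ring_from_type_algebra)
  have pw: "z [^]\<^bsub>ring_of_type_algebra\<^esub> (n::nat) = z ^ n" for n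
    by (induction n) auto
  show ?thesis
  proof (induction ps)
    case (Cons a ps)
    have "poly (Poly (rev ps @ [a])) z = poly (Poly (rev ps)) z + a * z ^ length ps"
      by (simp add: Poly_append poly_monom)
    then show ?case using Cons by (simp add: pw)
  qed auto
qed

text \<open>Reversing the list turns a \<open>HOL-Algebra\<close> polynomial into
  \<open>coeffs\<close>, and its nonzero head is the leading coefficient; so nonzero polynomials
  over \<open>k\<close> correspond to each other on the two sides.\<close>

lemma algebraic_over_iff:
  fixes k :: "'a::field set"
  assumes "subrng k"
  shows "(ring.algebraic ring_of_type_algebra over k) z \<longleftrightarrow> (\<exists>p\<in>polys k. p \<noteq> 0 \<and> poly p z = 0)"
proof -
  interpret field "ring_of_type_algebra :: 'a ring" by (rule field_from_type_algebra)
  show ?thesis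
  proof
    assume "(algebraic over k) z"
    then obtain ps where ps: "ps \<in> carrier (k [X]\<^bsub>ring_of_type_algebra\<^esub>)" "ps \<noteq> []" "eval ps z = 0"
      using algebraicE[OF assms, of z] by auto
    then have 1: "set ps \<subseteq> k" "hd ps \<noteq> 0"
      by (auto simp: univ_poly_def polynomial_def)
    have "Polynomial.coeff (Poly (rev ps)) i \<in> k" for i
      using 1(1) subrngD(1)[OF assms] nth_mem[of i "rev ps"] by (auto simp: nth_default_def)
    moreover
    have "Polynomial.coeff (Poly (rev ps)) (length ps - 1) = hd ps"
      using ps(2) by (simp add: nth_default_def rev_nth hd_conv_nth)
    then have "Poly (rev ps) \<noteq> 0" using 1(2) by (metis coeff_0)
    ultimately show "\<exists>p\<in>polys k. p \<noteq> 0 \<and> poly p z = 0"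
      using ps(3) eval_list_eq_poly[of ps z]
      by (intro bexI[of _ "Poly (rev ps)"]) (auto simp: polys_def)
  next
    assume "\<exists>p\<in>polys k. p \<noteq> 0 \<and> poly p z = 0"
    then obtain p where p: "p \<in> polys k" "p \<noteq> 0" "poly p z = 0" by auto
    have "set (coeffs p) \<subseteq> k" using p(1) by (auto simp: polys_def coeffs_def)
    moreover have "last (coeffs p) \<noteq> 0" "coeffs p \<noteq> []" using p(2) by (auto simp: last_coeffs_eq_coeff_degree)
    ultimately have "rev (coeffs p) \<in> carrier (k [X]\<^bsub>ring_of_type_algebra\<^esub>)"
      by (auto simp: univ_poly_def polynomial_def hd_rev)
    then show "(algebraic over k) z"
      by (rule algebraicI) (use p \<open>coeffs p \<noteq> []\<close> in \<open>auto simp: eval_list_eq_poly\<close>)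
  qed
qed


section \<open>Algebraic elements over a finite field\<close>

text \<open>Multiplication by a nonzero element is injective on \<open>S\<close>, hence onto by
  finiteness, so it hits 1.\<close>

lemma finite_subrng_subfld:
  fixes S :: "'a::field set"
  assumes "subrng S" "finite S"
  shows "subfld S"
proof (rule subfldI)
  fix a assume a: "a \<in> S" "a \<noteq> 0"
  have "(*) a ` S \<subseteq> S" using a subrngD(5)[OF assms(1)] by auto
  moreover have "inj_on ((*) a) S" using a by (auto simp: inj_on_def)
  ultimately have "(*) a ` S = S" using assms(2) by (simp add: endo_inj_surj)
  then obtain b where "b \<in> S" "a * b = 1" using subrngD(2)[OF assms(1)] by (metis imageE)
  then show "inverse a \<in> S" by (metis inverse_unique)
qed (use subrngD[OF assms(1)] in auto)

lemma finite_poly_degree_less: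
  fixes S :: "'a::field set"
  assumes "finite S"
  shows "finite {p \<in> polys S. Polynomial.degree p < n}"
proof (rule finite_subset)
  let ?f = "\<lambda>xs. Poly xs"
  show "{p \<in> polys S. Polynomial.degree p < n} \<subseteq> ?f ` {xs. set xs \<subseteq> S \<and> length xs \<le> n}"
  proof
    fix p assume p: "p \<in> {p \<in> polys S. Polynomial.degree p < n}"
    have "set (coeffs p) \<subseteq> S" using p by (auto simp: polys_def coeffs_def)
    moreover have "length (coeffs p) \<le> n" using p by (auto simp: length_coeffs_degree coeffs_def)
    ultimately show "p \<in> ?f ` {xs. set xs \<subseteq> S \<and> length xs \<le> n}"
      by (intro image_eqI[of _ _ "coeffs p"]) auto
  qed
  show "finite (?f ` {xs. set xs \<subseteq> S \<and> length xs \<le> n})"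
    using finite_lists_length_le[OF assms] by auto
qed

text \<open>Long division, written out because the coefficients of quotient and remainder have to be
  seen to stay in \<open>S\<close>.\<close>

lemma polys_mod_exists:
  fixes S :: "'a::field set"
  assumes S: "subfld S" and m: "m \<in> polys S" "m \<noteq> 0" and p: "p \<in> polys S"
  shows "\<exists>q\<in>polys S. \<exists>r\<in>polys S. p = q * m + r \<and> (r = 0 \<or> Polynomial.degree r < Polynomial.degree m)"
  using p
proof (induction "Polynomial.degree p" arbitrary: p rule: less_induct)
  case less
  note sr = subfld_subrng[OF S]
  show ?case
  proof (cases "p = 0 \<or> Polynomial.degree p < Polynomial.degree m")
    case True
    then show ?thesis using less.prems polys_0[OF sr] by (intro bexI[of _ 0] bexI[of _ p]) auto
  next
    case False
    then have pm: "p \<noteq> 0" "Polynomial.degree m \<le> Polynomial.degree p" by auto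
    define c where "c = lead_coeff p / lead_coeff m"
    define d where "d = Polynomial.degree p - Polynomial.degree m"
    have c: "c \<in> S" unfolding c_def using less.prems m by (intro subfldD(2)[OF S]) (auto simp: polys_def)
    define p' where "p' = p - Polynomial.monom c d * m"
    have p': "p' \<in> polys S" unfolding p'_def
      using less.prems m c by (intro polys_closed sr) auto
    have c0: "c \<noteq> 0" using pm m by (simp add: c_def)
    have deg: "Polynomial.degree (Polynomial.monom c d * m) = Polynomial.degree p"
    proof -
      have "Polynomial.monom c d \<noteq> 0" using c0 by simp
      then show ?thesis
        using degree_mult_eq[of "Polynomial.monom c d" m] degree_monom_eq[OF c0, of d] m(2) pm(2)
        unfolding d_def by linarith
    qed
    have lc: "lead_coeff (Polynomial.monom c d * m) = lead_coeff p"
    proof -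
      have "lead_coeff (Polynomial.monom c d) = c" using degree_monom_eq[OF c0, of d] by simp
      then show ?thesis using m by (simp only: lead_coeff_mult) (simp add: c_def)
    qed
    \<comment> \<open>In degree 0 the degree cannot drop any further; there equality of the leading
      coefficients already gives \<open>p' = 0\<close>.\<close>
    have "p' = 0 \<or> Polynomial.degree p' < Polynomial.degree p"
    proof (cases "Polynomial.degree p = 0")
      case True
      then obtain a b where "p = [:a:]" "Polynomial.monom c d * m = [:b:]"
        using deg by (metis degree_eq_zeroE)
      then show ?thesis using lc unfolding p'_def by simp
    next
      case False
      have "Polynomial.degree p' \<noteq> Polynomial.degree p"
      proof
        assume e: "Polynomial.degree p' = Polynomial.degree p"
        have "Polynomial.coeff p' (Polynomial.degree p) = 0"
          using lc unfolding deg unfolding p'_def coeff_diff by simp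
        then have "p' = 0" using e by (metis leading_coeff_0_iff)
        then show False using False e by simp
      qed
      moreover have "Polynomial.degree p' \<le> Polynomial.degree p"
        unfolding p'_def using deg by (intro degree_diff_le) auto
      ultimately show ?thesis by auto
    qed
    then obtain q r where qr: "q \<in> polys S" "r \<in> polys S" "p' = q * m + r"
      "r = 0 \<or> Polynomial.degree r < Polynomial.degree m"
    proof
      assume "p' = 0"
      then show thesis using that[of 0 0] polys_0[OF sr] by auto
    next
      assume "Polynomial.degree p' < Polynomial.degree p"
      from less.hyps[OF this p'] show thesis using that by blast
    qed
    then show ?thesis
      using c by (intro bexI[of _ "q + Polynomial.monom c d"] bexI[of _ r])
        (auto simp: p'_def algebra_simps intro!: polys_closed sr)
  qed
qed

text \<open>Reduction modulo \<open>m\<close> bounds the degrees, so the ring \<open>L[z]\<close> is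
  finite, and a finite subring of a field is a field. No irreducible polynomial has to be chosen for
  this.\<close>

lemma adjoin_root_finite:
  fixes L :: "'a::field set"
  assumes L: "subfld L" "finite L" and m: "m \<in> polys L" "m \<noteq> 0" "poly m z = 0"
  shows "\<exists>L'. subfld L' \<and> finite L' \<and> L \<subseteq> L' \<and> z \<in> L'"
proof -
  note sr = subfld_subrng[OF L(1)]
  define L' where "L' = (\<lambda>p. poly p z) ` polys L"
  have "L' \<subseteq> (\<lambda>p. poly p z) ` insert 0 {p \<in> polys L. Polynomial.degree p < Polynomial.degree m}"
  proof
    fix w assume "w \<in> L'"
    then obtain p where p: "p \<in> polys L" "w = poly p z" by (auto simp: L'_def)
    from polys_mod_exists[OF L(1) m(1,2) p(1)] obtain q r where
      "r \<in> polys L" "p = q * m + r" "r = 0 \<or> Polynomial.degree r < Polynomial.degree m" by blast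
    then show "w \<in> (\<lambda>p. poly p z) ` insert 0 {p \<in> polys L. Polynomial.degree p < Polynomial.degree m}"
      using p m(3) by (intro image_eqI[of _ _ r]) auto
  qed
  then have fin: "finite L'"
    by (rule finite_subset) (auto intro: finite_poly_degree_less L)
  have "subrng L'"
  proof (rule subrngI)
    show "1 \<in> L'" unfolding L'_def by (rule image_eqI[of _ _ 1]) (auto intro: polys_1 sr)
    show "a - b \<in> L'" "a * b \<in> L'" if "a \<in> L'" "b \<in> L'" for a b
      using that polys_diff[OF sr] polys_mult[OF sr] unfolding L'_def
      by (force simp flip: poly_diff poly_mult)+
  qed
  then have "subfld L'" using finite_subrng_subfld fin by blast
  moreover have "L \<subseteq> L'"
  proof
    fix c assume "c \<in> L"
    then show "c \<in> L'" unfolding L'_def by (intro image_eqI[of _ _ "[:c:]"]) (auto intro!: polys_closed sr)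
  qed
  moreover have "z \<in> L'"
    unfolding L'_def by (rule image_eqI[of _ _ "[:0, 1:]"]) (auto intro!: polys_closed sr subrngD(1,2)[OF sr])
  ultimately show ?thesis using fin by blast
qed

definition algebraics :: "'a::field set \<Rightarrow> 'a set" where
  "algebraics k = {z. \<exists>p\<in>polys k. p \<noteq> 0 \<and> poly p z = 0}"

context
  fixes k :: "'a::field set"
  assumes k: "subfld k" "finite k"
begin

text \<open>In a finite field two powers of \<open>z\<close> coincide, and \<open>X^i - X^j\<close>
  is the required polynomial. Closure of the algebraic elements under the field operations becomes
  immediate in this form.\<close>

lemma algebraics_finite_iff: "z \<in> algebraics k \<longleftrightarrow> (\<exists>L. subfld L \<and> finite L \<and> k \<subseteq> L \<and> z \<in> L)"
proof
  assume "z \<in> algebraics k"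
  then show "\<exists>L. subfld L \<and> finite L \<and> k \<subseteq> L \<and> z \<in> L"
    using adjoin_root_finite[OF k] by (auto simp: algebraics_def)
next
  assume "\<exists>L. subfld L \<and> finite L \<and> k \<subseteq> L \<and> z \<in> L"
  then obtain L where L: "subfld L" "finite L" "z \<in> L" by auto
  have "range (\<lambda>n. z ^ n) \<subseteq> L" using subrng_power[OF subfld_subrng[OF L(1)] L(3)] by auto
  then have "\<not> inj (\<lambda>n::nat. z ^ n)" using L(2) finite_subset range_inj_infinite by blast
  then obtain i j :: nat where ij: "i \<noteq> j" "z ^ i = z ^ j" by (auto simp: inj_on_def)
  define p :: "'a poly" where "p = Polynomial.monom 1 i - Polynomial.monom 1 j"
  have "Polynomial.coeff p i = 1" using ij by (simp add: p_def)
  then have "p \<noteq> 0" by auto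
  moreover have "p \<in> polys k" unfolding p_def
    by (intro polys_closed subfld_subrng k subrngD)
  moreover have "poly p z = 0" using ij by (simp add: p_def poly_monom)
  ultimately show "z \<in> algebraics k" by (auto simp: algebraics_def)
qed

lemma finite_algebraics_in_finite_subfld:
  assumes "finite A" "A \<subseteq> algebraics k"
  shows "\<exists>L. subfld L \<and> finite L \<and> k \<subseteq> L \<and> A \<subseteq> L"
  using assms
proof (induction A rule: finite_induct)
  case empty
  then show ?case using k by auto
next
  case (insert z A)
  then obtain L where L: "subfld L" "finite L" "k \<subseteq> L" "A \<subseteq> L" by auto
  obtain p where "p \<in> polys k" "p \<noteq> 0" "poly p z = 0" using insert by (auto simp: algebraics_def)
  then show ?case using adjoin_root_finite[OF L(1,2), of p z] polys_mono[OF L(3)] L by blast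
qed

lemma algebraics_superset: "k \<subseteq> algebraics k"
  using algebraics_finite_iff k by auto

lemma algebraics_subfld: "subfld (algebraics k)"
proof (rule subfldI)
  have *: "\<exists>L. subfld L \<and> finite L \<and> k \<subseteq> L \<and> {a, b} \<subseteq> L" if "a \<in> algebraics k" "b \<in> algebraics k" for a b
    using finite_algebraics_in_finite_subfld[of "{a, b}"] that by auto
  show "1 \<in> algebraics k"
    using algebraics_superset subrngD(2)[OF subfld_subrng[OF k(1)]] by auto
  show "a - b \<in> algebraics k" "a * b \<in> algebraics k" if ab: "a \<in> algebraics k" "b \<in> algebraics k" for a b
  proof -
    obtain L where L: "subfld L" "finite L" "k \<subseteq> L" "a \<in> L" "b \<in> L" using *[OF ab] by auto
    then have "a - b \<in> L" "a * b \<in> L" using subrngD[OF subfld_subrng[OF L(1)]] by auto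
    then show "a - b \<in> algebraics k" "a * b \<in> algebraics k"
      unfolding algebraics_finite_iff using L by blast+
  qed
  show "inverse a \<in> algebraics k" if "a \<in> algebraics k" for a
    using that subfldD(1) unfolding algebraics_finite_iff by blast
qed

text \<open>Transitivity of algebraicity: the finitely many coefficients lie in a common finite
  subfield, and adjoining \<open>z\<close> to it gives a finite field again.\<close>

lemma root_over_algebraics:
  assumes p: "p \<in> polys (algebraics k)" "p \<noteq> 0" "poly p z = 0"
  shows "z \<in> algebraics k"
proof -
  have "set (coeffs p) \<subseteq> algebraics k" using p(1) by (auto simp: polys_def coeffs_def)
  then obtain L where L: "subfld L" "finite L" "k \<subseteq> L" "set (coeffs p) \<subseteq> L"
    using finite_algebraics_in_finite_subfld[of "set (coeffs p)"] by auto
  have "Polynomial.coeff p i \<in> L" for i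
    using L(4) subrngD(1)[OF subfld_subrng[OF L(1)]] coeff_in_coeffs[of p i] p(2) coeff_eq_0[of p i]
    by (cases "i \<le> Polynomial.degree p") auto
  then have "p \<in> polys L" by (auto simp: polys_def)
  from adjoin_root_finite[OF L(1,2) this p(2,3)] L(3) show ?thesis
    unfolding algebraics_finite_iff by blast
qed

end

section \<open>Valuation rings and places\<close>

text \<open>The maximal ideal when \<open>V\<close> is a valuation ring. Since
  \<open>inverse 0 = 0\<close> belongs to \<open>V\<close>, zero is listed separately.\<close>

definition nonunits :: "'a::field set \<Rightarrow> 'a set" where
  "nonunits V = {z\<in>V. z = 0 \<or> inverse z \<notin> V}"

lemma nonunits_subset: "nonunits V \<subseteq> V"
  by (auto simp: nonunits_def)

locale valuation_subring =
  fixes k F V :: "'a::field set"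
  assumes subfld_F: "subfld F" and V: "V \<in> valuation_rings k F"
begin

lemma subrng_V: "subrng V" and k_V: "k \<subset> V" and V_F: "V \<subset> F"
  and V_or: "z \<in> F \<Longrightarrow> z \<in> V \<or> inverse z \<in> V"
  using V by (auto simp: valuation_rings_def)

lemma V_in_F: "z \<in> V \<Longrightarrow> z \<in> F"
  using V_F by auto

lemma nonunits_in_V: "z \<in> nonunits V \<Longrightarrow> z \<in> V"
  by (auto simp: nonunits_def)

lemmas V_closed = subrngD[OF subrng_V]
lemmas F_closed = subrngD[OF subfld_subrng[OF subfld_F]] subfldD[OF subfld_F] subfld_powi[OF subfld_F]

lemma nonunits_mult: "z \<in> nonunits V \<Longrightarrow> w \<in> V \<Longrightarrow> w * z \<in> nonunits V"
proof -
  assume z: "z \<in> nonunits V" and w: "w \<in> V"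
  have "inverse (w * z) \<notin> V" if "w * z \<noteq> 0"
  proof
    assume "inverse (w * z) \<in> V"
    then have "w * inverse (w * z) \<in> V" using w V_closed by auto
    moreover have "w * inverse (w * z) = inverse z" using that by (simp add: field_simps)
    ultimately show False using z that
      unfolding nonunits_def by (metis (mono_tags, lifting) mem_Collect_eq mult_zero_right)
  qed
  then show ?thesis using z w V_closed by (auto simp: nonunits_def)
qed

lemma nonunits_uminus: "z \<in> nonunits V \<Longrightarrow> - z \<in> nonunits V"
  using nonunits_mult[of z "- 1"] V_closed by auto

text \<open>One of \<open>z / w\<close> and \<open>w / z\<close> lies in \<open>V\<close>, so the
  sum is an element of \<open>V\<close> times one of the two nonunits.\<close>

lemma nonunits_add:
  assumes "z \<in> nonunits V" "w \<in> nonunits V"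
  shows "z + w \<in> nonunits V"
proof -
  have *: "z + w \<in> nonunits V" if "z \<in> nonunits V" "w \<in> nonunits V" "z / w \<in> V" "w \<noteq> 0" for z w
  proof -
    have "z + w = (z / w + 1) * w" using that by (simp add: field_simps)
    then show ?thesis using nonunits_mult[OF that(2), of "z / w + 1"] that V_closed by auto
  qed
  show ?thesis
  proof (cases "z = 0 \<or> w = 0")
    case True
    then show ?thesis using assms by auto
  next
    case False
    have "z / w \<in> F" using F_closed(8)[OF V_in_F V_in_F] assms nonunits_in_V by auto
    then have "z / w \<in> V \<or> w / z \<in> V" using V_or[of "z / w"] by simp
    then show ?thesis using *[OF assms] *[OF assms(2,1)] False by (auto simp: add.commute)
  qed
qed

lemma nonunits_0: "0 \<in> nonunits V" and one_notin_nonunits: "1 \<notin> nonunits V"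
  using V_closed by (auto simp: nonunits_def)

lemma nonunits_diff: "z \<in> nonunits V \<Longrightarrow> w \<in> nonunits V \<Longrightarrow> z - w \<in> nonunits V"
  using nonunits_add[of z "- w"] nonunits_uminus[of w] by auto

lemma ring_on_carrier: "ring (on_carrier V)"
proof -
  interpret ring "ring_of_type_algebra :: 'a ring" by (rule ring_from_type_algebra)
  show ?thesis by (rule subring_is_ring[OF subrng_V])
qed

lemma ideal_nonunits: "ideal (nonunits V) (on_carrier V)"
proof (rule idealI[OF ring_on_carrier])
  interpret ring "on_carrier V" by (rule ring_on_carrier)
  have m: "a_inv (on_carrier V) z = - z" if "z \<in> V" for z
    by (rule minus_equality) (use that V_closed in auto)
  show "subgroup (nonunits V) (add_monoid (on_carrier V))"
  proof (rule add.subgroupI)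
    show "nonunits V \<noteq> {}" using nonunits_0 by auto
    show "\<ominus>\<^bsub>on_carrier V\<^esub> a \<in> nonunits V" if "a \<in> nonunits V" for a
      using that m nonunits_uminus nonunits_subset[of V] by auto
  qed (use nonunits_subset[of V] nonunits_add in auto)
qed (use nonunits_mult in \<open>auto simp: mult.commute\<close>)

lemma ideal_without_1:
  assumes "ideal J (on_carrier V)" "1 \<notin> J"
  shows "J \<subseteq> nonunits V"
proof
  interpret J: ideal J "on_carrier V" by fact
  fix z assume z: "z \<in> J"
  have "z \<in> V" using J.Icarr[OF z] by simp
  moreover have "inverse z \<notin> V" if "z \<noteq> 0"
    using J.I_l_closed[OF z, of "inverse z"] assms(2) that by auto
  ultimately show "z \<in> nonunits V" by (auto simp: nonunits_def)
qed

text \<open>An ideal containing a unit contains 1. Hence every proper ideal consists of nonunits,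
  and these themselves form an ideal.\<close>

lemma maximalideal_iff: "maximalideal P (on_carrier V) \<longleftrightarrow> P = nonunits V"
proof
  assume "maximalideal P (on_carrier V)"
  then interpret P: maximalideal P "on_carrier V" .
  have "1 \<notin> P" using P.one_imp_carrier P.I_notcarr by auto
  then have "P \<subseteq> nonunits V" using ideal_without_1 P.is_ideal by auto
  then have "nonunits V = P \<or> nonunits V = V"
    using P.I_maximal[OF ideal_nonunits] nonunits_subset by auto
  then show "P = nonunits V" using one_notin_nonunits V_closed by auto
next
  assume P: "P = nonunits V"
  show "maximalideal P (on_carrier V)"
  proof (rule maximalidealI)
    fix J assume J: "ideal J (on_carrier V)" "P \<subseteq> J" "J \<subseteq> carrier (on_carrier V)"
    interpret J: ideal J "on_carrier V" by fact
    show "J = P \<or> J = carrier (on_carrier V)"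
      using ideal_without_1[OF J(1)] J(2) P J.one_imp_carrier by auto
  qed (use ideal_nonunits P one_notin_nonunits V_closed in auto)
qed

lemma nonunits_in_places: "nonunits V \<in> places k F"
  using V maximalideal_iff by (auto simp: places_def)

text \<open>A place determines its valuation ring. Places are compared through this, and it
  identifies the ring used in \<open>valuation\<close> and \<open>residue_field\<close>.\<close>

lemma ring_of_place_nonunits: "ring_of_place F (nonunits V) = V"
proof
  show "ring_of_place F (nonunits V) \<subseteq> V"
    using V_or V_closed by (auto simp: ring_of_place_def nonunits_def)
  show "V \<subseteq> ring_of_place F (nonunits V)"
    using V_F by (auto simp: ring_of_place_def nonunits_def)
qed

lemma unit_iff: "u \<in> V - nonunits V \<longleftrightarrow> u \<noteq> 0 \<and> u \<in> V \<and> inverse u \<in> V"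
  by (auto simp: nonunits_def)

lemma unit_mult: "u \<in> V - nonunits V \<Longrightarrow> w \<in> V - nonunits V \<Longrightarrow> u * w \<in> V - nonunits V"
  unfolding unit_iff using V_closed by auto

lemma unit_inverse: "u \<in> V - nonunits V \<Longrightarrow> inverse u \<in> V - nonunits V"
  unfolding unit_iff by auto

lemma unit_powi: "u \<in> V - nonunits V \<Longrightarrow> u powi n \<in> V - nonunits V"
  unfolding unit_iff using subrng_power[OF subrng_V, of u] subrng_power[OF subrng_V, of "inverse u"]
  by (auto simp: power_int_def power_inverse)

lemma inverse_nonunit: "z \<in> F \<Longrightarrow> z \<notin> V \<Longrightarrow> inverse z \<in> nonunits V"
  using V_or[of z] by (auto simp: nonunits_def)

lemma unit_add_nonunit:
  assumes "u \<in> V - nonunits V" "z \<in> nonunits V"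
  shows "u + z \<in> V - nonunits V"
proof -
  have "u + z \<in> V" using assms V_closed nonunits_subset[of V] by auto
  moreover have "u + z \<notin> nonunits V"
    using nonunits_diff[of "u + z" z] assms by auto
  ultimately show ?thesis by auto
qed

lemma powi_pos_nonunit: "s \<in> nonunits V \<Longrightarrow> n > 0 \<Longrightarrow> s powi n \<in> nonunits V"
proof -
  assume s: "s \<in> nonunits V" and n: "n > 0"
  obtain m where m: "nat n = Suc m" using n by (cases "nat n") auto
  have "s powi n = s ^ m * s" using n m by (simp add: power_int_def)
  then show ?thesis using nonunits_mult[OF s, of "s ^ m"] subrng_power[OF subrng_V, of s m] s nonunits_subset[of V] by auto
qed


section \<open>Residue classes and places of degree one\<close>

lemma coset_eq: "nonunits V +>\<^bsub>on_carrier V\<^esub> a = (\<lambda>z. z + a) ` nonunits V"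
  by (auto simp: a_r_coset_def r_coset_def)

lemma coset_eq_iff: "nonunits V +>\<^bsub>on_carrier V\<^esub> a = nonunits V +>\<^bsub>on_carrier V\<^esub> b \<longleftrightarrow> a - b \<in> nonunits V"
proof
  assume "nonunits V +>\<^bsub>on_carrier V\<^esub> a = nonunits V +>\<^bsub>on_carrier V\<^esub> b"
  moreover have "a \<in> nonunits V +>\<^bsub>on_carrier V\<^esub> a" unfolding coset_eq using nonunits_0 by (intro image_eqI[of _ _ 0]) auto
  ultimately obtain z where "z \<in> nonunits V" "a = z + b" by (auto simp: coset_eq)
  then show "a - b \<in> nonunits V" by simp
next
  assume ab: "a - b \<in> nonunits V"
  have *: "z + c \<in> (\<lambda>z. z + d) ` nonunits V" if "z \<in> nonunits V" "c - d \<in> nonunits V" for z c d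
    using nonunits_add[OF that] by (intro image_eqI[of _ _ "z + (c - d)"]) auto
  show "nonunits V +>\<^bsub>on_carrier V\<^esub> a = nonunits V +>\<^bsub>on_carrier V\<^esub> b"
    unfolding coset_eq using *[OF _ ab] *[of _ b a] nonunits_uminus[OF ab] by auto
qed

text \<open>Dimension one means that the residue field is a line over the image of \<open>k\<close>.
  As it contains the class of 1, the line is that image, so every residue is a constant.\<close>

lemma place_degree_one_iff:
  assumes k: "subfld k"
  shows "place_degree_is k F (nonunits V) 1 \<longleftrightarrow> (\<forall>z\<in>V. \<exists>c\<in>k. z - c \<in> nonunits V)"
proof -
  define R where "R = on_carrier V Quot nonunits V"
  let ?c = "\<lambda>a. nonunits V +>\<^bsub>on_carrier V\<^esub> a"
  interpret I: ideal "nonunits V" "on_carrier V" by (rule ideal_nonunits)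
  interpret R: ring R unfolding R_def by (rule I.quotient_is_ring)
  have carR: "carrier R = ?c ` V" by (auto simp: R_def FactRing_def A_RCOSETS_def')
  have zR: "\<zero>\<^bsub>R\<^esub> = ?c 0" by (simp add: R_def FactRing_def coset_eq)
  have mR: "?c a \<otimes>\<^bsub>R\<^esub> ?c b = ?c (a * b)" if "a \<in> V" "b \<in> V" for a b
    using I.rcoset_mult_add[of a b] that by (simp add: R_def FactRing_def)
  have aR: "?c a \<oplus>\<^bsub>R\<^esub> ?c b = ?c (a + b)" if "a \<in> V" "b \<in> V" for a b
    using I.a_rcos_sum[of a b] that by (simp add: R_def FactRing_def)
  have kV: "c \<in> V" if "c \<in> k" for c using that k_V by auto
  have zero_res: "?c a = ?c 0 \<longleftrightarrow> a \<in> nonunits V" for a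
    using coset_eq_iff[of a 0] by simp
  have line: "z \<in> R.line_extension (?c ` k) (?c w) {?c 0} \<longleftrightarrow> (\<exists>d\<in>k. z = ?c (d * w))" if "w \<in> V" for z w
    unfolding R.line_extension_mem_iff
    using that mR aR kV V_closed by auto
  have "place_degree_is k F (nonunits V) 1 \<longleftrightarrow> R.dimension 1 (?c ` k) (carrier R)"
    by (simp add: place_degree_is_def residue_field_def ring_of_place_nonunits R_def)
  also have "\<dots> \<longleftrightarrow> (\<forall>z\<in>V. \<exists>c\<in>k. z - c \<in> nonunits V)"
  proof
    assume "R.dimension 1 (?c ` k) (carrier R)"
    then obtain w' where w': "w' \<in> carrier R" "carrier R = R.line_extension (?c ` k) w' {?c 0}"
    proof cases
      case (Suc_dim v E n)
      have "R.dimension 0 (?c ` k) E" using Suc_dim by simp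
      then have "E = {?c 0}" by cases (auto simp: zR)
      then show ?thesis using that Suc_dim by auto
    qed auto
    then obtain w where w: "w \<in> V" "w' = ?c w" using carR by (metis imageE)
    have gen: "\<exists>d\<in>k. z - d * w \<in> nonunits V" if "z \<in> V" for z
      using that line[OF w(1), of "?c z"] w' w carR coset_eq_iff[of z] by blast
    \<comment> \<open>The spanning class \<open>w\<close> need not be 1. Expressing 1 as
      \<open>c * w\<close> makes \<open>w\<close> the class of \<open>1 / c\<close>, and
      \<open>d * w\<close> that of \<open>d / c\<close>.\<close>
    obtain c where c: "c \<in> k" "1 - c * w \<in> nonunits V" using gen[OF V_closed(2)] by blast
    have c0: "c \<noteq> 0" using c one_notin_nonunits by auto
    show "\<forall>z\<in>V. \<exists>c\<in>k. z - c \<in> nonunits V"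
    proof
      fix z assume "z \<in> V"
      with gen obtain d where d: "d \<in> k" "z - d * w \<in> nonunits V" by auto
      have dc: "d / c \<in> k" using subfldD[OF k] c d by auto
      have "z - d / c = (z - d * w) - (d / c) * (1 - c * w)" using c0 by (simp add: field_simps)
      then have "z - d / c \<in> nonunits V"
        using nonunits_diff[OF d(2) nonunits_mult[OF c(2) kV[OF dc]]] by (simp only:)
      then show "\<exists>c\<in>k. z - c \<in> nonunits V" using dc by auto
    qed
  next
    assume res: "\<forall>z\<in>V. \<exists>c\<in>k. z - c \<in> nonunits V"
    have "carrier R = R.line_extension (?c ` k) (?c 1) {?c 0}"
    proof (intro Set.set_eqI)
      fix z
      have "?c ` V = ?c ` k"
      proof
        show "?c ` V \<subseteq> ?c ` k"
        proof
          fix A assume "A \<in> ?c ` V"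
          then obtain a where a: "a \<in> V" "A = ?c a" by auto
          then obtain d where d: "d \<in> k" "a - d \<in> nonunits V" using res by auto
          then have "A = ?c d" using coset_eq_iff[of a d] a(2) by auto
          then show "A \<in> ?c ` k" using d by auto
        qed
      qed (use kV in auto)
      then have "z \<in> ?c ` V \<longleftrightarrow> (\<exists>d\<in>k. z = ?c d)" by auto
      then show "z \<in> carrier R \<longleftrightarrow> z \<in> R.line_extension (?c ` k) (?c 1) {?c 0}"
        using line[of 1 z] V_closed(2) carR by simp
    qed
    moreover have "R.dimension (Suc 0) (?c ` k) (R.line_extension (?c ` k) (?c 1) {?c 0})"
      using R.zero_dim[of "?c ` k"] V_closed(2) one_notin_nonunits zero_res[of 1]
      by (intro R.Suc_dim) (auto simp: zR carR)
    ultimately show "R.dimension 1 (?c ` k) (carrier R)" by simp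
  qed
  finally show ?thesis .
qed

end

lemma places_iff:
  assumes "subfld F"
  shows "P \<in> places k F \<longleftrightarrow> (\<exists>V\<in>valuation_rings k F. P = nonunits V)"
proof -
  have "maximalideal P (on_carrier V) \<longleftrightarrow> P = nonunits V" if "V \<in> valuation_rings k F" for V
    using valuation_subring.maximalideal_iff[of k F V P] that assms by (simp add: valuation_subring_def)
  then show ?thesis by (auto simp: places_def)
qed


section \<open>Discrete valuations\<close>

text \<open>Asks for a decomposition of all nonzero elements of \<open>F\<close> and not only for a
  principal maximal ideal: the latter also holds for some valuation rings of higher rank, where the
  powers of a generator do not reach every element up to units.\<close>

definition uniformizer :: "'a::field set \<Rightarrow> 'a set \<Rightarrow> 'a \<Rightarrow> bool" where
  "uniformizer F V t \<longleftrightarrow> t \<noteq> 0 \<and> t \<in> nonunits V \<and>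
     (\<forall>z\<in>F - {0}. \<exists>n::int. \<exists>u\<in>V - nonunits V. z = t powi n * u)"

locale discrete_valuation_subring = valuation_subring +
  fixes t
  assumes t: "uniformizer F V t"
begin

lemma t_nz: "t \<noteq> 0" and t_nonunit: "t \<in> nonunits V"
  and decompose: "z \<in> F \<Longrightarrow> z \<noteq> 0 \<Longrightarrow> \<exists>n::int. \<exists>u\<in>V - nonunits V. z = t powi n * u"
  using t by (auto simp: uniformizer_def)

lemma unit_powi_eq_0:
  assumes "s \<in> nonunits V" "s \<noteq> 0" "s powi n \<in> V - nonunits V"
  shows "n = 0"
proof (rule ccontr)
  assume "n \<noteq> 0"
  moreover have "s powi (-n) \<in> V - nonunits V"
    using unit_inverse[OF assms(3)] assms(2) by (simp add: power_int_minus)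
  ultimately show False using powi_pos_nonunit[OF assms(1), of n] powi_pos_nonunit[OF assms(1), of "-n"] assms(3)
    by (cases "n > 0") auto
qed

lemma powi_unit_nonunit_iff:
  assumes u: "u \<in> V - nonunits V"
  shows "t powi n * u \<in> nonunits V \<longleftrightarrow> n > 0"
proof
  assume nu: "t powi n * u \<in> nonunits V"
  show "n > 0"
  proof (rule ccontr)
    assume "\<not> n > 0"
    then have "t powi (-n) \<in> V" using subrng_power[OF subrng_V, of t] t_nonunit nonunits_subset[of V] by (auto simp: power_int_def)
    from nonunits_mult[OF nu this] have "u \<in> nonunits V"
      using t_nz by (simp add: power_int_minus field_simps)
    then show False using u by auto
  qed
next
  assume "n > 0"
  then show "t powi n * u \<in> nonunits V"
    using nonunits_mult[OF powi_pos_nonunit[OF t_nonunit], of n u] u by (auto simp: mult.commute)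
qed

lemma nonunits_eq: "nonunits V = (\<lambda>w. t * w) ` V"
proof (intro Set.set_eqI iffI)
  fix z assume z: "z \<in> nonunits V"
  show "z \<in> (\<lambda>w. t * w) ` V"
  proof (cases "z = 0")
    case True
    then show ?thesis using V_closed by (intro image_eqI[of _ _ 0]) auto
  next
    case False
    then obtain n u where nu: "u \<in> V - nonunits V" "z = t powi n * u"
      using decompose[of z] z V_F nonunits_subset[of V] by blast
    then have n: "n > 0" using powi_unit_nonunit_iff z by auto
    then have "t powi n = t * t powi (n - 1)" using t_nz power_int_add_1'[of t "n - 1"] by simp
    moreover have "t powi (n - 1) \<in> V"
      using n subrng_power[OF subrng_V, of t] t_nonunit nonunits_subset[of V] by (auto simp: power_int_def)
    ultimately show ?thesis using nu V_closed by (intro image_eqI[of _ _ "t powi (n - 1) * u"]) auto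
  qed
next
  fix z assume "z \<in> (\<lambda>w. t * w) ` V"
  then show "z \<in> nonunits V" using nonunits_mult[OF t_nonunit] by (auto simp: mult.commute)
qed

text \<open>The description in \<open>valuation\<close> admits every generator of the maximal ideal.
  Two generators differ by a unit \<open>w\<close>, so \<open>t powi (n - m)\<close> is a unit,
  which forces \<open>n = m\<close>.\<close>

lemma valuation_eqI:
  assumes z: "z = t powi n * u" and u: "u \<in> V - nonunits V"
  shows "valuation F (nonunits V) z = n"
  unfolding valuation_def ring_of_place_nonunits
proof (rule the_equality)
  show "\<exists>t u. t \<in> nonunits V \<and> nonunits V = (*) t ` V \<and> u \<in> V - nonunits V \<and> z = t powi n * u"
    by (rule exI[of _ t], rule exI[of _ u]) (intro conjI t_nonunit u z nonunits_eq)
next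
  fix m assume "\<exists>t u. t \<in> nonunits V \<and> nonunits V = (*) t ` V \<and> u \<in> V - nonunits V \<and> z = t powi m * u"
  then obtain t' u' where *: "t' \<in> nonunits V" "nonunits V = (*) t' ` V" "u' \<in> V - nonunits V" "z = t' powi m * u'"
    by blast
  obtain w where w: "w \<in> V" "t' = t * w" using *(1) nonunits_eq by auto
  obtain w' where w': "w' \<in> V" "t = t' * w'" using *(2) t_nonunit by auto
  have "t * (w * w') = t * 1" by (metis w(2) w'(2) mult.assoc mult_1_right)
  then have "w * w' = 1" using t_nz by (metis mult_left_cancel)
  then have "w \<noteq> 0" "w' = inverse w" by (auto simp: inverse_unique)
  then have wu: "w \<in> V - nonunits V" using w w' unit_iff by auto
  have "t powi n * u = (t powi m * w powi m) * u'" using * z w(2) by (simp add: power_int_mult_distrib)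
  then have "t powi (n - m) = w powi m * u' * inverse u"
  proof -
    have "t powi (n - m) = t powi n * u * inverse u * inverse (t powi m)"
      using u unit_iff[of u] t_nz by (simp add: power_int_diff divide_inverse)
    also have "\<dots> = t powi m * w powi m * u' * inverse u * inverse (t powi m)"
      using \<open>t powi n * u = _\<close> by simp
    also have "\<dots> = w powi m * u' * inverse u * (t powi m * inverse (t powi m))"
      by (simp only: mult_ac)
    finally show ?thesis using t_nz by simp
  qed
  then have "t powi (n - m) \<in> V - nonunits V"
    using unit_mult[OF unit_mult[OF unit_powi[OF wu] *(3)] unit_inverse[OF u]] by simp
  then have "n - m = 0" by (rule unit_powi_eq_0[OF t_nonunit t_nz])
  then show "m = n" by simp
qed

abbreviation v where "v \<equiv> valuation F (nonunits V)"

lemma v_t: "v t = 1"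
  by (rule valuation_eqI[of _ _ 1]) (use V_closed one_notin_nonunits in auto)

lemma v_unit: "u \<in> V - nonunits V \<Longrightarrow> v u = 0"
  by (rule valuation_eqI[of _ _ u]) auto

lemma v_mult:
  assumes "z \<in> F - {0}" "w \<in> F - {0}"
  shows "v (z * w) = v z + v w"
proof -
  obtain n u where nu: "u \<in> V - nonunits V" "z = t powi n * u" using decompose assms by blast
  obtain m u' where mu: "u' \<in> V - nonunits V" "w = t powi m * u'" using decompose assms by blast
  have "z * w = t powi (n + m) * (u * u')" using nu mu t_nz by (simp add: power_int_add)
  from valuation_eqI[OF this unit_mult[OF nu(1) mu(1)]] valuation_eqI[OF nu(2,1)] valuation_eqI[OF mu(2,1)]
  show ?thesis by simp
qed

lemma v_inverse:
  assumes "z \<in> F - {0}"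
  shows "v (inverse z) = - v z"
proof -
  have "v (z * inverse z) = v z + v (inverse z)" using assms F_closed by (intro v_mult) auto
  moreover have "v 1 = 0" using v_unit[of 1] V_closed one_notin_nonunits by auto
  ultimately show ?thesis using assms by simp
qed

lemma v_divide:
  assumes "z \<in> F - {0}" "w \<in> F - {0}"
  shows "v (z / w) = v z - v w"
  using v_mult[of z "inverse w"] v_inverse[of w] assms F_closed(7)[of w] by (simp add: divide_inverse)

lemma nonunit_iff_v: "z \<in> F - {0} \<Longrightarrow> z \<in> nonunits V \<longleftrightarrow> v z > 0"
proof -
  assume "z \<in> F - {0}"
  then obtain n u where nu: "u \<in> V - nonunits V" "z = t powi n * u" using decompose[of z] by auto
  show ?thesis unfolding valuation_eqI[OF nu(2,1)] unfolding nu(2) by (rule powi_unit_nonunit_iff[OF nu(1)])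
qed

lemma in_V_iff_v: "z \<in> F - {0} \<Longrightarrow> z \<in> V \<longleftrightarrow> v z \<ge> 0"
  using nonunit_iff_v[of "inverse z"] v_inverse[of z] F_closed(7)[of z] V_or[of z]
  by (auto simp: nonunits_def)

lemma unit_iff_v: "z \<in> F - {0} \<Longrightarrow> z \<in> V - nonunits V \<longleftrightarrow> v z = 0"
  using nonunit_iff_v[of z] in_V_iff_v[of z] by auto

end

lemma discrete_valuation_subringI:
  assumes "subfld F" "V \<in> valuation_rings k F" "uniformizer F V t"
  shows "discrete_valuation_subring k F V t"
  using assms
  by (intro discrete_valuation_subring.intro valuation_subring.intro discrete_valuation_subring_axioms.intro)


text \<open>The additive law is demanded only for nonnegative values, which is closure of
  \<open>V\<close> under sums. The element of value 1 is the uniformizer, because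
  \<open>t powi - v z * z\<close> has value 0 and is therefore a unit.\<close>

lemma valuation_ring_of_map:
  fixes v :: "'a::field \<Rightarrow> int"
  assumes k: "subfld k" "k \<subseteq> F" and F: "subfld F"
    and mult: "\<And>z w. z \<in> F - {0} \<Longrightarrow> w \<in> F - {0} \<Longrightarrow> v (z * w) = v z + v w"
    and add: "\<And>z w. z \<in> F - {0} \<Longrightarrow> w \<in> F - {0} \<Longrightarrow> z + w \<noteq> 0 \<Longrightarrow> v z \<ge> 0 \<Longrightarrow> v w \<ge> 0 \<Longrightarrow> v (z + w) \<ge> 0"
    and const: "\<And>c. c \<in> k - {0} \<Longrightarrow> v c = 0"
    and t: "t \<in> F - {0}" "v t = 1"
  defines "V \<equiv> {z\<in>F. z = 0 \<or> v z \<ge> 0}"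
  shows "V \<in> valuation_rings k F" "uniformizer F V t" "\<And>z. z \<in> F - {0} \<Longrightarrow> valuation F (nonunits V) z = v z"
proof -
  note F_closed = subrngD[OF subfld_subrng[OF F]] subfldD[OF F] subfld_powi[OF F]
  have one: "v 1 = 0" using const[of 1] subrngD(2)[OF subfld_subrng[OF k(1)]] by auto
  have inv: "v (inverse z) = - v z" if "z \<in> F - {0}" for z
  proof -
    have "z * inverse z = 1" using that by simp
    then have "v 1 = v z + v (inverse z)"
      using mult[of z "inverse z"] that F_closed(7)[of z] by simp
    then show ?thesis using one by simp
  qed
  have "- 1 \<in> k" using subrngD(2)[OF subfld_subrng[OF k(1)]] subrngD(3)[OF subfld_subrng[OF k(1)]] by blast
  then have m1: "v (- 1) = 0"
    using const[of "- 1"] by simp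
  have neg: "v (- z) = v z" if "z \<in> F - {0}" for z
    using mult[of "-1" z] m1 that F_closed(3)[of 1] F_closed(2) by auto
  show VV: "V \<in> valuation_rings k F"
    unfolding valuation_rings_def
  proof (intro CollectI conjI)
    show "subrng V"
    proof (rule subrngI)
      show "1 \<in> V" using one F_closed by (auto simp: V_def)
      show "a * b \<in> V" if "a \<in> V" "b \<in> V" for a b
        using that mult[of a b] F_closed(5)[of a b] F_closed(1) by (cases "a = 0"; cases "b = 0") (auto simp: V_def)
      show "a - b \<in> V" if "a \<in> V" "b \<in> V" for a b
        using that add[of a "- b"] neg[of b] F_closed(1) F_closed(3)[of b] F_closed(6)[of a b] by (cases "a = 0"; cases "b = 0"; cases "a = b") (auto simp: V_def)
    qed
    have "t \<in> V" using t by (auto simp: V_def)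
    moreover have "t \<notin> k" using const[of t] t by auto
    moreover have "k \<subseteq> V" using const k(2) by (force simp: V_def)
    ultimately show "k \<subset> V" by auto
    have "inverse t \<in> F" "inverse t \<notin> V" using inv[of t] t F_closed(7)[of t] by (auto simp: V_def)
    moreover have "V \<subseteq> F" by (auto simp: V_def)
    ultimately show "V \<subset> F" by auto
    show "\<forall>z\<in>F. z \<in> V \<or> inverse z \<in> V" using inv F_closed(7) by (force simp: V_def)
  qed
  interpret valuation_subring k F V by (rule valuation_subring.intro[OF F VV])
  have unit: "u \<in> V - nonunits V" if "u \<in> F - {0}" "v u = 0" for u
    unfolding unit_iff using that inv[OF that(1)] F_closed(7)[of u] by (auto simp: V_def)
  have pw: "v (t ^ n) = int n" for n :: nat
    using t by (induction n) (auto simp: one mult subrng_power[OF subfld_subrng[OF F]])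
  have pwi: "v (t powi n) = n" for n
  proof (cases "n \<ge> 0")
    case False
    then show ?thesis using pw[of "nat (-n)"] inv[of "t ^ nat (-n)"] t subrng_power[OF subfld_subrng[OF F], of t]
      by (simp add: power_int_def power_inverse)
  qed (auto simp: pw power_int_def)
  have dec: "\<exists>u\<in>V - nonunits V. z = t powi v z * u" if z: "z \<in> F - {0}" for z
  proof
    have tF: "t powi - v z \<in> F - {0}" using t F_closed(9)[of t] by auto
    show "z = t powi v z * (t powi - v z * z)" using t z by (simp add: power_int_minus)
    show "t powi - v z * z \<in> V - nonunits V"
      using unit[of "t powi - v z * z"] mult[OF tF z] pwi[of "- v z"] F_closed(5)[of "t powi - v z" z] tF z by auto
  qed
  show unif: "uniformizer F V t"
    unfolding uniformizer_def
  proof (intro conjI ballI)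
    show "t \<in> nonunits V" using t inv[of t] by (auto simp: nonunits_def V_def)
    show "\<exists>n. \<exists>u\<in>V - nonunits V. z = t powi n * u" if "z \<in> F - {0}" for z using dec[OF that] by blast
  qed (use t in auto)
  interpret discrete_valuation_subring k F V t by (rule discrete_valuation_subringI[OF F VV unif])
  show "valuation F (nonunits V) z = v z" if "z \<in> F - {0}" for z
    using dec[OF that] valuation_eqI by blast
qed


text \<open>A local ring whose nonunits are multiples of \<open>t\<close> is a discrete valuation
  ring once no nonzero element is infinitely divisible by \<open>t\<close>. The assumption
  \<open>bnd\<close> excludes this: each nonzero element divides a power of \<open>t\<close> times a
  unit.\<close>

lemma valuation_ring_of_local_ring:
  fixes R :: "'a::field set"
  assumes k: "subfld k" "k \<subseteq> R" and F: "subfld F" "R \<subseteq> F" and R: "subrng R"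
    and t: "t \<in> R" "t \<noteq> 0" "inverse t \<notin> R"
    and loc: "\<And>r. r \<in> R \<Longrightarrow> r = 0 \<or> inverse r \<in> R \<or> (\<exists>r'\<in>R. r = t * r')"
    and bnd: "\<And>r. r \<in> R \<Longrightarrow> r \<noteq> 0 \<Longrightarrow> \<exists>r'\<in>R. \<exists>m::nat. \<exists>u\<in>R. inverse u \<in> R \<and> u \<noteq> 0 \<and> r * r' = t ^ m * u"
    and frac: "\<And>z. z \<in> F \<Longrightarrow> \<exists>r\<in>R. \<exists>s\<in>R. s \<noteq> 0 \<and> z = r / s"
  shows "R \<in> valuation_rings k F" "uniformizer F R t"
proof -
  note R_closed = subrngD[OF R] subrng_power[OF R]
  define U where "U = {u\<in>R. u \<noteq> 0 \<and> inverse u \<in> R}"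
  have Umult: "u * w \<in> U" if "u \<in> U" "w \<in> U" for u w using that R_closed by (auto simp: U_def)
  have Uinv: "inverse u \<in> U" if "u \<in> U" for u using that by (auto simp: U_def)

  \<comment> \<open>If \<open>g\<close> is not a unit, it is a multiple of \<open>t\<close>, and
    cancelling one \<open>t\<close> lowers the exponent \<open>m\<close>. For \<open>m = 0\<close>
    the element divides a unit.\<close>
  have key: "\<exists>j. \<exists>w\<in>U. g = t ^ j * w" if "g \<in> R" "g' \<in> R" "u \<in> U" "g * g' = t ^ m * u" for g g' u and m :: nat
    using that
  proof (induction m arbitrary: g)
    case 0
    have "u \<noteq> 0" "inverse u \<in> R" using 0(3) by (auto simp: U_def)
    moreover from this have "g * (g' * inverse u) = 1" using 0(4) by (simp add: mult.assoc[symmetric])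
    moreover from this have "g \<noteq> 0" "inverse g = g' * inverse u" by (auto simp: inverse_unique)
    ultimately have "g \<in> U" using 0(1,2) R_closed(5) by (auto simp: U_def)
    then show ?case by (intro exI[of _ 0]) auto
  next
    case (Suc m)
    have g0: "g \<noteq> 0" using Suc.prems t by (auto simp: U_def)
    show ?case
    proof (cases "g \<in> U")
      case True
      then show ?thesis by (intro exI[of _ 0]) auto
    next
      case False
      then obtain g1 where g1: "g1 \<in> R" "g = t * g1" using loc[OF Suc.prems(1)] g0 Suc.prems by (auto simp: U_def)
      then have "g1 * g' = t ^ m * u" using Suc.prems(4) t by simp
      from Suc.IH[OF g1(1) Suc.prems(2,3) this] obtain j w where "w \<in> U" "g1 = t ^ j * w" by blast
      then show ?thesis using g1 by (intro exI[of _ "Suc j"]) auto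
    qed
  qed
  have dec: "\<exists>j::nat. \<exists>w\<in>U. g = t ^ j * w" if "g \<in> R" "g \<noteq> 0" for g
    using bnd[OF that] key[OF that(1)] by (auto simp: U_def)
  have decF: "\<exists>n::int. \<exists>w\<in>U. z = t powi n * w" if "z \<in> F" "z \<noteq> 0" for z
  proof -
    obtain r s where rs: "r \<in> R" "s \<in> R" "s \<noteq> 0" "z = r / s" using frac \<open>z \<in> F\<close> by blast
    then have "r \<noteq> 0" using that by auto
    obtain i w where i: "w \<in> U" "r = t ^ i * w" using dec[OF rs(1) \<open>r \<noteq> 0\<close>] by auto
    obtain j w' where j: "w' \<in> U" "s = t ^ j * w'" using dec[OF rs(2,3)] by auto
    have "z = t powi (int i - int j) * (w * inverse w')"
      using rs(4) i j t by (simp add: power_int_diff divide_inverse U_def)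
    then show ?thesis using Umult[OF i(1) Uinv[OF j(1)]] by blast
  qed
  have RR: "t powi n * w \<in> R" if "w \<in> U" "n \<ge> 0" for n w
    using that t R_closed by (auto simp: U_def power_int_def)
  show VV: "R \<in> valuation_rings k F"
    unfolding valuation_rings_def
  proof (intro CollectI conjI ballI)
    have "t \<notin> k" using t k subfldD(1)[OF k(1)] by auto
    then show "k \<subset> R" using k t by auto
    have "inverse t \<in> F" using t F subfldD(1)[OF F(1)] by auto
    then show "R \<subset> F" using F t by auto
    fix z assume z: "z \<in> F"
    show "z \<in> R \<or> inverse z \<in> R"
    proof (cases "z = 0")
      case False
      then obtain n w where nw: "w \<in> U" "z = t powi n * w" using decF z by blast
      then have "inverse z = t powi (-n) * inverse w" by (simp add: power_int_minus)
      then show ?thesis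
        using RR[OF nw(1), of n] RR[OF Uinv[OF nw(1)], of "- n"] nw(2) by (cases "n \<ge> 0") (simp_all only:, auto)
    qed (use R_closed in auto)
  qed (use R in auto)
  interpret valuation_subring k F R by (rule valuation_subring.intro[OF F(1) VV])
  have "U = R - nonunits R" by (auto simp: U_def nonunits_def)
  then show "uniformizer F R t"
    using decF t by (auto simp: uniformizer_def nonunits_def)
qed

section \<open>Extension of valuation rings\<close>

text \<open>
  Zorn's lemma is applied to the candidates \<open>N\<close> for the maximal ideal; the valuation ring is
  recovered from \<open>N\<close> as its idealizer.
\<close>

lemma extend_nonunits:
  fixes V m :: "'a::field set"
  assumes V: "subrng V" and m: "0 \<in> m" "1 \<notin> m" "\<And>a b. a \<in> m \<Longrightarrow> b \<in> m \<Longrightarrow> a - b \<in> m"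
    "\<And>a b. a \<in> V \<Longrightarrow> b \<in> m \<Longrightarrow> a * b \<in> m" and mV: "m \<subseteq> V"
  shows "\<exists>B. subrng B \<and> V \<subseteq> B \<and> m \<subseteq> nonunits B \<and> (\<forall>z. z \<in> B \<or> inverse z \<in> B)"
proof -
  \<comment> \<open>Closure under products places a candidate \<open>N\<close> inside its own
    idealizer; stability under \<open>V\<close> will place \<open>V\<close> there as well.\<close>
  define \<A> where "\<A> = {N. m \<subseteq> N \<and> 1 \<notin> N \<and> (\<forall>a\<in>N. \<forall>b\<in>N. a - b \<in> N \<and> a * b \<in> N) \<and> (\<forall>a\<in>V. \<forall>b\<in>N. a * b \<in> N)}"
  have "\<exists>M\<in>\<A>. \<forall>Y\<in>\<A>. M \<subseteq> Y \<longrightarrow> Y = M"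
  proof (rule subset_Zorn_nonempty)
    have "m \<in> \<A>" using m mV by (auto simp: \<A>_def)
    then show "\<A> \<noteq> {}" by auto
    fix C assume C: "C \<noteq> {}" "subset.chain \<A> C"
    have CA: "C \<subseteq> \<A>" using C by (simp add: subset.chain_def)
    have two: "\<exists>N\<in>C. a \<in> N \<and> b \<in> N" if "a \<in> \<Union>C" "b \<in> \<Union>C" for a b
    proof -
      obtain N N' where N: "N \<in> C" "a \<in> N" "N' \<in> C" "b \<in> N'" using \<open>a \<in> \<Union>C\<close> \<open>b \<in> \<Union>C\<close> by auto
      then have "N \<subseteq> N' \<or> N' \<subseteq> N" using C(2) unfolding subset.chain_def by blast
      then show ?thesis using N by blast
    qed
    have "a - b \<in> \<Union>C \<and> a * b \<in> \<Union>C" if "a \<in> \<Union>C" "b \<in> \<Union>C" for a b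
      using two[OF that] CA unfolding \<A>_def by blast
    moreover have "a * b \<in> \<Union>C" if "a \<in> V" "b \<in> \<Union>C" for a b
      using that CA unfolding \<A>_def by blast
    moreover have "m \<subseteq> \<Union>C" "1 \<notin> \<Union>C" using C(1) CA unfolding \<A>_def by blast+
    ultimately show "\<Union>C \<in> \<A>" unfolding \<A>_def by blast
  qed
  then obtain N where "N \<in> \<A>" and max: "\<And>Y. Y \<in> \<A> \<Longrightarrow> N \<subseteq> Y \<Longrightarrow> Y = N" by blast
  then have mN: "m \<subseteq> N" and N1: "1 \<notin> N" and N_diff: "\<And>a b. a \<in> N \<Longrightarrow> b \<in> N \<Longrightarrow> a - b \<in> N"
    and N_mult: "\<And>a b. a \<in> N \<Longrightarrow> b \<in> N \<Longrightarrow> a * b \<in> N" and VN: "\<And>a b. a \<in> V \<Longrightarrow> b \<in> N \<Longrightarrow> a * b \<in> N"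
    by (auto simp: \<A>_def)
  have N0: "0 \<in> N" using m mN by auto
  have N_uminus: "- a \<in> N" if "a \<in> N" for a using N_diff[OF N0 that] by simp
  have N_add: "a + b \<in> N" if "a \<in> N" "b \<in> N" for a b using N_diff[OF that(1) N_uminus[OF that(2)]] by simp
  have N_sum: "sum f I \<in> N" if "\<And>i. i \<in> I \<Longrightarrow> f i \<in> N" for f :: "nat \<Rightarrow> 'a" and I
    using that by (induction I rule: infinite_finite_induct) (auto intro: N0 N_add)

  define B where "B = {z. \<forall>n\<in>N. z * n \<in> N}"
  have B: "subrng B"
  proof (rule subrngI)
    show "a - b \<in> B" if "a \<in> B" "b \<in> B" for a b using that N_diff by (auto simp: B_def left_diff_distrib)
    show "a * b \<in> B" if "a \<in> B" "b \<in> B" for a b using that by (auto simp: B_def mult.assoc)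
  qed (auto simp: B_def)
  have NB: "N \<subseteq> B" using N_mult by (auto simp: B_def)
  have VB: "V \<subseteq> B" using VN by (auto simp: B_def)
  have BN: "a * b \<in> N" if "a \<in> B" "b \<in> N" for a b using that by (auto simp: B_def)
  have poly_N: "poly p z \<in> N" if "p \<in> polys N" "z \<in> B" for p z
    unfolding poly_altdef using that BN[OF subrng_power[OF B that(2)]]
    by (intro N_sum) (auto simp: polys_def mult.commute)

  \<comment> \<open>If 1 is not such a value, the values at \<open>z\<close> of the polynomials over
    \<open>N\<close> are again a candidate. By maximality they lie in \<open>N\<close>; in
    particular \<open>z * n\<close> does for all \<open>n\<close> in \<open>N\<close>, so
    \<open>z\<close> is in the idealizer.\<close>
  have ext: "\<exists>p\<in>polys N. poly p z = 1" if "z \<notin> B" for z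
  proof (rule ccontr)
    assume no: "\<not> ?thesis"
    define Y where "Y = (\<lambda>p. poly p z) ` polys N"
    have pqN: "p - q \<in> polys N" "p * q \<in> polys N" if "p \<in> polys N" "q \<in> polys N" for p q
      using that by (auto simp: polys_def coeff_mult intro!: N_diff N_sum N_mult)
    have sm: "smult a p \<in> polys N" if "a \<in> V" "p \<in> polys N" for a p
      using that by (auto simp: polys_def intro!: VN)
    have NY: "N \<subseteq> Y"
    proof
      fix n assume "n \<in> N"
      then show "n \<in> Y" unfolding Y_def using N0
        by (intro image_eqI[of _ _ "[:n:]"]) (auto simp: polys_def coeff_pCons split: nat.split)
    qed
    have cl: "a - b \<in> Y" "a * b \<in> Y" if "a \<in> Y" "b \<in> Y" for a b
    proof -
      obtain p q where pq: "p \<in> polys N" "a = poly p z" "q \<in> polys N" "b = poly q z"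
        using \<open>a \<in> Y\<close> \<open>b \<in> Y\<close> by (auto simp: Y_def)
      have "poly (p - q) z \<in> Y" "poly (p * q) z \<in> Y" unfolding Y_def by (intro imageI pqN pq)+
      then show "a - b \<in> Y" "a * b \<in> Y" by (simp_all add: pq)
    qed
    have "a * b \<in> Y" if "a \<in> V" "b \<in> Y" for a b
    proof -
      obtain p where p: "p \<in> polys N" "b = poly p z" using \<open>b \<in> Y\<close> by (auto simp: Y_def)
      have "poly (smult a p) z \<in> Y" unfolding Y_def by (rule imageI) (rule sm[OF that(1) p(1)])
      then show ?thesis by (simp add: p)
    qed
    then have "Y \<in> \<A>" unfolding \<A>_def using mN no cl NY by (auto simp: Y_def)
    then have "Y = N" using max NY by auto
    have "z * n \<in> N" if "n \<in> N" for n
    proof -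
      have "[:0, n:] \<in> polys N" using that N0 by (auto simp: polys_def coeff_pCons split: nat.split)
      then have "poly [:0, n:] z \<in> Y" unfolding Y_def by (rule imageI)
      then show ?thesis using \<open>Y = N\<close> by simp
    qed
    then show False using that by (auto simp: B_def)
  qed

  have reflect_N: "reflect_poly p \<in> polys N" if "p \<in> polys N" for p
    using that N0 by (auto simp: polys_def coeff_reflect_poly)
  \<comment> \<open>Were the inverse outside \<open>B\<close>, a polynomial over \<open>N\<close>
    would take the value 1 at it. Clearing denominators puts a power of \<open>1 - n\<close> into
    \<open>N\<close>, although every such power is congruent to 1 modulo \<open>N\<close>.\<close>
  have unit: "1 - n \<noteq> 0" "inverse (1 - n) \<in> B" if "n \<in> N" for n
  proof -
    show nz: "1 - n \<noteq> 0" using that N1 by auto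
    show "inverse (1 - n) \<in> B"
    proof (rule ccontr)
      assume "inverse (1 - n) \<notin> B"
      then obtain p where p: "p \<in> polys N" "poly p (inverse (1 - n)) = 1" using ext by blast
      have uB: "1 - n \<in> B" using that NB subrngD(2,6)[OF B] by auto
      have "poly (reflect_poly p) (1 - n) = (1 - n) ^ Polynomial.degree p"
        using p nz by (simp add: poly_reflect_poly_nz)
      then have "(1 - n) ^ Polynomial.degree p \<in> N" using poly_N[OF reflect_N[OF p(1)] uB] by simp
      moreover have "1 - (1 - n) ^ d \<in> N" for d
      proof (induction d)
        case (Suc d)
        have "1 - (1 - n) ^ Suc d = (1 - (1 - n) ^ d) + (1 - n) ^ d * n" by (simp add: algebra_simps)
        then show ?case using N_add[OF Suc BN[OF subrng_power[OF B uB, of d] that]] by (simp only:)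
      qed (use N0 in auto)
      ultimately show False using N_add N1 by (metis diff_add_cancel)
    qed
  qed

  have "z \<in> B \<or> inverse z \<in> B" for z
  proof (rule ccontr)
    assume z: "\<not> (z \<in> B \<or> inverse z \<in> B)"
    define d where "d z = (LEAST n. \<exists>p\<in>polys N. poly p z = 1 \<and> Polynomial.degree p = n)" for z
    have dmin: "\<exists>p\<in>polys N. poly p z = 1 \<and> Polynomial.degree p = d z" if "z \<notin> B" for z
    proof -
      have "\<exists>n. \<exists>p\<in>polys N. poly p z = 1 \<and> Polynomial.degree p = n" using ext[OF that] by auto
      then show ?thesis unfolding d_def by (rule LeastI_ex)
    qed
    have dle: "d z \<le> Polynomial.degree p" if "p \<in> polys N" "poly p z = 1" for p z
      unfolding d_def by (rule Least_le) (use that in auto)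
    \<comment> \<open>Chevalley's argument: with relations of minimal degree for \<open>z\<close>
      and for \<open>inverse z\<close>, the relation of larger degree is shortened by means of the
      other.\<close>
    have key: False if z: "z \<notin> B" "inverse z \<notin> B" "d (inverse z) \<le> d z" for z
    proof -
      have z0: "z \<noteq> 0" using z subrngD(1)[OF B] by auto
      obtain p where p: "p \<in> polys N" "poly p z = 1" "Polynomial.degree p = d z" using dmin[OF z(1)] by blast
      obtain q where q: "q \<in> polys N" "poly q (inverse z) = 1" "Polynomial.degree q = d (inverse z)"
        using dmin[OF z(2)] by blast
      obtain b q' where q': "q = pCons b q'" by (cases q)
      have b: "b \<in> N" using q(1) by (auto simp: q' polys_def dest: spec[of _ 0])
      have "Polynomial.coeff q' i \<in> N" for i
        using q(1) unfolding q' polys_def by (auto dest: spec[of _ "Suc i"])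
      then have q'N: "q' \<in> polys N" by (simp add: polys_def)
      have "q' \<noteq> 0" using q(2) b N1 by (auto simp: q')
      then have dq: "d (inverse z) = Suc (Polynomial.degree q')" using q(3) by (simp add: q')
      define w where "w = inverse (1 - b)"
      have w: "w \<in> B" "w * (1 - b) = 1" using unit[OF b] by (auto simp: w_def)
      define n where "n = d z"
      define k where "k = d (inverse z)"
      define r where "r = reflect_poly q'"
      have "z * (1 - b) = poly q' (inverse z)" using q(2) z0 by (simp add: q' field_simps)
      then have "poly r z = z ^ k * (1 - b)"
        using z0 unfolding r_def k_def dq by (simp add: poly_reflect_poly_nz mult_ac)
      \<comment> \<open>The relation for \<open>inverse z\<close>, multiplied by
        \<open>z ^ k\<close> and by the unit \<open>w\<close>, writes \<open>z ^ k\<close> through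
        lower powers of \<open>z\<close>: the degree of \<open>r\<close> is at most
        \<open>k - 1\<close>.\<close>
      then have zk: "z ^ k = w * poly r z" using w(2) by (metis mult.assoc mult.commute mult_1)
      define a where "a = Polynomial.coeff p n"
      define p1 where "p1 = p - Polynomial.monom a n"
      \<comment> \<open>The top term \<open>a z^n\<close> of \<open>p\<close> is replaced by
        \<open>a z^(n - k)\<close> times the expression just found for \<open>z ^ k\<close>. This
        preserves the value at \<open>z\<close> and lowers the degree.\<close>
      define p2 where "p2 = p1 + Polynomial.monom (a * w) (n - k) * r"
      have n0: "n > 0" using z(3) dq by (simp add: n_def)
      have kn: "k \<le> n" "k > 0" using z(3) dq by (auto simp: n_def k_def)
      have p1c: "Polynomial.coeff p1 i = (if i \<ge> n then 0 else Polynomial.coeff p i)" for i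
        using coeff_eq_0[of p i] p(3) by (auto simp: p1_def a_def n_def)
      have "Polynomial.degree p1 < n"
        using p1c n0 by (intro degree_lessI) auto
      moreover have "Polynomial.degree (Polynomial.monom (a * w) (n - k) * r) < n"
      proof -
        have "Polynomial.degree r \<le> k - 1" unfolding r_def using degree_reflect_poly_le[of q'] dq by (simp add: k_def)
        then show ?thesis
          using degree_mult_le[of "Polynomial.monom (a * w) (n - k)" r] degree_monom_le[of "a * w" "n - k"] kn by linarith
      qed
      ultimately have "Polynomial.degree p2 < n" unfolding p2_def by (rule degree_add_less)
      moreover have "poly p2 z = 1"
      proof -
        have "a * z ^ n = a * (z ^ (n - k) * z ^ k)" using kn by (simp flip: power_add)
        then have "a * w * z ^ (n - k) * poly r z = a * z ^ n" unfolding zk by (simp only: mult_ac)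
        then show ?thesis using p(2) by (simp add: p2_def p1_def poly_monom del: mult_cancel_left)
      qed
      moreover have "p2 \<in> polys N"
      proof -
        have aw: "a * w \<in> N" using BN[OF w(1), of a] p(1) by (auto simp: a_def polys_def mult.commute)
        have rN: "Polynomial.coeff r i \<in> N" for i using reflect_N[OF q'N] by (auto simp: r_def polys_def)
        have "Polynomial.coeff p1 i \<in> N" for i using p1c[of i] p(1) N0 by (auto simp: polys_def)
        then show ?thesis unfolding polys_def p2_def
          using aw rN N0 by (auto simp: coeff_monom_mult intro!: N_add N_mult)
      qed
      ultimately show False using dle[of p2 z] by (simp add: n_def)
    qed
    show False
      using key[of z] key[of "inverse z"] z by (cases "d (inverse z) \<le> d z") auto
  qed
  moreover have "m \<subseteq> nonunits B"
  proof
    fix a assume a: "a \<in> m"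
    have "inverse a \<notin> B" if "a \<noteq> 0"
      using BN[of "inverse a" a] a mN N1 that by auto
    then show "a \<in> nonunits B" using a mV VB by (auto simp: nonunits_def)
  qed
  ultimately show ?thesis using B VB by blast
qed

text \<open>Valuation rings are integrally closed. If \<open>c\<close> is not in \<open>B\<close>,
  its inverse is, and dividing the equation of \<open>c\<close> by its highest power gives
  \<open>a + c^-1 r(c^-1) = 0\<close>, where \<open>a\<close> is the leading coefficient; solved for
  \<open>c\<close> this lies in \<open>B\<close>.\<close>

lemma algebraic_in_valuation_ring:
  fixes B :: "'a::field set"
  assumes B: "subrng B" "c \<in> B \<or> inverse c \<in> B" and k: "subfld k" "k \<subseteq> B"
    and c: "c \<in> algebraics k"
  shows "c \<in> B"
proof (rule ccontr)
  assume cB: "c \<notin> B"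
  then have c0: "c \<noteq> 0" and uB: "inverse c \<in> B" using subrngD(1)[OF B(1)] B(2) by auto
  obtain p where p: "p \<in> polys k" "p \<noteq> 0" "poly p c = 0" using c by (auto simp: algebraics_def)
  obtain a r where ar: "reflect_poly p = pCons a r" by (cases "reflect_poly p")
  have "reflect_poly p \<in> polys k"
    using p(1) subrngD(1)[OF subfld_subrng[OF k(1)]] by (auto simp: polys_def coeff_reflect_poly)
  then have r: "r \<in> polys B" "a \<in> k"
    using polys_pCons_iff[OF subfld_subrng[OF k(1)], of a r] polys_mono[OF k(2)] ar by auto
  have "a = Polynomial.coeff (reflect_poly p) 0" by (simp add: ar)
  then have a: "a \<noteq> 0" using p(2) by (simp add: coeff_0_reflect_poly)
  have "poly (reflect_poly p) (inverse c) = 0"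
    using p(3) c0 by (simp add: poly_reflect_poly_nz)
  then have eq: "a + inverse c * poly r (inverse c) = 0" by (simp add: ar)
  have "c * a + poly r (inverse c) = c * (a + inverse c * poly r (inverse c))"
    using c0 by (simp add: distrib_left)
  then have "c * a = - poly r (inverse c)" using eq by (simp add: add_eq_0_iff)
  then have "c = - poly r (inverse c) * inverse a" using a by (simp add: field_simps)
  moreover have "poly r (inverse c) \<in> B" using poly_in_subrng[OF B(1) r(1) uB] .
  moreover have "inverse a \<in> B" using subfldD(1)[OF k(1) r(2)] k(2) by auto
  ultimately show False using cB subrngD(3,5)[OF B(1)] by metis
qed

section \<open>Places in the algebraic closure\<close>

lemma to_ac_image_subfld:
  assumes "subfld k"
  shows "subfld (to_ac ` k)"
proof (rule subfldI)
  show "1 \<in> to_ac ` k" using subrngD(2)[OF subfld_subrng[OF assms]] by (intro image_eqI[of _ _ 1]) auto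
  show "a - b \<in> to_ac ` k" "a * b \<in> to_ac ` k" if "a \<in> to_ac ` k" "b \<in> to_ac ` k" for a b
    using that subrngD(5,6)[OF subfld_subrng[OF assms]] by (auto simp flip: to_ac_diff to_ac_mult)
  show "inverse a \<in> to_ac ` k" if "a \<in> to_ac ` k" for a
    using that subfldD(1)[OF assms] by (auto simp flip: to_ac_inverse)
qed

lemma alg_closure_in_algebraics: "z \<in> algebraics (range to_ac)"
proof -
  obtain p where p: "p \<noteq> 0" "poly (map_poly to_ac p) z = 0" by (rule alg_closure_algebraic)
  have "map_poly to_ac p \<in> polys (range to_ac)" by (simp add: polys_def coeff_map_poly)
  moreover have "map_poly to_ac p \<noteq> 0" using p(1) by (simp add: map_poly_eq_0_iff)
  ultimately show ?thesis using p(2) by (auto simp: algebraics_def)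
qed

context
  fixes k' F' V' :: "'a::field alg_closure set" and k :: "'a set"
  assumes F': "subfld F'" "range to_ac \<subseteq> F'" and k: "subfld k" "to_ac ` k \<subseteq> k'"
    and V': "V' \<in> valuation_rings k' F'"
begin

interpretation V': valuation_subring k' F' V'
  by (rule valuation_subring.intro[OF F'(1) V'])

text \<open>\<open>F'\<close> is algebraic over \<open>E\<close>, so a valuation ring containing
  \<open>E\<close> would be all of \<open>F'\<close>. Hence the contraction to \<open>E\<close> is a
  proper subring.\<close>

lemma nontriv: "\<exists>z. to_ac z \<notin> V'"
proof (rule ccontr)
  assume "\<not> ?thesis"
  then have "range to_ac \<subseteq> V'" by auto
  then have "F' \<subseteq> V'"
    using algebraic_in_valuation_ring[OF V'.subrng_V V'.V_or to_ac_image_subfld[OF subfld_UNIV] _ alg_closure_in_algebraics]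
    by blast
  then show False using V'.V_F by blast
qed

lemma vimage_valuation_ring: "to_ac -` V' \<in> valuation_rings k UNIV"
  unfolding valuation_rings_def
proof (intro CollectI conjI ballI)
  show "subrng (to_ac -` V')"
    by (rule subrngI) (use V'.V_closed in auto)
  have kV: "k \<subseteq> to_ac -` V'" using k V'.k_V by auto
  obtain z where z: "to_ac z \<notin> V'" using nontriv by auto
  have "inverse z \<in> to_ac -` V'" using z V'.V_or[of "to_ac z"] F' by auto
  moreover have "inverse z \<notin> k" using subfldD(1)[OF k(1), of "inverse z"] kV z by auto
  ultimately show "k \<subset> to_ac -` V'" using kV by auto
  show "to_ac -` V' \<subset> UNIV" using z by auto
  show "z \<in> to_ac -` V' \<or> inverse z \<in> to_ac -` V'" for z
    using V'.V_or[of "to_ac z"] F' by auto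
qed

lemma vimage_nonunits: "nonunits (to_ac -` V') = to_ac -` nonunits V'"
  by (auto simp: nonunits_def)

text \<open>The values taken on \<open>E\<close> form a nonzero subgroup of the integers, generated
  by its least positive element \<open>e\<close>, the ramification index. Any element of value
  \<open>e\<close> is a uniformizer.\<close>

lemma vimage_uniformizer:
  assumes "uniformizer F' V' s"
  shows "\<exists>t. uniformizer UNIV (to_ac -` V') t"
proof -
  interpret V': discrete_valuation_subring k' F' V' s
    by (rule discrete_valuation_subringI[OF F'(1) V' assms])
  define v where "v z = V'.v (to_ac z)" for z
  have toF: "to_ac z \<in> F' - {0}" if "z \<noteq> 0" for z using that F' by auto
  have vm: "v (z * w) = v z + v w" if "z \<noteq> 0" "w \<noteq> 0" for z w
    using V'.v_mult[OF toF toF] that by (simp add: v_def)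
  have vi: "v (inverse z) = - v z" if "z \<noteq> 0" for z
    using V'.v_inverse[OF toF] that by (simp add: v_def)
  have vp: "v (z ^ n) = int n * v z" if "z \<noteq> 0" for z and n :: nat
    using that vm[of z 1] by (induction n) (auto simp: vm algebra_simps)
  have vpi: "v (z powi n) = n * v z" if "z \<noteq> 0" for z and n :: int
    using that vp[of z "nat n"] vp[of z "nat (- n)"] vi[of "z ^ nat (- n)"]
    by (auto simp: power_int_def power_inverse)
  have nu: "z \<in> nonunits (to_ac -` V') \<longleftrightarrow> v z > 0" if "z \<noteq> 0" for z
    using V'.nonunit_iff_v[OF toF[OF that]] by (simp add: vimage_nonunits v_def)
  have un: "z \<in> to_ac -` V' - nonunits (to_ac -` V') \<longleftrightarrow> v z = 0" if "z \<noteq> 0" for z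
    using V'.unit_iff_v[OF toF[OF that]] by (simp add: vimage_nonunits v_def)
  obtain z where "to_ac z \<notin> V'" using nontriv by auto
  then have z: "z \<noteq> 0" using V'.V_closed(1) by auto
  with \<open>to_ac z \<notin> V'\<close> have vz: "v z < 0" using V'.in_V_iff_v[OF toF[of z]] by (auto simp: v_def)
  define e where "e = (LEAST n. \<exists>z. z \<noteq> 0 \<and> v z = int n \<and> n > 0)"
  have "\<exists>n z. z \<noteq> 0 \<and> v z = int n \<and> n > 0"
    using z vz vi[of z] by (intro exI[of _ "nat (- v z)"] exI[of _ "inverse z"]) auto
  then have "\<exists>z. z \<noteq> 0 \<and> v z = int e \<and> e > 0" unfolding e_def by (rule LeastI_ex)
  then obtain t where t: "t \<noteq> 0" "v t = int e" "e > 0" by auto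
  have min: "e \<le> n" if "z \<noteq> 0" "v z = int n" "n > 0" for z n
    unfolding e_def using that by (intro Least_le) auto
  have "uniformizer UNIV (to_ac -` V') t"
    unfolding uniformizer_def
  proof (intro conjI ballI)
    show "t \<noteq> 0" "t \<in> nonunits (to_ac -` V')" using t nu[of t] by auto
    fix z :: 'a assume "z \<in> UNIV - {0}"
    then have z: "z \<noteq> 0" by auto
    \<comment> \<open>Division with remainder leaves \<open>u\<close> with a value between 0 and
      \<open>e - 1\<close>, which vanishes by minimality of \<open>e\<close>.\<close>
    define q where "q = v z div int e"
    define u where "u = z * t powi (- q)"
    have u0: "u \<noteq> 0" using z t by (simp add: u_def)
    have "v u = v z mod int e"
      using z t vpi[of t "- q"] vm[of z "t powi (- q)"] minus_div_mult_eq_mod[of "v z" "int e"]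
      by (simp add: u_def q_def)
    moreover have "v z mod int e \<ge> 0" "v z mod int e < int e" using t(3) by auto
    ultimately have "v u = 0" using min[OF u0, of "nat (v u)"] by fastforce
    then have "u \<in> to_ac -` V' - nonunits (to_ac -` V')" using un[OF u0] by auto
    moreover have "z = t powi q * u" using t by (simp add: u_def power_int_minus)
    ultimately show "\<exists>n. \<exists>u\<in>to_ac -` V' - nonunits (to_ac -` V'). z = t powi n * u" by blast
  qed
  then show ?thesis by blast
qed

end

text \<open>A ring \<open>B\<close> dominating \<open>V\<close> is found in the whole algebraic
  closure and intersected with \<open>F'\<close>. Its contraction is not larger than
  \<open>V\<close>, because an element outside \<open>V\<close> has a nonunit as its inverse, which
  remains a nonunit in \<open>B\<close>.\<close>

lemma valuation_ring_extension:
  fixes k F :: "'a::field set" and k' F' :: "'a alg_closure set"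
  assumes F': "subfld F'" "range to_ac \<subseteq> F'" and k: "subfld k" "k' = algebraics (to_ac ` k)" "k' \<subseteq> F'"
    and V: "V \<in> valuation_rings k UNIV"
  shows "\<exists>V'\<in>valuation_rings k' F'. to_ac -` V' = V"
proof -
  interpret V: valuation_subring k UNIV V
    by (rule valuation_subring.intro[OF subfld_UNIV V])
  have im: "subrng (to_ac ` V)"
  proof (rule subrngI)
    show "1 \<in> to_ac ` V" using V.V_closed by (intro image_eqI[of _ _ 1]) auto
    show "a - b \<in> to_ac ` V" "a * b \<in> to_ac ` V" if "a \<in> to_ac ` V" "b \<in> to_ac ` V" for a b
      using that V.V_closed by (auto simp flip: to_ac_diff to_ac_mult)
  qed
  have "\<exists>B. subrng B \<and> to_ac ` V \<subseteq> B \<and> to_ac ` nonunits V \<subseteq> nonunits B \<and> (\<forall>z. z \<in> B \<or> inverse z \<in> B)"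
  proof (rule extend_nonunits[OF im])
    show "0 \<in> to_ac ` nonunits V" using V.nonunits_0 by (intro image_eqI[of _ _ 0]) auto
    show "1 \<notin> to_ac ` nonunits V" using V.one_notin_nonunits by auto
    show "a - b \<in> to_ac ` nonunits V" if "a \<in> to_ac ` nonunits V" "b \<in> to_ac ` nonunits V" for a b
      using that V.nonunits_diff by (auto simp flip: to_ac_diff)
    show "a * b \<in> to_ac ` nonunits V" if "a \<in> to_ac ` V" "b \<in> to_ac ` nonunits V" for a b
      using that V.nonunits_mult by (auto simp flip: to_ac_mult)
  qed (use nonunits_subset in auto)
  then obtain B where B: "subrng B" "to_ac ` V \<subseteq> B" "to_ac ` nonunits V \<subseteq> nonunits B"
    and B_or: "\<And>z. z \<in> B \<or> inverse z \<in> B" by blast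
  have contr: "z \<in> V" if "to_ac z \<in> B" for z
  proof (rule ccontr)
    assume z: "z \<notin> V"
    then have "to_ac (inverse z) \<in> nonunits B" using V.inverse_nonunit[of z] B by blast
    then show False using z that V.V_closed by (auto simp: nonunits_def)
  qed
  define V' where "V' = B \<inter> F'"
  have kB: "to_ac ` k \<subseteq> B" using V.k_V B(2) by blast
  have kf: "subfld (to_ac ` k)" by (rule to_ac_image_subfld[OF k(1)])
  have k'B: "k' \<subseteq> B" using algebraic_in_valuation_ring[OF B(1) B_or kf kB] k(2) by auto
  have toF': "to_ac z \<in> F'" for z using F'(2) by blast
  have vim: "to_ac -` V' = V" using contr B(2) toF' by (auto simp: V'_def)
  obtain z where z: "z \<notin> V" using V.V_F by auto
  then have zn: "inverse z \<in> nonunits V" "z \<noteq> 0" using V.inverse_nonunit[of z] V.V_closed by auto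
  \<comment> \<open>This witnesses that \<open>V'\<close> is larger than \<open>k'\<close>. If
    \<open>inverse z\<close> were algebraic over \<open>k\<close>, so would be \<open>z\<close>, by
    reversing the polynomial; then \<open>z\<close> would lie in \<open>B\<close>.\<close>
  have zk: "to_ac (inverse z) \<notin> k'"
  proof
    assume "to_ac (inverse z) \<in> k'"
    moreover have "to_ac z \<in> algebraics (to_ac ` k)" if "to_ac (inverse z) \<in> algebraics (to_ac ` k)"
    proof -
      obtain p where p: "p \<in> polys (to_ac ` k)" "p \<noteq> 0" "poly p (to_ac (inverse z)) = 0"
        using \<open>to_ac (inverse z) \<in> algebraics (to_ac ` k)\<close> by (auto simp: algebraics_def)
      have "reflect_poly p \<in> polys (to_ac ` k)"
        using p(1) subrngD(1)[OF subfld_subrng[OF kf]] by (auto simp: polys_def coeff_reflect_poly)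
      moreover have "poly (reflect_poly p) (to_ac z) = 0"
        using p(3) zn(2) by (simp add: poly_reflect_poly_nz)
      ultimately show ?thesis using p(2) unfolding algebraics_def by (auto intro!: bexI[of _ "reflect_poly p"])
    qed
    ultimately have "to_ac z \<in> B" using k'B k(2) by auto
    then show False using contr z by auto
  qed
  have "V' \<in> valuation_rings k' F'"
    unfolding valuation_rings_def
  proof (intro CollectI conjI ballI)
    show "subrng V'"
      by (rule subrngI) (use subrngD[OF B(1)] subrngD[OF subfld_subrng[OF F'(1)]] in \<open>auto simp: V'_def\<close>)
    have "to_ac (inverse z) \<in> B" using B(2) zn(1) nonunits_subset[of V] by blast
    then have "to_ac (inverse z) \<in> V'" using toF'[of "inverse z"] by (simp add: V'_def)
    then show "k' \<subset> V'" using zk k'B k(3) by (auto simp: V'_def)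
    have "to_ac z \<in> F'" "to_ac z \<notin> V'" using z vim F' by auto
    moreover have "V' \<subseteq> F'" by (auto simp: V'_def)
    ultimately show "V' \<subset> F'" by blast
    show "w \<in> V' \<or> inverse w \<in> V'" if "w \<in> F'" for w
      using that B_or[of w] subfldD(1)[OF F'(1)] by (auto simp: V'_def)
  qed
  then show ?thesis using vim by blast
qed

section \<open>The function field of a Weierstrass curve\<close>

lemma synthetic_div_polys:
  assumes "subrng k" "c \<in> k" "p \<in> polys k"
  shows "synthetic_div p c \<in> polys k"
  using assms(3)
proof (induction p)
  case 0
  then show ?case by simp
next
  case (pCons a p)
  then have "p \<in> polys k" using polys_pCons_iff[OF assms(1), of a p] by simp
  then show ?case using pCons poly_in_subrng[OF assms(1) _ assms(2)] by (simp add: polys_pCons_iff[OF assms(1)])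
qed

lemma poly_synthetic_div: "poly p u = poly p c + (u - c) * poly (synthetic_div p c) (u :: 'a::comm_ring_1)"
  using arg_cong[OF synthetic_div_correct[of p c], of "\<lambda>q. poly q u"] by (simp add: algebra_simps)

lemma poly_factor_root:
  fixes p :: "'a::idom poly"
  assumes "poly p c = 0"
  shows "p = [:- c, 1:] * synthetic_div p c"
  using synthetic_div_correct'[of c p] assms by simp

lemma degree_synthetic_div_less: "Polynomial.degree p > 0 \<Longrightarrow> Polynomial.degree (synthetic_div p c) < Polynomial.degree p"
  by (simp add: degree_synthetic_div)

lemma split_root_power:
  fixes k :: "'a::field set"
  assumes k: "subrng k" "c \<in> k" and p: "p \<in> polys k" "p \<noteq> 0"
  shows "\<exists>m. \<exists>q\<in>polys k. p = [:- c, 1:] ^ m * q \<and> poly q c \<noteq> 0"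
  using p
proof (induction "Polynomial.degree p" arbitrary: p rule: less_induct)
  case less
  show ?case
  proof (cases "poly p c = 0")
    case True
    then have p: "p = [:- c, 1:] * synthetic_div p c" by (rule poly_factor_root)
    have "Polynomial.degree p > 0" using True less.prems(2) by (metis degree_eq_zeroE gr0I poly_const_conv pCons_0_0)
    moreover have "synthetic_div p c \<noteq> 0" using p less.prems(2) by auto
    ultimately obtain m q where "q \<in> polys k" "synthetic_div p c = [:- c, 1:] ^ m * q" "poly q c \<noteq> 0"
      using less.hyps[OF degree_synthetic_div_less synthetic_div_polys[OF k less.prems(1)]] by blast
    then have "p = [:- c, 1:] ^ Suc m * q" using p by (simp only: power_Suc mult.assoc)
    then show ?thesis using \<open>q \<in> polys k\<close> \<open>poly q c \<noteq> 0\<close> by blast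
  next
    case False
    then show ?thesis using less.prems by (intro exI[of _ 0] bexI[of _ p]) auto
  qed
qed

text \<open>Used both for \<open>E\<close> over \<open>K\<close> and for \<open>F'\<close> over
  \<open>k'\<close>. The assumption \<open>gen\<close> expresses \<open>F = k(x, y)\<close> through
  minimality among subfields of the ambient type.\<close>

locale weierstrass_field =
  fixes k F :: "'b::field set" and x y a1 a2 a3 a4 a6 :: 'b
  assumes k: "subfld k" and F: "subfld F" and kF: "k \<subseteq> F" and x: "x \<in> F" and y: "y \<in> F"
    and coeffs: "a1 \<in> k" "a2 \<in> k" "a3 \<in> k" "a4 \<in> k" "a6 \<in> k"
    and transc: "\<And>p. p \<in> polys k \<Longrightarrow> poly p x = 0 \<Longrightarrow> p = 0"
    and curve: "weierstrass a1 a2 a3 a4 a6 x y = 0"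
    and gen: "\<And>S. subfld S \<Longrightarrow> k \<subseteq> S \<Longrightarrow> x \<in> S \<Longrightarrow> y \<in> S \<Longrightarrow> F \<subseteq> S"
begin

lemmas kr = subfld_subrng[OF k]
lemmas k_closed = subrngD[OF subfld_subrng[OF k]] subfldD[OF k]
lemmas F_closed = subrngD[OF subfld_subrng[OF F]] subfldD[OF F] subfld_powi[OF F]
lemmas poly_closed = polys_closed[OF subfld_subrng[OF k]]

abbreviation on_curve where "on_curve u v \<equiv> weierstrass a1 a2 a3 a4 a6 u v = 0"

definition lin :: "'b poly" where "lin = [:a3, a1:]"
definition cub :: "'b poly" where "cub = [:a6, a4, a2, 1:]"

lemma lin_polys: "lin \<in> polys k" and cub_polys: "cub \<in> polys k"
  using coeffs k_closed(1,2) by (auto simp: lin_def cub_def polys_pCons_iff[OF kr] polys_0[OF kr])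

lemma degree_lin: "Polynomial.degree lin \<le> 1" and degree_cub: "Polynomial.degree cub = 3" and cub_nz: "cub \<noteq> 0"
  by (auto simp: lin_def cub_def)

lemma on_curve_iff: "on_curve u v \<longleftrightarrow> v * v = poly cub u - poly lin u * v"
  unfolding weierstrass_def lin_def cub_def
  by (simp add: power2_eq_square power3_eq_cube algebra_simps)

text \<open>A pair \<open>(p, q)\<close> of polynomials stands for the element \<open>p(x) + q(x) y\<close> of the affine coordinate ring.\<close>

definition ev :: "'b poly \<times> 'b poly \<Rightarrow> 'b \<Rightarrow> 'b \<Rightarrow> 'b" where
  "ev f u v = poly (fst f) u + poly (snd f) u * v"

definition pp :: "('b poly \<times> 'b poly) set" where "pp = polys k \<times> polys k"

text \<open>Multiplication modulo the curve equation, that is with \<open>y * y\<close> replaced by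
  \<open>cub - lin * y\<close>.\<close>

definition pmul where
  "pmul f g = (fst f * fst g + snd f * snd g * cub, fst f * snd g + snd f * fst g - snd f * snd g * lin)"

definition padd :: "'b poly \<times> 'b poly \<Rightarrow> 'b poly \<times> 'b poly \<Rightarrow> 'b poly \<times> 'b poly" where
  "padd f g = (fst f + fst g, snd f + snd g)"

text \<open>Replaces \<open>y\<close> by \<open>- y - lin\<close>, the other root of the equation as
  a quadratic in \<open>y\<close>; on points this is negation.\<close>

definition pconj where "pconj f = (fst f - snd f * lin, - snd f)"

text \<open>The product of \<open>f\<close> and \<open>pconj f\<close>, in which the part containing
  \<open>y\<close> cancels.\<close>

definition pnorm where "pnorm f = fst f * fst f - fst f * snd f * lin - snd f * snd f * cub"

definition pconst :: "'b \<Rightarrow> 'b poly \<times> 'b poly" where "pconst c = ([:c:], 0)"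

definition px :: "'b poly \<times> 'b poly" where "px = ([:0, 1:], 0)"
definition py :: "'b poly \<times> 'b poly" where "py = (0, 1)"

lemma pp_closed:
  "f \<in> pp \<Longrightarrow> g \<in> pp \<Longrightarrow> pmul f g \<in> pp" "f \<in> pp \<Longrightarrow> g \<in> pp \<Longrightarrow> padd f g \<in> pp" "f \<in> pp \<Longrightarrow> pconj f \<in> pp"
  "c \<in> k \<Longrightarrow> pconst c \<in> pp" "px \<in> pp" "py \<in> pp" "p \<in> polys k \<Longrightarrow> (p, 0) \<in> pp"
  using lin_polys cub_polys k_closed(1,2)
  by (auto simp: pp_def pmul_def padd_def pconj_def pconst_def px_def py_def intro!: poly_closed)

lemma pnorm_polys: "f \<in> pp \<Longrightarrow> pnorm f \<in> polys k"
  using lin_polys cub_polys by (auto simp: pp_def pnorm_def intro!: poly_closed)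

lemma ev_padd: "ev (padd f g) u v = ev f u v + ev g u v"
  by (simp add: ev_def padd_def algebra_simps)

lemma ev_simps [simp]: "ev (pconst c) u v = c" "ev px u v = u" "ev py u v = v" "ev (p, 0) u v = poly p u"
  "ev (0, q) u v = poly q u * v"
  by (auto simp: ev_def pconst_def px_def py_def)

lemma ev_pmul:
  assumes "on_curve u v"
  shows "ev (pmul f g) u v = ev f u v * ev g u v"
proof -
  have *: "(p + q * v) * (r + s * v) = p * r + (p * s + q * r) * v + q * s * (v * v)" for p q r s
    by (simp add: algebra_simps)
  show ?thesis
    unfolding ev_def * assms[unfolded on_curve_iff] by (simp add: pmul_def algebra_simps)
qed

lemma ev_pconj:
  assumes "on_curve u v"
  shows "ev f u v * ev (pconj f) u v = poly (pnorm f) u"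
proof -
  have "pmul f (pconj f) = (pnorm f, 0)"
    by (simp add: pmul_def pconj_def pnorm_def algebra_simps)
  then show ?thesis using ev_pmul[OF assms, of f "pconj f"] by simp
qed

lemma pnorm_pmul: "pnorm (pmul f g) = pnorm f * pnorm g"
  by (simp add: pmul_def pnorm_def algebra_simps)

text \<open>The pole order at infinity (\<open>2\<close> for \<open>x\<close>, \<open>3\<close> for \<open>y\<close>), which is also the degree of the norm.\<close>

definition weight :: "'b poly \<times> 'b poly \<Rightarrow> nat" where
  "weight f = (if snd f = 0 then 2 * Polynomial.degree (fst f)
               else max (2 * Polynomial.degree (fst f)) (2 * Polynomial.degree (snd f) + 3))"

text \<open>The terms \<open>p * p\<close> and \<open>q * q * cub\<close> have degrees of different
  parity, so they cannot cancel, and the mixed term has degree at most \<open>a + b + 1\<close>,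
  below the larger of the two.\<close>

lemma pnorm_nz_degree:
  assumes "f \<noteq> (0, 0)"
  shows "pnorm f \<noteq> 0 \<and> Polynomial.degree (pnorm f) = weight f"
proof -
  obtain p q where f: "f = (p, q)" by (cases f)
  define a b where "a = Polynomial.degree p" and "b = Polynomial.degree q"
  show ?thesis
  proof (cases "q = 0")
    case True
    then show ?thesis using assms f by (auto simp: pnorm_def weight_def degree_mult_eq)
  next
    case False
    have B: "Polynomial.degree (p * q * lin) \<le> a + b + 1"
      using degree_mult_le[of "p * q" lin] degree_mult_le[of p q] degree_lin by (simp add: a_def b_def)
    have C: "Polynomial.degree (q * q * cub) = 2 * b + 3" "q * q * cub \<noteq> 0"
      using False cub_nz by (auto simp: degree_mult_eq degree_cub b_def)
    have A: "Polynomial.degree (p * p) \<le> 2 * a" using degree_mult_le[of p p] by (simp add: a_def)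
    have w: "weight f = max (2 * a) (2 * b + 3)" using False by (simp add: f weight_def a_def b_def)
    have N: "pnorm f = p * p - p * q * lin - q * q * cub" by (simp add: f pnorm_def)
    have "Polynomial.degree (pnorm f) = weight f"
    proof (cases "2 * a > 2 * b + 3")
      case True
      then have p0: "p \<noteq> 0" by (auto simp: a_def)
      then have A': "Polynomial.degree (p * p) = 2 * a" by (simp add: degree_mult_eq a_def)
      have "Polynomial.degree (- (p * q * lin) - q * q * cub) < 2 * a"
        using B C True by (intro degree_diff_less) auto
      then have "Polynomial.degree (p * p + (- (p * q * lin) - q * q * cub)) = 2 * a"
        using A' by (subst degree_add_eq_left) auto
      moreover have "pnorm f = p * p + (- (p * q * lin) - q * q * cub)" unfolding N by simp
      ultimately show ?thesis using w True by (simp only:)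
    next
      case False
      then have "a \<le> b + 1" by simp
      then have "Polynomial.degree (p * p - p * q * lin) < 2 * b + 3"
        using B A by (intro degree_diff_less) auto
      then have "Polynomial.degree ((p * p - p * q * lin) + - (q * q * cub)) = 2 * b + 3"
        using C by (subst degree_add_eq_right) auto
      moreover have "pnorm f = (p * p - p * q * lin) + - (q * q * cub)" unfolding N by simp
      ultimately show ?thesis using w False by (simp only:)
    qed
    moreover have "weight f > 0" using w by simp
    ultimately show ?thesis by auto
  qed
qed

text \<open>If the element vanishes, so does its norm, a polynomial in the transcendental
  \<open>x\<close>; and only the zero pair has norm zero.\<close>

lemma ev_eq_0_iff:
  assumes "f \<in> pp"
  shows "ev f x y = 0 \<longleftrightarrow> f = (0, 0)"
proof
  assume "ev f x y = 0"
  then have "poly (pnorm f) x = 0" using ev_pconj[OF curve, of f] by simp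
  then have "pnorm f = 0" using transc pnorm_polys[OF assms] by blast
  then show "f = (0, 0)" using pnorm_nz_degree by blast
qed (auto simp: ev_def)

lemma ev_inj:
  assumes "f \<in> pp" "g \<in> pp" "ev f x y = ev g x y"
  shows "f = g"
proof -
  have "padd f (pmul (pconst (- 1)) g) \<in> pp" using assms k_closed(2,3) by (intro pp_closed) auto
  moreover have "ev (padd f (pmul (pconst (- 1)) g)) x y = 0"
    using assms(3) by (simp add: ev_padd ev_pmul[OF curve])
  ultimately have "padd f (pmul (pconst (- 1)) g) = (0, 0)" using ev_eq_0_iff by blast
  then show ?thesis by (auto simp: padd_def pmul_def pconst_def prod_eq_iff)
qed

lemma pmul_nz: "f \<noteq> (0, 0) \<Longrightarrow> g \<noteq> (0, 0) \<Longrightarrow> pmul f g \<noteq> (0, 0)"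
  using pnorm_nz_degree[of f] pnorm_nz_degree[of g] pnorm_pmul[of f g] by (auto simp: pnorm_def)

lemma weight_pmul:
  assumes "f \<noteq> (0, 0)" "g \<noteq> (0, 0)"
  shows "weight (pmul f g) = weight f + weight g"
  using pnorm_nz_degree[OF assms(1)] pnorm_nz_degree[OF assms(2)] pnorm_nz_degree[OF pmul_nz[OF assms]]
    pnorm_pmul[of f g] by (simp add: degree_mult_eq)

lemma weight_padd: "weight (padd f g) \<le> max (weight f) (weight g)"
  using degree_add_le_max[of "fst f" "fst g"] degree_add_le_max[of "snd f" "snd g"]
  by (auto simp: weight_def padd_def max_def split: if_splits)


text \<open>The fractions form a subfield containing \<open>k\<close>, \<open>x\<close> and
  \<open>y\<close>; denominators multiply to nonzero pairs by multiplicativity of the norm.\<close>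

lemma F_fractions:
  assumes "z \<in> F"
  obtains f g where "f \<in> pp" "g \<in> pp" "g \<noteq> (0, 0)" "z = ev f x y / ev g x y"
proof -
  define S where "S = {z. \<exists>f\<in>pp. \<exists>g\<in>pp. g \<noteq> (0, 0) \<and> z = ev f x y / ev g x y}"
  have SI: "ev f x y / ev g x y \<in> S" if "f \<in> pp" "g \<in> pp" "g \<noteq> (0, 0)" for f g
    using that by (auto simp: S_def)
  have one: "pconst 1 \<noteq> (0, 0)" by (simp add: pconst_def)
  have in_S: "ev f x y \<in> S" if "f \<in> pp" for f
    using SI[OF that pp_closed(4)[OF k_closed(2)] one] by simp
  have "subfld S"
  proof (rule subfldI)
    show "1 \<in> S" using in_S[OF pp_closed(4)[OF k_closed(2)]] by simp
    fix a b assume "a \<in> S" "b \<in> S"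
    then obtain f g f' g' where fg: "f \<in> pp" "g \<in> pp" "g \<noteq> (0, 0)" "a = ev f x y / ev g x y"
      "f' \<in> pp" "g' \<in> pp" "g' \<noteq> (0, 0)" "b = ev f' x y / ev g' x y" unfolding S_def by blast
    have nz: "ev g x y \<noteq> 0" "ev g' x y \<noteq> 0" using fg ev_eq_0_iff by auto
    have "a * b = ev (pmul f f') x y / ev (pmul g g') x y" by (simp add: ev_pmul[OF curve] fg)
    then show "a * b \<in> S" using SI pp_closed(1) pmul_nz fg by auto
    have "a - b = ev (padd (pmul f g') (pmul (pconst (- 1)) (pmul f' g))) x y / ev (pmul g g') x y"
      using nz by (simp add: ev_pmul[OF curve] ev_padd fg field_simps)
    then show "a - b \<in> S"
      using SI pp_closed(1,2,4) pmul_nz fg k_closed(3)[OF k_closed(2)] by auto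
  next
    fix a assume "a \<in> S" "a \<noteq> 0"
    then obtain f g where fg: "f \<in> pp" "g \<in> pp" "g \<noteq> (0, 0)" "a = ev f x y / ev g x y" unfolding S_def by blast
    then have "f \<noteq> (0, 0)" using \<open>a \<noteq> 0\<close> ev_eq_0_iff by auto
    then show "inverse a \<in> S" using SI fg by auto
  qed
  moreover have "k \<subseteq> S" using in_S[OF pp_closed(4)] by auto
  moreover have "x \<in> S" "y \<in> S" using in_S[OF pp_closed(5)] in_S[OF pp_closed(6)] by auto
  ultimately have "F \<subseteq> S" by (rule gen)
  then have "z \<in> S" using assms by auto
  then show thesis using that unfolding S_def by blast
qed

lemma poly_in_F: "p \<in> polys k \<Longrightarrow> z \<in> F \<Longrightarrow> poly p z \<in> F"
  using poly_in_subrng[OF subfld_subrng[OF F]] polys_mono[OF kF] by blast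

lemma ev_in_F: "f \<in> pp \<Longrightarrow> ev f x y \<in> F"
  using poly_in_F x y F_closed by (auto simp: ev_def pp_def)

lemma x_nz: "x \<noteq> 0" and y_nz: "y \<noteq> 0"
  using ev_eq_0_iff[OF pp_closed(5)] ev_eq_0_iff[OF pp_closed(6)] by (auto simp: px_def py_def)

subsection \<open>The place at infinity\<close>

definition vinf :: "'b \<Rightarrow> int" where
  "vinf z = (THE n. \<exists>f\<in>pp. \<exists>g\<in>pp. f \<noteq> (0, 0) \<and> g \<noteq> (0, 0) \<and> z = ev f x y / ev g x y \<and>
                    n = int (weight g) - int (weight f))"

lemma vinf_eq:
  assumes "f \<in> pp" "g \<in> pp" "f \<noteq> (0, 0)" "g \<noteq> (0, 0)"
  shows "vinf (ev f x y / ev g x y) = int (weight g) - int (weight f)"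
  unfolding vinf_def
proof (rule the_equality)
  fix n assume "\<exists>f'\<in>pp. \<exists>g'\<in>pp. f' \<noteq> (0, 0) \<and> g' \<noteq> (0, 0) \<and> ev f x y / ev g x y = ev f' x y / ev g' x y \<and>
    n = int (weight g') - int (weight f')"
  then obtain f' g' where *: "f' \<in> pp" "g' \<in> pp" "f' \<noteq> (0, 0)" "g' \<noteq> (0, 0)"
    "ev f x y / ev g x y = ev f' x y / ev g' x y" "n = int (weight g') - int (weight f')" by blast
  have nz: "ev g x y \<noteq> 0" "ev g' x y \<noteq> 0" using assms * ev_eq_0_iff by auto
  have "ev (pmul f g') x y = ev (pmul f' g) x y"
    using *(5) nz by (simp add: ev_pmul[OF curve] field_simps)
  then have "pmul f g' = pmul f' g" using ev_inj pp_closed(1) assms * by auto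
  then have "weight f + weight g' = weight f' + weight g"
    using weight_pmul[OF assms(3) *(4)] weight_pmul[OF *(3) assms(4)] by simp
  then show "n = int (weight g) - int (weight f)" using *(6) by linarith
qed (use assms in blast)

lemma vinf_ev: "f \<in> pp \<Longrightarrow> f \<noteq> (0, 0) \<Longrightarrow> vinf (ev f x y) = - int (weight f)"
  using vinf_eq[of f "pconst 1"] pp_closed(4)[OF k_closed(2)] by (simp add: pconst_def weight_def ev_def)

definition Vinf :: "'b set" where "Vinf = {z\<in>F. z = 0 \<or> vinf z \<ge> 0}"

lemma Vinf_props:
  shows Vinf_valuation_ring: "Vinf \<in> valuation_rings k F"
    and Vinf_uniformizer: "uniformizer F Vinf (x / y)"
    and Vinf_valuation: "z \<in> F - {0} \<Longrightarrow> valuation F (nonunits Vinf) z = vinf z"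
proof -
  have frac: "\<exists>f g. f \<in> pp \<and> g \<in> pp \<and> f \<noteq> (0, 0) \<and> g \<noteq> (0, 0) \<and> z = ev f x y / ev g x y" if "z \<in> F - {0}" for z
  proof -
    have "z \<in> F" using that by auto
    then obtain f g where fg: "f \<in> pp" "g \<in> pp" "g \<noteq> (0, 0)" "z = ev f x y / ev g x y" by (rule F_fractions)
    moreover have "f \<noteq> (0, 0)" using that fg by (auto simp: ev_def)
    ultimately show ?thesis by blast
  qed
  have mult: "vinf (z * w) = vinf z + vinf w" if zw: "z \<in> F - {0}" "w \<in> F - {0}" for z w
  proof -
    obtain f g where fg: "f \<in> pp" "g \<in> pp" "f \<noteq> (0, 0)" "g \<noteq> (0, 0)" "z = ev f x y / ev g x y" using frac[OF zw(1)] by blast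
    obtain f' g' where fg': "f' \<in> pp" "g' \<in> pp" "f' \<noteq> (0, 0)" "g' \<noteq> (0, 0)" "w = ev f' x y / ev g' x y" using frac[OF zw(2)] by blast
    have "z * w = ev (pmul f f') x y / ev (pmul g g') x y" using fg(5) fg'(5) by (simp add: ev_pmul[OF curve])
    then show ?thesis
      using vinf_eq[of "pmul f f'" "pmul g g'"] vinf_eq[of f g] vinf_eq[of f' g'] fg fg' pp_closed(1) pmul_nz weight_pmul
      by simp
  qed
  have add: "vinf (z + w) \<ge> 0" if zw: "z \<in> F - {0}" "w \<in> F - {0}" "z + w \<noteq> 0" "vinf z \<ge> 0" "vinf w \<ge> 0" for z w
  proof -
    obtain f g where fg: "f \<in> pp" "g \<in> pp" "f \<noteq> (0, 0)" "g \<noteq> (0, 0)" "z = ev f x y / ev g x y" using frac[OF zw(1)] by blast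
    obtain f' g' where fg': "f' \<in> pp" "g' \<in> pp" "f' \<noteq> (0, 0)" "g' \<noteq> (0, 0)" "w = ev f' x y / ev g' x y" using frac[OF zw(2)] by blast
    define h where "h = padd (pmul f g') (pmul f' g)"
    have le: "weight f \<le> weight g" "weight f' \<le> weight g'"
      using zw(4,5) vinf_eq[OF fg(1-4)] vinf_eq[OF fg'(1-4)] fg(5) fg'(5) by auto
    have nz: "ev g x y \<noteq> 0" "ev g' x y \<noteq> 0" using fg fg' ev_eq_0_iff by auto
    have eq: "z + w = ev h x y / ev (pmul g g') x y"
      unfolding h_def ev_padd ev_pmul[OF curve] fg(5) fg'(5) using nz by (simp add: add_frac_eq mult.commute)
    then have "h \<noteq> (0, 0)" using zw(3) by (auto simp: ev_def)
    moreover have "h \<in> pp" unfolding h_def using fg fg' pp_closed by auto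
    moreover have "weight h \<le> weight (pmul g g')"
      using weight_padd[of "pmul f g'" "pmul f' g"] weight_pmul fg fg' le by (simp add: h_def)
    ultimately show ?thesis using vinf_eq[of h "pmul g g'"] eq fg fg' pp_closed(1) pmul_nz by simp
  qed
  have const: "vinf c = 0" if "c \<in> k - {0}" for c
    using vinf_ev[OF pp_closed(4), of c] that by (simp add: pconst_def weight_def ev_def)
  \<comment> \<open>The orders -2 and -3 of \<open>x\<close> and \<open>y\<close> at infinity differ
    by 1.\<close>
  have t: "x / y \<in> F - {0}" "vinf (x / y) = 1"
    using x y x_nz y_nz F_closed vinf_eq[OF pp_closed(5,6)] by (auto simp: px_def py_def weight_def ev_def)
  note * = valuation_ring_of_map[where v = vinf and t = "x / y", OF k kF F mult add const t, folded Vinf_def]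
  show "Vinf \<in> valuation_rings k F" "uniformizer F Vinf (x / y)"
    "z \<in> F - {0} \<Longrightarrow> valuation F (nonunits Vinf) z = vinf z"
    using * by blast+
qed

lemma vinf_x: "vinf x = - 2" and vinf_y: "vinf y = - 3"
  using vinf_ev[OF pp_closed(5)] vinf_ev[OF pp_closed(6)] by (auto simp: px_def py_def weight_def ev_def)

text \<open>The equation forces \<open>s = x / y\<close> to be a nonunit and \<open>x\<close>,
  \<open>y\<close> to be \<open>s^-2\<close> and \<open>s^-3\<close> times the same unit of
  \<open>V\<close>. Then every element is a unit of \<open>V\<close> times \<open>s\<close> to the
  power of its order at infinity, which determines \<open>V\<close>.\<close>

lemma Vinf_unique:
  assumes V: "V \<in> valuation_rings k F" and xV: "x \<notin> V"
  shows "V = Vinf"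
proof -
  interpret valuation_subring k F V by (rule valuation_subring.intro[OF F V])
  have kV: "c \<in> V" if "c \<in> k" for c using that k_V by auto
  have k_unit: "c \<in> V - nonunits V" if "c \<in> k" "c \<noteq> 0" for c
    unfolding unit_iff using that kV k_closed(7) by auto
  define s where "s = x / y"
  have ix: "inverse x \<in> nonunits V" by (rule inverse_nonunit[OF x xV])
  \<comment> \<open>Dividing the curve equation by \<open>x * x\<close> expresses \<open>x\<close>
    as a polynomial in \<open>y / x\<close> and \<open>inverse x\<close> over \<open>k\<close>; with
    both in \<open>V\<close>, so would be \<open>x\<close>.\<close>
  have yx: "y / x \<notin> V"
  proof
    assume w: "y / x \<in> V"
    define w' i where "w' = y / x" and "i = inverse x"
    have i: "x * i = 1" "y = w' * x" using x_nz by (auto simp: i_def w'_def)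
    have "y * y = poly cub x - poly lin x * y" using curve on_curve_iff by simp
    then have "x * x * x = y * y + (a3 + x * a1) * y - a6 - a4 * x - a2 * x * x"
      by (simp add: cub_def lin_def algebra_simps)
    then have *: "i * i * (x * x * x) = i * i * (y * y + (a3 + x * a1) * y - a6 - a4 * x - a2 * x * x)" by simp
    have "i * i * (x * x * x) = (x * i) * (x * i) * x" by (simp only: mult_ac)
    then have "i * i * (x * x * x) = x" using i(1) by simp
    moreover have "i * i * (y * y + (a3 + x * a1) * y - a6 - a4 * x - a2 * x * x) =
        w' * w' + (a3 * i + a1) * w' - a6 * i * i - a4 * i - a2"
    proof -
      have "i * i * (y * y + (a3 + x * a1) * y - a6 - a4 * x - a2 * x * x) =
        (x * i) * (x * i) * (w' * w') + (x * i) * (a3 * i + a1 * (x * i)) * w' - a6 * i * i - a4 * i * (x * i) - a2 * (x * i) * (x * i)"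
        unfolding i(2) by (simp add: algebra_simps)
      then show ?thesis unfolding i(1) by (simp add: algebra_simps)
    qed
    ultimately have "x = w' * w' + (a3 * i + a1) * w' - a6 * i * i - a4 * i - a2"
      using * by simp
    moreover have "\<dots> \<in> V" using w ix[folded i_def] nonunits_in_V[of i] coeffs[THEN kV] unfolding w'_def[symmetric]
      by (intro V_closed(4-6)) auto
    ultimately show False using xV by simp
  qed
  then have sn: "s \<in> nonunits V" using inverse_nonunit[OF F_closed(8)[OF y x] yx] by (simp add: s_def)
  have s_nz: "s \<noteq> 0" using x_nz y_nz by (simp add: s_def)
  have iy: "inverse y \<in> nonunits V"
    using nonunits_mult[OF sn, of "inverse x"] ix nonunits_in_V x_nz y_nz by (simp add: s_def divide_inverse mult.assoc[symmetric])
  \<comment> \<open>\<open>D\<close> is \<open>poly cub x\<close> divided by \<open>x^3\<close>, and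
    \<open>G\<close> is the left side \<open>y^2 + a1 x y + a3 y\<close> divided by
    \<open>y^2\<close>. Both are 1 plus a nonunit, and the curve equation reads
    \<open>G = x * s^2 * D\<close>.\<close>
  define D where "D = 1 + (a2 * inverse x + a4 * inverse x * inverse x + a6 * inverse x * inverse x * inverse x)"
  define G where "G = 1 + (a1 * s + a3 * inverse y)"
  have one_unit: "1 \<in> V - nonunits V" using V_closed one_notin_nonunits by auto
  have Du: "D \<in> V - nonunits V" unfolding D_def
    by (rule unit_add_nonunit[OF one_unit])
      (use ix coeffs kV nonunits_mult nonunits_add V_closed nonunits_in_V in \<open>simp add: mult.assoc\<close>)
  have Gu: "G \<in> V - nonunits V" unfolding G_def
    by (rule unit_add_nonunit[OF one_unit]) (use sn iy coeffs kV nonunits_mult nonunits_add in auto)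
  have "y * y = poly cub x - poly lin x * y" using curve on_curve_iff by simp
  then have e: "y * y + (a3 + x * a1) * y = x * x * x + a2 * x * x + a4 * x + a6"
    by (simp add: cub_def lin_def algebra_simps)
  have GD: "G = x * (s * s) * D"
  proof -
    define i j where "i = inverse x" and "j = inverse y"
    have ij: "x * i = 1" "y * j = 1" "s = x * j" using x_nz y_nz by (auto simp: i_def j_def s_def divide_inverse)
    have "j * j * (y * y + (a3 + x * a1) * y) = (y * j) * (y * j) + (a3 * j + a1 * (x * j)) * (y * j)"
      by (simp add: algebra_simps)
    then have 1: "G = j * j * (y * y + (a3 + x * a1) * y)"
      unfolding ij(2) G_def by (simp add: ij(3) j_def)
    have "x * (s * s) * D = j * j * (x * x * x + a2 * x * x * (x * i) + a4 * x * (x * i) * (x * i) + a6 * (x * i) * (x * i) * (x * i))"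
      unfolding D_def ij(3) i_def[symmetric] by (simp add: algebra_simps)
    then show ?thesis unfolding 1 e ij(1) by simp
  qed
  have ixs: "x = s powi (- 2) * (G * inverse D)"
  proof -
    have D0: "D * inverse D = 1" using Du nonunits_0 by (intro right_inverse) auto
    have "s powi (- 2) = inverse (s * s)" by (simp add: power_int_minus power2_eq_square)
    moreover have "inverse (s * s) * (s * s) = 1"
      by (rule left_inverse) (use s_nz in simp)
    ultimately have 1: "s powi (- 2) * (s * s) = 1" by (simp only:)
    have "s powi (- 2) * (G * inverse D) = (s powi (- 2) * (s * s)) * x * (D * inverse D)"
      unfolding GD by (simp only: mult_ac)
    then show ?thesis unfolding 1 D0 by simp
  qed
  define u where "u = G * inverse D"
  have uu: "u \<in> V - nonunits V" unfolding u_def using unit_mult[OF Gu unit_inverse[OF Du]] .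
  have xs: "x = s powi (- 2) * u" using ixs by (simp add: u_def)
  have ys: "y = s powi (- 3) * u"
  proof -
    have "y = x * inverse s" using x_nz y_nz by (simp add: s_def)
    also have "\<dots> = s powi (- 2) * s powi (- 1) * u" by (subst xs) simp
    also have "s powi (- 2) * s powi (- 1) = s powi (- 3)" using s_nz by (subst power_int_add[symmetric]) auto
    finally show ?thesis .
  qed
  \<comment> \<open>\<open>poly p x\<close> is a power of \<open>x\<close> times the reversed
    polynomial at \<open>inverse x\<close>. The latter is a unit: its constant term is the leading
    coefficient of \<open>p\<close>, and the rest is a multiple of the nonunit
    \<open>inverse x\<close>.\<close>
  have polyx: "\<exists>w\<in>V - nonunits V. poly p x = s powi (- int (2 * Polynomial.degree p)) * w" if p: "p \<in> polys k" "p \<noteq> 0" for p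
  proof -
    let ?n = "Polynomial.degree p"
    obtain c r where cr: "reflect_poly p = pCons c r" by (cases "reflect_poly p")
    have "reflect_poly p \<in> polys k" using p(1) k_closed(1) by (auto simp: polys_def coeff_reflect_poly)
    then have c: "c \<in> k" "r \<in> polys k" using cr polys_pCons_iff[OF kr] by auto
    have "c = Polynomial.coeff (reflect_poly p) 0" by (simp add: cr)
    then have c0: "c \<noteq> 0" using p(2) by (simp add: coeff_0_reflect_poly)
    have rV: "poly r (inverse x) \<in> V"
      using poly_in_subrng[OF subrng_V] c(2) polys_mono[of k V] k_V ix nonunits_in_V by blast
    define w where "w = c + poly r (inverse x) * inverse x"
    have wu: "w \<in> V - nonunits V" unfolding w_def
      by (rule unit_add_nonunit[OF k_unit[OF c(1) c0] nonunits_mult[OF ix rV]])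
    have "poly (reflect_poly p) (inverse x) = inverse x ^ ?n * poly p x"
      using x_nz by (simp add: poly_reflect_poly_nz)
    then have "w = inverse x ^ ?n * poly p x" by (simp add: cr w_def mult.commute)
    then have "poly p x = x powi (int ?n) * w" using x_nz by (simp add: power_inverse)
    also have "x powi (int ?n) = s powi (- int (2 * ?n)) * u powi (int ?n)"
    proof -
      have e: "(- 2) * int ?n = - int (2 * ?n)" by simp
      have "x powi (int ?n) = (s powi (- 2) * u) powi (int ?n)" using arg_cong[OF xs] .
      also have "\<dots> = s powi (- int (2 * ?n)) * u powi (int ?n)"
        by (simp only: power_int_mult_distrib power_int_mult[symmetric] e)
      finally show ?thesis .
    qed
    finally show ?thesis using unit_mult[OF unit_powi[OF uu, of "int ?n"] wu] by (auto simp: mult.assoc)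
  qed
  have sum: "\<exists>w\<in>V - nonunits V. s powi i * u1 + s powi j * u2 = s powi i * w"
    if "u1 \<in> V - nonunits V" "u2 \<in> V - nonunits V" "i < j" for i j u1 u2
  proof
    have "s powi j = s powi i * s powi (j - i)" using s_nz by (simp flip: power_int_add)
    then show "s powi i * u1 + s powi j * u2 = s powi i * (u1 + u2 * s powi (j - i))" by (simp add: algebra_simps)
    show "u1 + u2 * s powi (j - i) \<in> V - nonunits V"
      using that by (intro unit_add_nonunit nonunits_mult powi_pos_nonunit sn) auto
  qed
  have evx: "\<exists>w\<in>V - nonunits V. ev f x y = s powi (- int (weight f)) * w" if f: "f \<in> pp" "f \<noteq> (0, 0)" for f
  proof -
    obtain p q where pq: "f = (p, q)" "p \<in> polys k" "q \<in> polys k" using f(1) by (auto simp: pp_def)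
    show ?thesis
    proof (cases "q = 0")
      case True
      then show ?thesis using polyx[of p] pq f by (auto simp: weight_def)
    next
      case q0: False
      obtain w where w: "w \<in> V - nonunits V" "poly q x = s powi (- int (2 * Polynomial.degree q)) * w"
        using polyx[OF pq(3) q0] by blast
      have "poly q x * y = (s powi (- int (2 * Polynomial.degree q)) * s powi (- 3)) * (w * u)"
        by (subst ys) (simp add: w(2) mult_ac)
      also have "s powi (- int (2 * Polynomial.degree q)) * s powi (- 3) = s powi (- int (2 * Polynomial.degree q + 3))"
        using s_nz by (subst power_int_add[symmetric]) (auto simp: algebra_simps)
      finally have qy: "poly q x * y = s powi (- int (2 * Polynomial.degree q + 3)) * (w * u)" .
      have wu: "w * u \<in> V - nonunits V" by (rule unit_mult[OF w(1) uu])
      show ?thesis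
      proof (cases "p = 0")
        case True
        then show ?thesis using qy wu q0 pq by (intro bexI[of _ "w * u"]) (auto simp: weight_def ev_def)
      next
        case p0: False
        obtain w' where w': "w' \<in> V - nonunits V" "poly p x = s powi (- int (2 * Polynomial.degree p)) * w'"
          using polyx[OF pq(2) p0] by blast
        define i j where "i = - int (2 * Polynomial.degree p)" and "j = - int (2 * Polynomial.degree q + 3)"
        have ev: "ev f x y = s powi i * w' + s powi j * (w * u)" using w' qy pq by (simp add: ev_def i_def j_def)
        have wt: "- int (weight f) = min i j" using q0 pq by (auto simp: weight_def i_def j_def)
        \<comment> \<open>One exponent is even and the other odd, so the term of lower order always
          dominates.\<close>
        have "i \<noteq> j" unfolding i_def j_def by presburger
        then consider "i < j" | "j < i" by linarith
        then show ?thesis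
        proof cases
          case 1
          then show ?thesis using sum[OF w'(1) wu 1] ev wt by simp
        next
          case 2
          then show ?thesis using sum[OF wu w'(1) 2] ev wt by (simp add: add.commute)
        qed
      qed
    qed
  qed
  have main: "\<exists>w\<in>V - nonunits V. z = s powi (vinf z) * w" if z: "z \<in> F - {0}" for z
  proof -
    have "z \<in> F" using z by auto
    then obtain f g where fg: "f \<in> pp" "g \<in> pp" "g \<noteq> (0, 0)" "z = ev f x y / ev g x y" by (rule F_fractions)
    have f0: "f \<noteq> (0, 0)" using z fg by (auto simp: ev_def)
    obtain w where w: "w \<in> V - nonunits V" "ev f x y = s powi (- int (weight f)) * w" using evx[OF fg(1) f0] by blast
    obtain w' where w': "w' \<in> V - nonunits V" "ev g x y = s powi (- int (weight g)) * w'" using evx[OF fg(2,3)] by blast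
    have "z = (s powi (- int (weight f)) * inverse (s powi (- int (weight g)))) * (w * inverse w')"
      by (simp add: fg(4) w(2) w'(2) divide_inverse mult_ac)
    also have "s powi (- int (weight f)) * inverse (s powi (- int (weight g))) = s powi (vinf z)"
    proof -
      have v: "vinf z = - int (weight f) + int (weight g)" using vinf_eq[OF fg(1,2) f0 fg(3)] fg(4) by simp
      have "inverse (s powi (- int (weight g))) = s powi (int (weight g))"
        by (simp only: power_int_minus inverse_inverse_eq)
      then show ?thesis unfolding v using power_int_add[of s "- int (weight f)" "int (weight g)"] s_nz by simp
    qed
    finally show ?thesis using unit_mult[OF w(1) unit_inverse[OF w'(1)]] by blast
  qed
  have sub: "z \<in> V" if z: "z \<in> F - {0}" "vinf z \<ge> 0" for z
  proof -
    obtain w where w: "w \<in> V - nonunits V" "z = s powi (vinf z) * w" using main[OF z(1)] by blast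
    have "s powi (vinf z) \<in> V"
      using z(2) subrng_power[OF subrng_V nonunits_in_V[OF sn]] by (simp add: power_int_def)
    show ?thesis by (subst w(2), rule V_closed(5)) (use w(1) \<open>s powi (vinf z) \<in> V\<close> in auto)
  qed
  have sup: "vinf z \<ge> 0" if z: "z \<in> F - {0}" "z \<in> V" for z
  proof (rule ccontr)
    assume neg: "\<not> vinf z \<ge> 0"
    obtain w where w: "w \<in> V - nonunits V" "z = s powi (vinf z) * w" using main[OF z(1)] by blast
    have "w \<noteq> 0" using z w by auto
    have gen: "inverse w * z = c" if "z = c * w" for c using that \<open>w \<noteq> 0\<close> by simp
    have "inverse w * z = s powi (vinf z)" by (rule gen[OF w(2)])
    moreover have "inverse w * z \<in> V" using V_closed(5)[of "inverse w" z] unit_inverse[OF w(1)] z(2) by auto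
    ultimately have "s powi (vinf z) \<in> V" by (simp only:)
    moreover have "s powi (- vinf z) \<in> nonunits V" using powi_pos_nonunit[OF sn, of "- vinf z"] neg by simp
    ultimately show False using s_nz by (auto simp: nonunits_def power_int_minus)
  qed
  show ?thesis
    unfolding Vinf_def using sub sup V_in_F V_closed(1) by auto
qed

lemma x_notin_Vinf: "x \<notin> Vinf"
  using x_nz vinf_x by (auto simp: Vinf_def)

text \<open>At a place without uniformizer \<open>valuation\<close> could be any integer, negative
  ones included. With a uniformizer, \<open>x\<close> in \<open>V\<close> has nonnegative value, so
  the description singles out the one place where \<open>x\<close> is not regular.\<close>

lemma infinite_place_eq:
  assumes "\<And>V. V \<in> valuation_rings k F \<Longrightarrow> x \<in> V \<Longrightarrow> \<exists>t. uniformizer F V t"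
  shows "infinite_place k F x y = nonunits Vinf"
  unfolding infinite_place_def
proof (rule the_equality)
  show "nonunits Vinf \<in> places k F \<and> valuation F (nonunits Vinf) x < 0 \<and> valuation F (nonunits Vinf) y < 0"
    using Vinf_valuation[of x] Vinf_valuation[of y] x y x_nz y_nz vinf_x vinf_y
      valuation_subring.nonunits_in_places[OF valuation_subring.intro[OF F Vinf_valuation_ring]] by auto
next
  fix P assume P: "P \<in> places k F \<and> valuation F P x < 0 \<and> valuation F P y < 0"
  then obtain V where VR: "V \<in> valuation_rings k F" "P = nonunits V" using places_iff[OF F] by blast
  have "x \<notin> V"
  proof
    assume xV: "x \<in> V"
    then obtain t where t: "uniformizer F V t" using assms VR by blast
    interpret discrete_valuation_subring k F V t by (rule discrete_valuation_subringI[OF F VR(1) t])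
    show False using in_V_iff_v[of x] xV x x_nz P VR(2) by auto
  qed
  then show "P = nonunits Vinf" using Vinf_unique VR by auto
qed

end

subsection \<open>Affine places\<close>

locale weierstrass_point = weierstrass_field +
  fixes a b
  assumes a: "a \<in> k" and b: "b \<in> k" and ab: "on_curve a b"
    and smooth: "\<not> weierstrass_singular a1 a2 a3 a4 a6 a b"
begin


text \<open>The graph of evaluation at \<open>(a, b)\<close>, kept as a relation so that no fraction
  has to be chosen when sums and products are formed.\<close>

definition residue_is :: "'a \<Rightarrow> 'a \<Rightarrow> bool" where
  "residue_is r c \<longleftrightarrow> (\<exists>f\<in>pp. \<exists>g\<in>pp. ev g a b \<noteq> 0 \<and> r = ev f x y / ev g x y \<and> c = ev f a b / ev g a b)"

definition local_ring :: "'a set" where "local_ring = {r. \<exists>c. residue_is r c}"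

lemma ev_nz_if: "g \<in> pp \<Longrightarrow> ev g a b \<noteq> 0 \<Longrightarrow> ev g x y \<noteq> 0"
  using ev_eq_0_iff[of g] by (auto simp: ev_def)

lemma residue_is_ev: "f \<in> pp \<Longrightarrow> residue_is (ev f x y) (ev f a b)"
  unfolding residue_is_def using pp_closed(4)[OF k_closed(2)]
  by (intro bexI[of _ f] bexI[of _ "pconst 1"]) auto

lemma residue_is_const: "c \<in> k \<Longrightarrow> residue_is c c"
  and residue_is_x: "residue_is x a" and residue_is_y: "residue_is y b"
  using residue_is_ev[OF pp_closed(4)] residue_is_ev[OF pp_closed(5)] residue_is_ev[OF pp_closed(6)] by auto

lemma residue_is_add:
  assumes "residue_is r c" "residue_is s d"
  shows "residue_is (r + s) (c + d)"
proof -
  obtain f g where fg: "f \<in> pp" "g \<in> pp" "ev g a b \<noteq> 0" "r = ev f x y / ev g x y" "c = ev f a b / ev g a b"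
    using assms(1) unfolding residue_is_def by blast
  obtain f' g' where fg': "f' \<in> pp" "g' \<in> pp" "ev g' a b \<noteq> 0" "s = ev f' x y / ev g' x y" "d = ev f' a b / ev g' a b"
    using assms(2) unfolding residue_is_def by blast
  have nz: "ev g x y \<noteq> 0" "ev g' x y \<noteq> 0" using ev_nz_if fg fg' by auto
  have "r + s = ev (padd (pmul f g') (pmul f' g)) x y / ev (pmul g g') x y"
    unfolding fg(4) fg'(4) ev_padd ev_pmul[OF curve] using nz by (simp add: add_frac_eq)
  moreover have "c + d = ev (padd (pmul f g') (pmul f' g)) a b / ev (pmul g g') a b"
    unfolding fg(5) fg'(5) ev_padd ev_pmul[OF ab] using fg(3) fg'(3) by (simp add: add_frac_eq)
  ultimately show ?thesis unfolding residue_is_def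
    using fg(1-3) fg'(1-3) pp_closed(1,2) ev_pmul[OF ab]
    by (intro bexI[of _ "padd (pmul f g') (pmul f' g)"] bexI[of _ "pmul g g'"]) auto
qed

lemma residue_is_mult:
  assumes "residue_is r c" "residue_is s d"
  shows "residue_is (r * s) (c * d)"
proof -
  obtain f g where fg: "f \<in> pp" "g \<in> pp" "ev g a b \<noteq> 0" "r = ev f x y / ev g x y" "c = ev f a b / ev g a b"
    using assms(1) unfolding residue_is_def by blast
  obtain f' g' where fg': "f' \<in> pp" "g' \<in> pp" "ev g' a b \<noteq> 0" "s = ev f' x y / ev g' x y" "d = ev f' a b / ev g' a b"
    using assms(2) unfolding residue_is_def by blast
  have "r * s = ev (pmul f f') x y / ev (pmul g g') x y" "c * d = ev (pmul f f') a b / ev (pmul g g') a b"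
    unfolding fg(4,5) fg'(4,5) ev_pmul[OF curve] ev_pmul[OF ab] by auto
  then show ?thesis unfolding residue_is_def
    using fg(1-3) fg'(1-3) pp_closed(1) ev_pmul[OF ab]
    by (intro bexI[of _ "pmul f f'"] bexI[of _ "pmul g g'"]) auto
qed

lemma residue_is_uminus: "residue_is r c \<Longrightarrow> residue_is (- r) (- c)"
  using residue_is_mult[OF residue_is_const, of "- 1"] k_closed(3)[OF k_closed(2)] by fastforce

lemma residue_is_diff: "residue_is r c \<Longrightarrow> residue_is s d \<Longrightarrow> residue_is (r - s) (c - d)"
  using residue_is_add[OF _ residue_is_uminus, of r c s d] by simp

lemma residue_is_inverse:
  assumes "residue_is r c" "c \<noteq> 0"
  shows "residue_is (inverse r) (inverse c)" and "r \<noteq> 0"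
proof -
  obtain f g where fg: "f \<in> pp" "g \<in> pp" "ev g a b \<noteq> 0" "r = ev f x y / ev g x y" "c = ev f a b / ev g a b"
    using assms(1) unfolding residue_is_def by blast
  then have "ev f a b \<noteq> 0" using assms(2) by auto
  then show "residue_is (inverse r) (inverse c)" "r \<noteq> 0"
    unfolding residue_is_def using fg ev_nz_if by (force, simp)
qed

text \<open>Cross-multiplication gives an equality at \<open>(x, y)\<close>, which by
  \<open>ev_inj\<close> is an identity of pairs and can therefore be evaluated at
  \<open>(a, b)\<close>.\<close>

lemma residue_is_unique:
  assumes "residue_is r c" "residue_is r d"
  shows "c = d"
proof -
  obtain f g where fg: "f \<in> pp" "g \<in> pp" "ev g a b \<noteq> 0" "r = ev f x y / ev g x y" "c = ev f a b / ev g a b"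
    using assms(1) unfolding residue_is_def by blast
  obtain f' g' where fg': "f' \<in> pp" "g' \<in> pp" "ev g' a b \<noteq> 0" "r = ev f' x y / ev g' x y" "d = ev f' a b / ev g' a b"
    using assms(2) unfolding residue_is_def by blast
  have nz: "ev g x y \<noteq> 0" "ev g' x y \<noteq> 0" using ev_nz_if fg fg' by auto
  have "ev (pmul f g') x y = ev (pmul f' g) x y"
    using fg(4) fg'(4) nz by (simp add: ev_pmul[OF curve] frac_eq_eq)
  then have "pmul f g' = pmul f' g" by (intro ev_inj pp_closed(1) fg fg')
  then have "ev f a b * ev g' a b = ev f' a b * ev g a b"
    using ev_pmul[OF ab, of f g'] ev_pmul[OF ab, of f' g] by simp
  then show ?thesis unfolding fg(5) fg'(5) using fg(3) fg'(3) by (simp add: frac_eq_eq)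
qed

lemma residue_in_k: "residue_is r c \<Longrightarrow> c \<in> k"
  unfolding residue_is_def ev_def pp_def
  using poly_in_subrng[OF kr _ a] b k_closed by auto

lemma residue_in_F: "residue_is r c \<Longrightarrow> r \<in> F"
  unfolding residue_is_def using ev_in_F F_closed by auto

lemma subrng_local_ring: "subrng local_ring"
  using residue_is_const[OF k_closed(2)] residue_is_diff residue_is_mult
  by (intro subrngI) (auto simp: local_ring_def, blast+)

text \<open>
  The partial derivatives of the Weierstrass polynomial at \<open>(a, b)\<close>. If \<open>dv\<close> is nonzero then
  \<open>x - a\<close> is a uniformizer; otherwise \<open>y - b\<close> is, and \<open>x - a\<close> is its square up to a unit.
\<close>

definition dv where "dv = 2 * b + a1 * a + a3"
definition du where "du = a1 * b - (3 * a^2 + 2 * a2 * a + a4)"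

lemma du_if_dv: "dv = 0 \<Longrightarrow> du \<noteq> 0"
  using smooth ab by (auto simp: weierstrass_singular_def dv_def du_def)

text \<open>The expansion of the Weierstrass polynomial at \<open>(a, b)\<close>, whose value is 0
  at both points. The terms containing \<open>y - b\<close> are collected on the left and the pure
  powers of \<open>x - a\<close> on the right.\<close>

lemma taylor: "(y - b) * (dv + (y - b) + a1 * (x - a)) = (x - a) * (- du + (3 * a + a2) * (x - a) + (x - a) * (x - a))"
proof -
  have "weierstrass a1 a2 a3 a4 a6 x y - weierstrass a1 a2 a3 a4 a6 a b =
    (y - b) * (dv + (y - b) + a1 * (x - a)) - (x - a) * (- du + (3 * a + a2) * (x - a) + (x - a) * (x - a))"
    unfolding weierstrass_def dv_def du_def by (simp add: power2_eq_square power3_eq_cube algebra_simps)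
  then show ?thesis using curve ab by simp
qed

lemma du_in_k: "du \<in> k" and dv_in_k: "dv \<in> k" and c3_in_k: "3 * a + a2 \<in> k"
  unfolding du_def dv_def using a b coeffs subrng_numeral[OF kr] subrng_power[OF kr]
  by (auto intro!: k_closed(4,5,6))

lemma residue_xa: "residue_is (x - a) 0" and residue_yb: "residue_is (y - b) 0"
  using residue_is_diff[OF residue_is_x residue_is_const[OF a]]
    residue_is_diff[OF residue_is_y residue_is_const[OF b]] by auto

definition t where "t = (if dv \<noteq> 0 then x - a else y - b)"

lemma residue_t: "residue_is t 0"
  using residue_xa residue_yb by (simp add: t_def)

lemma xa_nz: "x - a \<noteq> 0" and yb_nz: "y - b \<noteq> 0"
proof -
  have "([:- a, 1:], 0) \<in> pp" "([:- b:], 1) \<in> pp"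
    using a b k_closed(1,2,3) by (auto simp: pp_def polys_pCons_iff[OF kr] polys_0[OF kr] polys_1[OF kr])
  from this[THEN ev_eq_0_iff] show "x - a \<noteq> 0" "y - b \<noteq> 0"
    by (auto simp: ev_def)
qed

lemma t_nz: "t \<noteq> 0" using xa_nz yb_nz by (simp add: t_def)

text \<open>In \<open>taylor\<close> the factor accompanying \<open>y - b\<close> has residue
  \<open>dv\<close>, hence is a unit and can be divided out.\<close>

lemma yb_unramified: "dv \<noteq> 0 \<Longrightarrow> \<exists>c. \<exists>r. residue_is r c \<and> y - b = t * r"
proof -
  assume dv: "dv \<noteq> 0"
  define D where "D = dv + (y - b) + a1 * (x - a)"
  have "residue_is D (dv + 0 + a1 * 0)" unfolding D_def
    by (intro residue_is_add residue_is_mult residue_is_const dv_in_k coeffs residue_xa residue_yb)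
  then have D: "residue_is (inverse D) (inverse dv)" "D \<noteq> 0" using residue_is_inverse[of D dv] dv by auto
  define G where "G = - du + (3 * a + a2) * (x - a) + (x - a) * (x - a)"
  have G: "residue_is G (- du + (3 * a + a2) * 0 + 0 * 0)" unfolding G_def
    by (intro residue_is_add residue_is_mult residue_is_uminus residue_is_const du_in_k c3_in_k residue_xa)
  have "(y - b) * D = (x - a) * G" unfolding D_def G_def by (rule taylor)
  then have "y - b = t * (G * inverse D)" using D(2) dv by (simp add: t_def field_simps)
  then show ?thesis using residue_is_mult[OF G D(1)] by blast
qed

text \<open>With \<open>dv = 0\<close> the mixed term of \<open>taylor\<close> is moved to the
  right, which leaves \<open>(y - b)^2 = (x - a) * G\<close>, where \<open>G\<close> has residue
  \<open>- du\<close>, nonzero by smoothness.\<close>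

lemma xa_ramified: "dv = 0 \<Longrightarrow> \<exists>c. \<exists>r. residue_is r c \<and> c \<noteq> 0 \<and> x - a = t * t * r"
proof -
  assume dv: "dv = 0"
  define G where "G = - du + (3 * a + a2) * (x - a) + (x - a) * (x - a) - a1 * (y - b)"
  have "residue_is G (- du + (3 * a + a2) * 0 + 0 * 0 - a1 * 0)" unfolding G_def
    by (intro residue_is_add residue_is_diff residue_is_mult residue_is_uminus residue_is_const du_in_k c3_in_k coeffs residue_xa residue_yb)
  then have G: "residue_is (inverse G) (inverse (- du))" "G \<noteq> 0"
    using residue_is_inverse[of G "- du"] du_if_dv[OF dv] by auto
  have "(x - a) * G = (y - b) * (y - b)"
    using taylor dv unfolding G_def by (simp add: algebra_simps)
  then have "x - a = t * t * inverse G" using G(2) dv by (simp add: t_def field_simps)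
  then show ?thesis using G(1) du_if_dv[OF dv] by (intro exI[of _ "inverse (- du)"] exI[of _ "inverse G"]) auto
qed

lemma xa_yb_multiples: "\<exists>c r. residue_is r c \<and> x - a = t * r" "\<exists>c r. residue_is r c \<and> y - b = t * r"
proof -
  have one: "residue_is 1 1" using residue_is_const[OF k_closed(2)] .
  show "\<exists>c r. residue_is r c \<and> x - a = t * r"
  proof (cases "dv = 0")
    case True
    then obtain c r where "residue_is r c" "x - a = t * t * r" using xa_ramified by blast
    then show ?thesis using residue_is_mult[OF residue_t, of r c] by (auto simp: mult.assoc)
  qed (use one in \<open>auto simp: t_def\<close>)
  show "\<exists>c r. residue_is r c \<and> y - b = t * r"
    using yb_unramified one by (cases "dv = 0") (auto simp: t_def)
qed

text \<open>Expanding both polynomials at \<open>a\<close> leaves the value at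
  \<open>(a, b)\<close>, a multiple of \<open>x - a\<close>, and a multiple of
  \<open>y - b\<close>.\<close>

lemma ev_multiple:
  assumes f: "f \<in> pp" "ev f a b = 0"
  shows "\<exists>c r. residue_is r c \<and> ev f x y = t * r"
proof -
  obtain p q where pq: "f = (p, q)" "p \<in> polys k" "q \<in> polys k" using f(1) by (auto simp: pp_def)
  define p1 q1 where "p1 = synthetic_div p a" and "q1 = synthetic_div q a"
  have p1q1: "(p1, q1) \<in> pp" using synthetic_div_polys[OF kr a] pq by (auto simp: pp_def p1_def q1_def)
  have qa: "poly q a \<in> k" using poly_in_subrng[OF kr pq(3) a] .
  obtain c1 r1 where 1: "residue_is r1 c1" "x - a = t * r1" using xa_yb_multiples(1) by blast
  obtain c2 r2 where 2: "residue_is r2 c2" "y - b = t * r2" using xa_yb_multiples(2) by blast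
  have "poly p a + poly q a * b = 0" using f(2) by (simp add: ev_def pq)
  moreover have "ev f x y = (poly p a + poly q a * b) + (x - a) * ev (p1, q1) x y + (y - b) * poly q a"
    unfolding ev_def pq fst_conv snd_conv poly_synthetic_div[of p x a] poly_synthetic_div[of q x a] p1_def q1_def
    by (simp add: algebra_simps)
  ultimately have "ev f x y = t * (r1 * ev (p1, q1) x y + r2 * poly q a)"
    by (simp add: 1(2) 2(2) algebra_simps)
  then show ?thesis
    using residue_is_add[OF residue_is_mult[OF 1(1) residue_is_ev[OF p1q1]] residue_is_mult[OF 2(1) residue_is_const[OF qa]]]
    by blast
qed

lemma residue_0_multiple:
  assumes "residue_is r 0"
  shows "\<exists>c r'. residue_is r' c \<and> r = t * r'"
proof -
  obtain f g where fg: "f \<in> pp" "g \<in> pp" "ev g a b \<noteq> 0" "r = ev f x y / ev g x y" "0 = ev f a b / ev g a b"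
    using assms unfolding residue_is_def by blast
  then have "ev f a b = 0" by auto
  from ev_multiple[OF fg(1) this] obtain c s where s: "residue_is s c" "ev f x y = t * s" by blast
  have "residue_is (inverse (ev g x y)) (inverse (ev g a b))"
    using residue_is_inverse[OF residue_is_ev[OF fg(2)] fg(3)] by blast
  from residue_is_mult[OF s(1) this] show ?thesis
    using s(2) fg(4) by (auto simp: divide_inverse mult.assoc)
qed

lemma local_ring_valuation_ring: "local_ring \<in> valuation_rings k F" and local_ring_uniformizer: "uniformizer F local_ring t"
proof -
  have kR: "k \<subseteq> local_ring" using residue_is_const by (auto simp: local_ring_def)
  have RF: "local_ring \<subseteq> F" using residue_in_F by (auto simp: local_ring_def)
  have tR: "t \<in> local_ring" using residue_t by (auto simp: local_ring_def)
  have it: "inverse t \<notin> local_ring"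
  proof
    assume "inverse t \<in> local_ring"
    then obtain c where "residue_is (inverse t) c" by (auto simp: local_ring_def)
    from residue_is_mult[OF residue_t this] have "residue_is 1 0" using t_nz by simp
    then show False using residue_is_unique[OF residue_is_const[OF k_closed(2)], of 0] by auto
  qed
  have loc: "r = 0 \<or> inverse r \<in> local_ring \<or> (\<exists>r'\<in>local_ring. r = t * r')" if r: "r \<in> local_ring" for r
  proof -
    obtain c where c: "residue_is r c" using r by (auto simp: local_ring_def)
    show ?thesis
    proof (cases "c = 0")
      case True
      then show ?thesis using residue_0_multiple c by (auto simp: local_ring_def)
    next
      case False
      then show ?thesis using residue_is_inverse(1)[OF c] by (auto simp: local_ring_def)
    qed
  qed
  \<comment> \<open>The exponent \<open>e\<close>, equal to 1 or 2, is the ramification index of the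
    place over \<open>x = a\<close>.\<close>
  have "\<exists>e::nat. \<exists>w\<in>local_ring. inverse w \<in> local_ring \<and> w \<noteq> 0 \<and> x - a = t ^ e * w"
  proof (cases "dv = 0")
    case True
    then obtain c r where r: "residue_is r c" "c \<noteq> 0" "x - a = t * t * r" using xa_ramified by blast
    then show ?thesis using residue_is_inverse[OF r(1,2)]
      by (intro exI[of _ 2] bexI[of _ r]) (auto simp: local_ring_def power2_eq_square)
  next
    case False
    then show ?thesis using residue_is_const[OF k_closed(2)]
      by (intro exI[of _ 1] bexI[of _ 1]) (auto simp: local_ring_def t_def)
  qed
  then obtain e w where w: "w \<in> local_ring" "inverse w \<in> local_ring" "w \<noteq> 0" "x - a = t ^ e * w" by blast
  have bnd: "\<exists>r'\<in>local_ring. \<exists>m::nat. \<exists>u\<in>local_ring. inverse u \<in> local_ring \<and> u \<noteq> 0 \<and> r * r' = t ^ m * u"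
    if r: "r \<in> local_ring" "r \<noteq> 0" for r
  proof -
    obtain f g where fg: "f \<in> pp" "g \<in> pp" "ev g a b \<noteq> 0" "r = ev f x y / ev g x y"
      using r by (auto simp: local_ring_def residue_is_def)
    have f0: "f \<noteq> (0, 0)" using r fg by (auto simp: ev_def)
    obtain m q where mq: "q \<in> polys k" "pnorm f = [:- a, 1:] ^ m * q" "poly q a \<noteq> 0"
      using split_root_power[OF kr a pnorm_polys[OF fg(1)]] pnorm_nz_degree[OF f0] by blast
    \<comment> \<open>Multiplied by its denominator and by the conjugate of its numerator,
      \<open>r\<close> becomes a norm: a power of \<open>x - a\<close> times a polynomial that is
      nonzero at \<open>a\<close>.\<close>
    define r' where "r' = ev (pmul g (pconj f)) x y"
    have r': "r' \<in> local_ring"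
      using residue_is_ev[OF pp_closed(1)[OF fg(2) pp_closed(3)[OF fg(1)]]] by (auto simp: r'_def local_ring_def)
    have qx: "residue_is (poly q x) (poly q a)" using residue_is_ev[OF pp_closed(7)[OF mq(1)]] by simp
    define u where "u = w ^ m * poly q x"
    have "r * r' = ev f x y * ev (pconj f) x y"
      using ev_nz_if[OF fg(2,3)] by (simp add: r'_def fg(4) ev_pmul[OF curve])
    also have "\<dots> = (x - a) ^ m * poly q x" unfolding ev_pconj[OF curve] mq(2) by (simp add: poly_power)
    also have "\<dots> = t ^ (e * m) * u" unfolding w(4) u_def by (simp add: power_mult_distrib power_mult)
    finally have eq: "r * r' = t ^ (e * m) * u" .
    have "u \<in> local_ring" unfolding u_def
      using subrngD(5)[OF subrng_local_ring subrng_power[OF subrng_local_ring w(1), of m], of "poly q x"] qx by (auto simp: local_ring_def)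
    moreover have "inverse u \<in> local_ring" unfolding u_def inverse_mult_distrib power_inverse[symmetric]
      using subrngD(5)[OF subrng_local_ring subrng_power[OF subrng_local_ring w(2), of m], of "inverse (poly q x)"]
        residue_is_inverse(1)[OF qx mq(3)] by (auto simp: local_ring_def)
    moreover have "u \<noteq> 0" using w(3) residue_is_inverse(2)[OF qx mq(3)] by (simp add: u_def)
    ultimately show ?thesis using r' eq by blast
  qed
  have frac: "\<exists>r\<in>local_ring. \<exists>s\<in>local_ring. s \<noteq> 0 \<and> z = r / s" if zF: "z \<in> F" for z
  proof -
    obtain f g where fg: "f \<in> pp" "g \<in> pp" "g \<noteq> (0, 0)" "z = ev f x y / ev g x y" by (rule F_fractions[OF zF])
    have "ev f x y \<in> local_ring" "ev g x y \<in> local_ring"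
      using residue_is_ev[OF fg(1)] residue_is_ev[OF fg(2)] by (auto simp: local_ring_def)
    then show ?thesis using fg(4) ev_eq_0_iff[OF fg(2)] fg(3) by blast
  qed
  note * = valuation_ring_of_local_ring[OF k kR F RF subrng_local_ring tR t_nz it loc bnd frac]
  show "local_ring \<in> valuation_rings k F" "uniformizer F local_ring t" using * by blast+
qed

sublocale loc: discrete_valuation_subring k F local_ring t
  by (rule discrete_valuation_subringI[OF F local_ring_valuation_ring local_ring_uniformizer])

lemma residue_nonunit_iff:
  assumes "residue_is r c"
  shows "r \<in> nonunits local_ring \<longleftrightarrow> c = 0"
proof
  assume r: "r \<in> nonunits local_ring"
  show "c = 0"
  proof (rule ccontr)
    assume "c \<noteq> 0"
    from residue_is_inverse[OF assms this] show False using r by (auto simp: nonunits_def local_ring_def)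
  qed
next
  assume c: "c = 0"
  have "inverse r \<notin> local_ring" if "r \<noteq> 0"
  proof
    assume "inverse r \<in> local_ring"
    then obtain d where "residue_is (inverse r) d" by (auto simp: local_ring_def)
    from residue_is_mult[OF assms this] have "residue_is 1 0" using that c by simp
    then show False using residue_is_unique[OF residue_is_const[OF k_closed(2)], of 0] by auto
  qed
  then show "r \<in> nonunits local_ring" using assms by (auto simp: nonunits_def local_ring_def)
qed

lemma local_ring_rational: "\<forall>z\<in>local_ring. \<exists>c\<in>k. z - c \<in> nonunits local_ring"
proof
  fix z assume "z \<in> local_ring"
  then obtain c where c: "residue_is z c" by (auto simp: local_ring_def)
  have "residue_is (z - c) (c - c)" by (rule residue_is_diff[OF c residue_is_const[OF residue_in_k[OF c]]])
  then show "\<exists>c\<in>k. z - c \<in> nonunits local_ring"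
    using residue_nonunit_iff residue_in_k[OF c] by auto
qed

lemma v_xa: "loc.v (x - a) = (if dv = 0 then 2 else 1)"
proof (cases "dv = 0")
  case True
  then obtain c r where r: "residue_is r c" "c \<noteq> 0" "x - a = t * t * r" using xa_ramified by blast
  have "r \<in> local_ring - nonunits local_ring" using residue_nonunit_iff[OF r(1)] r(1,2) by (auto simp: local_ring_def)
  moreover have "x - a = t powi 2 * r" using r(3) by (simp add: power2_eq_square)
  ultimately have "loc.v (x - a) = 2" using loc.valuation_eqI by blast
  then show ?thesis using True by simp
next
  case False
  then show ?thesis using loc.v_t by (simp add: t_def)
qed

lemma v_yb_ramified: "dv = 0 \<Longrightarrow> loc.v (y - b) = 1"
  using loc.v_t by (simp add: t_def)

text \<open>Modulo \<open>nonunits V\<close>, evaluation at \<open>(x, y)\<close> agrees with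
  evaluation at \<open>(a, b)\<close>, so \<open>V\<close> contains the local ring. It cannot be
  larger, since an element of negative order would turn the nonunit \<open>t\<close> into a unit of
  \<open>V\<close>.\<close>

lemma local_ring_unique:
  assumes V: "V \<in> valuation_rings k F" and "x - a \<in> nonunits V" "y - b \<in> nonunits V"
  shows "V = local_ring"
proof -
  interpret V: valuation_subring k F V by (rule valuation_subring.intro[OF F V])
  have kV: "c \<in> V" if "c \<in> k" for c using that V.k_V by auto
  have polyV: "poly p x \<in> V \<and> poly p x - poly p a \<in> nonunits V" if "p \<in> polys k" for p
  proof -
    have xV: "x \<in> V" using V.V_closed(4)[OF V.nonunits_in_V[OF assms(2)] kV[OF a]] by simp
    have "synthetic_div p a \<in> polys V" using synthetic_div_polys[OF kr a that] polys_mono[of k V] V.k_V by blast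
    then have "poly (synthetic_div p a) x \<in> V" by (rule poly_in_subrng[OF V.subrng_V _ xV])
    then have "poly p x - poly p a \<in> nonunits V"
      using V.nonunits_mult[OF assms(2), of "poly (synthetic_div p a) x"] poly_synthetic_div[of p x a]
      by (simp add: mult.commute)
    moreover have "p \<in> polys V" using that polys_mono[of k V] V.k_V by blast
    ultimately show ?thesis using poly_in_subrng[OF V.subrng_V _ xV] by blast
  qed
  have evV: "ev f x y - ev f a b \<in> nonunits V" if "f \<in> pp" for f
  proof -
    have pq: "fst f \<in> polys k" "snd f \<in> polys k" using that by (auto simp: pp_def)
    have "ev f x y - ev f a b = (poly (fst f) x - poly (fst f) a) + b * (poly (snd f) x - poly (snd f) a) + poly (snd f) x * (y - b)"
      by (simp add: ev_def algebra_simps)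
    also have "\<dots> \<in> nonunits V"
      by (intro V.nonunits_add V.nonunits_mult) (use polyV[OF pq(1)] polyV[OF pq(2)] kV[OF b] assms in auto)
    finally show ?thesis .
  qed
  have ev_in: "ev f x y \<in> V" "ev f a b \<in> k" if "f \<in> pp" for f
  proof -
    show k: "ev f a b \<in> k" using residue_in_k[OF residue_is_ev[OF that]] .
    show "ev f x y \<in> V" using V.V_closed(4)[OF V.nonunits_in_V[OF evV[OF that]] kV[OF k]] by simp
  qed
  have "local_ring \<subseteq> V"
  proof
    fix r assume "r \<in> local_ring"
    then obtain f g where fg: "f \<in> pp" "g \<in> pp" "ev g a b \<noteq> 0" "r = ev f x y / ev g x y"
      by (auto simp: local_ring_def residue_is_def)
    have "ev g a b \<in> V - nonunits V" unfolding V.unit_iff using fg(3) ev_in[OF fg(2)] kV k_closed(7) by auto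
    from V.unit_add_nonunit[OF this evV[OF fg(2)]] have "ev g x y \<in> V - nonunits V" by simp
    then have "inverse (ev g x y) \<in> V" using V.unit_inverse by auto
    then show "r \<in> V" using V.V_closed(5)[OF ev_in(1)[OF fg(1)]] fg(4) by (simp add: divide_inverse)
  qed
  moreover have "z \<in> local_ring" if z: "z \<in> V" for z
  proof (rule ccontr)
    assume zR: "z \<notin> local_ring"
    have zF: "z \<in> F" "z \<noteq> 0" using V.V_in_F[OF z] zR loc.V_closed(1) by auto
    then obtain n u where nu: "u \<in> local_ring - nonunits local_ring" "z = t powi n * u" using loc.decompose by blast
    have n: "n < 0" using loc.in_V_iff_v[of z] zR zF loc.valuation_eqI[OF nu(2,1)] by auto
    have u0: "u \<noteq> 0" "inverse u \<in> local_ring" using nu(1) loc.unit_iff by auto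
    have tn: "t \<in> nonunits V" using assms by (simp add: t_def)
    have "t powi n = z * inverse u" using u0(1) by (simp add: nu(2))
    then have "t powi n \<in> V" using V.V_closed(5)[OF z, of "inverse u"] u0 \<open>local_ring \<subseteq> V\<close> by auto
    moreover have "t powi (- n) \<in> nonunits V" using V.powi_pos_nonunit[OF tn, of "- n"] n by simp
    ultimately show False using t_nz by (auto simp: nonunits_def power_int_minus)
  qed
  ultimately show ?thesis by blast
qed

end

subsection \<open>Curves over an algebraically closed field\<close>

locale weierstrass_closed = weierstrass_field +
  assumes root: "\<And>p. p \<in> polys k \<Longrightarrow> Polynomial.degree p > 0 \<Longrightarrow> \<exists>c\<in>k. poly p c = 0"
    and nonsing: "\<And>u v. u \<in> k \<Longrightarrow> v \<in> k \<Longrightarrow> \<not> weierstrass_singular a1 a2 a3 a4 a6 u v"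
begin

lemma weierstrass_pointI:
  assumes "a \<in> k" "b \<in> k" "on_curve a b"
  shows "weierstrass_point k F x y a1 a2 a3 a4 a6 a b"
  using assms nonsing
  by (intro weierstrass_point.intro weierstrass_field_axioms weierstrass_point_axioms.intro) auto

abbreviation R where "R \<equiv> weierstrass_point.local_ring k x y"

text \<open>\<open>p\<close> splits into linear factors over \<open>k\<close>; if all
  \<open>z - c\<close> were units of \<open>V\<close>, so would be \<open>poly p z\<close>.\<close>

lemma nonunit_root:
  assumes V: "V \<in> valuation_rings k F" and p: "p \<in> polys k" "p \<noteq> 0" and z: "z \<in> V" "poly p z \<in> nonunits V"
  shows "\<exists>c\<in>k. poly p c = 0 \<and> z - c \<in> nonunits V"
  using p z(2)
proof (induction "Polynomial.degree p" arbitrary: p rule: less_induct)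
  case less
  interpret V: valuation_subring k F V by (rule valuation_subring.intro[OF F V])
  have kV: "c \<in> V" if "c \<in> k" for c using that V.k_V by auto
  have "Polynomial.degree p \<noteq> 0"
  proof
    assume "Polynomial.degree p = 0"
    then obtain c where c: "p = [:c:]" by (metis degree_eq_zeroE)
    then have "c \<in> k" "c \<noteq> 0" using less.prems polys_pCons_iff[OF kr] by auto
    then show False using less.prems(3) kV k_closed(7) by (auto simp: c nonunits_def)
  qed
  then obtain c where c: "c \<in> k" "poly p c = 0" using root[OF less.prems(1)] by auto
  define q where "q = synthetic_div p c"
  have q: "q \<in> polys k" unfolding q_def by (rule synthetic_div_polys[OF kr c(1) less.prems(1)])
  have pq: "poly p u = (u - c) * poly q u" for u
    using poly_synthetic_div[of p u c] c(2) by (simp add: q_def)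
  have q0: "q \<noteq> 0" using poly_factor_root[OF c(2)] less.prems(2) by (auto simp: q_def)
  show ?case
  proof (cases "z - c \<in> nonunits V")
    case True
    then show ?thesis using c by auto
  next
    case False
    have zc: "z - c \<in> V" using V.V_closed(6)[OF z(1) kV[OF c(1)]] .
    have "poly q z \<in> nonunits V"
    proof (rule ccontr)
      assume "poly q z \<notin> nonunits V"
      moreover have "poly q z \<in> V"
        using poly_in_subrng[OF V.subrng_V _ z(1)] polys_mono[of k V] V.k_V q by blast
      ultimately have "(z - c) * poly q z \<in> V - nonunits V" using V.unit_mult zc False by auto
      then show False using less.prems(3) pq[of z] by auto
    qed
    then obtain d where "d \<in> k" "poly q d = 0" "z - d \<in> nonunits V"
      using less.hyps[OF _ q q0] degree_synthetic_div_less \<open>Polynomial.degree p \<noteq> 0\<close> unfolding q_def by blast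
    then show ?thesis using pq by auto
  qed
qed

text \<open>The point is formed by the residues of \<open>x\<close> and \<open>y\<close>. Both are
  roots of nonzero polynomials over \<open>k\<close> modulo the maximal ideal, hence lie in
  \<open>k\<close> by \<open>nonunit_root\<close>.\<close>

lemma affine_place:
  assumes V: "V \<in> valuation_rings k F" and xV: "x \<in> V"
  shows "\<exists>a\<in>k. \<exists>b\<in>k. on_curve a b \<and> V = R a b"
proof -
  interpret V: valuation_subring k F V by (rule valuation_subring.intro[OF F V])
  have kV: "c \<in> V" if "c \<in> k" for c using that V.k_V by auto
  have pV: "p \<in> polys V" if "p \<in> polys k" for p using that polys_mono[of k V] V.k_V by blast
  have yeq: "y * y = poly cub x - poly lin x * y" using curve on_curve_iff by simp
  have cV: "poly cub x \<in> V" "poly lin x \<in> V"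
    using poly_in_subrng[OF V.subrng_V pV xV] cub_polys lin_polys by auto
  have yV: "y \<in> V"
  proof (rule ccontr)
    assume yV: "y \<notin> V"
    then have iy: "inverse y \<in> V" using V.V_or[OF y] by auto
    have "y = (y * y) * inverse y" using y_nz by simp
    also have "\<dots> = poly cub x * inverse y - poly lin x" unfolding yeq using y_nz by (simp add: algebra_simps)
    also have "\<dots> \<in> V" using cV iy by (intro V.V_closed(5,6))
    finally show False using yV by simp
  qed
  have evV: "ev f x y \<in> V" if "f \<in> pp" for f
    using that poly_in_subrng[OF V.subrng_V pV xV] yV V.V_closed(4,5) by (auto simp: ev_def pp_def)
  \<comment> \<open>Since \<open>V\<close> is not all of \<open>F\<close>, some nonzero element of
    the coordinate ring is a nonunit. Its norm is the polynomial in \<open>x\<close> to which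
    \<open>nonunit_root\<close> is applied.\<close>
  obtain z where z: "z \<in> F" "z \<notin> V" using V.V_F by auto
  then have iz: "inverse z \<in> nonunits V" "inverse z \<noteq> 0" using V.inverse_nonunit V.V_closed(1) by auto
  obtain f g where fg: "f \<in> pp" "g \<in> pp" "g \<noteq> (0, 0)" "inverse z = ev f x y / ev g x y"
    by (rule F_fractions[OF F_closed(7)[OF z(1)]])
  have "ev f x y = ev g x y * inverse z" using fg ev_eq_0_iff by simp
  then have fn: "ev f x y \<in> nonunits V" using V.nonunits_mult[OF iz(1) evV[OF fg(2)]] by simp
  have f0: "f \<noteq> (0, 0)" using iz(2) fg(4) by (auto simp: ev_def)
  have "poly (pnorm f) x \<in> nonunits V"
    using V.nonunits_mult[OF fn evV[OF pp_closed(3)[OF fg(1)]]] ev_pconj[OF curve, of f] by (simp add: mult.commute)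
  then obtain a where a: "a \<in> k" "x - a \<in> nonunits V"
    using nonunit_root[OF V pnorm_polys[OF fg(1)] _ xV] pnorm_nz_degree[OF f0] by blast
  \<comment> \<open>The curve equation at \<open>x = a\<close> as a quadratic polynomial in
    \<open>y\<close>.\<close>
  define p where "p = [:- poly cub a, poly lin a, 1:]"
  have p: "p \<in> polys k" "p \<noteq> 0"
    using poly_in_subrng[OF kr cub_polys a(1)] poly_in_subrng[OF kr lin_polys a(1)] k_closed(1-3)
    by (auto simp: p_def polys_pCons_iff[OF kr] polys_0[OF kr])
  have pv: "poly p v = 0 \<longleftrightarrow> on_curve a v" for v
    unfolding on_curve_iff p_def by (auto simp: algebra_simps)
  have diff: "poly r x - poly r a \<in> nonunits V" if "r \<in> polys k" for r
  proof -
    have "poly (synthetic_div r a) x \<in> V"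
      using poly_in_subrng[OF V.subrng_V pV xV] synthetic_div_polys[OF kr a(1) that] by auto
    then show ?thesis using V.nonunits_mult[OF a(2), of "poly (synthetic_div r a) x"] poly_synthetic_div[of r x a]
      by (simp add: mult.commute)
  qed
  have "poly p y = (poly cub x - poly cub a) - y * (poly lin x - poly lin a)"
    using yeq by (simp add: p_def algebra_simps)
  also have "\<dots> \<in> nonunits V"
    by (intro V.nonunits_diff V.nonunits_mult diff cub_polys lin_polys yV)
  finally obtain b where b: "b \<in> k" "poly p b = 0" "y - b \<in> nonunits V"
    using nonunit_root[OF V p yV] by blast
  have xa: "x - a \<in> nonunits V" and ak: "a \<in> k" and yb: "y - b \<in> nonunits V" and bk: "b \<in> k"
    and pb: "poly p b = 0" using a b by auto
  interpret weierstrass_point k F x y a1 a2 a3 a4 a6 a b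
    using weierstrass_pointI a b pv by auto
  show ?thesis using local_ring_unique[OF V xa yb] ak bk pb pv by auto
qed

lemma valuation_ring_cases:
  assumes "V \<in> valuation_rings k F"
  obtains "V = Vinf" | a b where "a \<in> k" "b \<in> k" "on_curve a b" "V = R a b"
  using assms Vinf_unique affine_place by blast

lemma valuation_ring_discrete: "V \<in> valuation_rings k F \<Longrightarrow> \<exists>t. uniformizer F V t"
  by (erule valuation_ring_cases)
    (use Vinf_uniformizer weierstrass_point.local_ring_uniformizer[OF weierstrass_pointI] in blast)+

lemma infinite_place_closed: "infinite_place k F x y = nonunits Vinf"
  using infinite_place_eq valuation_ring_discrete by blast

lemma Vinf_rational: "\<forall>z\<in>Vinf. \<exists>c\<in>k. z - c \<in> nonunits Vinf"
proof
  interpret V: discrete_valuation_subring k F Vinf "x / y"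
    by (rule discrete_valuation_subringI[OF F Vinf_valuation_ring Vinf_uniformizer])
  fix z assume z: "z \<in> Vinf"
  show "\<exists>c\<in>k. z - c \<in> nonunits Vinf"
  proof (cases "z \<in> nonunits Vinf")
    case True
    then show ?thesis using k_closed(1) by (intro bexI[of _ 0]) auto
  next
    case False
    have z0: "z \<noteq> 0" "z \<in> F" using False z V.nonunits_0 V.V_in_F by auto
    obtain f g where fg: "f \<in> pp" "g \<in> pp" "g \<noteq> (0, 0)" "z = ev f x y / ev g x y" by (rule F_fractions[OF z0(2)])
    have f0: "f \<noteq> (0, 0)" using z0 fg by (auto simp: ev_def)
    have "V.v z = 0" using V.unit_iff_v[of z] z0 False z by auto
    then have w: "weight f = weight g" using Vinf_valuation[of z] z0 vinf_eq[OF fg(1,2) f0 fg(3)] fg(4) by simp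
    \<comment> \<open>The coefficient of the dominant term at infinity; the parity of the weight
      tells which component contains it. The residue of \<open>z\<close> is the quotient of the two
      dominant coefficients.\<close>
    define top where "top h = (if even (weight h) then lead_coeff (fst h) else lead_coeff (snd h))" for h :: "'a poly \<times> 'a poly"
    have top_k: "top h \<in> k" if "h \<in> pp" for h using that by (auto simp: top_def pp_def polys_def)
    have top_nz: "top h \<noteq> 0" if "h \<noteq> (0, 0)" for h
      using that by (cases h) (auto simp: top_def weight_def max_def split: if_splits)
    define c where "c = top f / top g"
    have c: "c \<in> k" using k_closed(8) top_k fg by (simp add: c_def)
    define h where "h = padd f (pmul (pconst (- c)) g)"
    have h: "h \<in> pp" unfolding h_def using fg c k_closed(3) pp_closed by auto
    have ctop: "c * top g = top f" using top_nz[OF fg(3)] by (simp add: c_def)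
    have hfs: "fst h = fst f - smult c (fst g)" "snd h = snd f - smult c (snd g)"
      by (auto simp: h_def padd_def pmul_def pconst_def)
    have zc: "z - c = ev h x y / ev g x y"
      using fg(3,4) ev_eq_0_iff[OF fg(2)] by (simp add: h_def ev_padd ev_pmul[OF curve] field_simps)
    show ?thesis
    proof (cases "h = (0, 0)")
      case True
      then have "z - c = 0" using zc by (simp add: ev_def)
      then show ?thesis using c V.nonunits_0 by (intro bexI[of _ c]) auto
    next
      case False
      have "weight h < weight g"
      proof -
        define n where "n = weight g"
        have le: "2 * Polynomial.degree (fst f) \<le> n" "2 * Polynomial.degree (fst g) \<le> n"
          "snd f \<noteq> 0 \<Longrightarrow> 2 * Polynomial.degree (snd f) + 3 \<le> n" "snd g \<noteq> 0 \<Longrightarrow> 2 * Polynomial.degree (snd g) + 3 \<le> n"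
          using w by (auto simp: n_def weight_def split: if_splits)
        have fstc: "Polynomial.coeff (fst h) i = 0" if "n \<le> 2 * i" for i
        proof (cases "n = 2 * i")
          case True
          then have "even (weight f)" "even (weight g)" using w by (auto simp: n_def)
          moreover have "Polynomial.degree (fst f) = i" "Polynomial.degree (fst g) = i"
            using True w unfolding n_def weight_def max_def by (auto split: if_splits) presburger+
          ultimately show ?thesis using ctop by (simp add: hfs top_def)
        next
          case False
          then show ?thesis using that le by (simp add: hfs coeff_eq_0)
        qed
        have sndc: "Polynomial.coeff (snd h) i = 0" if "n \<le> 2 * i + 3" for i
        proof (cases "n = 2 * i + 3")
          case True
          then have "odd (weight f)" "odd (weight g)" using w by (auto simp: n_def)
          moreover have "Polynomial.degree (snd f) = i" "Polynomial.degree (snd g) = i"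
            using True w unfolding n_def weight_def max_def by (auto split: if_splits) presburger+
          ultimately show ?thesis using ctop by (simp add: hfs top_def)
        next
          case False
          have "Polynomial.coeff (snd f) i = 0" using that False le(3) by (cases "snd f = 0") (auto intro: coeff_eq_0)
          moreover have "Polynomial.coeff (snd g) i = 0" using that False le(4) by (cases "snd g = 0") (auto intro: coeff_eq_0)
          ultimately show ?thesis by (simp add: hfs)
        qed
        have "fst h \<noteq> 0 \<Longrightarrow> 2 * Polynomial.degree (fst h) < n"
          using fstc[of "Polynomial.degree (fst h)"] by (metis leading_coeff_0_iff not_le)
        moreover have "snd h \<noteq> 0 \<Longrightarrow> 2 * Polynomial.degree (snd h) + 3 < n"
          using sndc[of "Polynomial.degree (snd h)"] by (metis leading_coeff_0_iff not_le)
        ultimately have "weight h < n" using False unfolding weight_def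
          by (cases h; cases "fst h = 0") (auto simp: max_def)
        then show ?thesis by (simp add: n_def)
      qed
      then have "vinf (z - c) > 0" unfolding zc using vinf_eq[OF h fg(2) False fg(3)] by simp
      moreover have "z - c \<in> F - {0}"
      proof -
        have "z - c \<in> F" using F_closed(6)[OF z0(2)] c kF by auto
        moreover have "z - c \<noteq> 0" unfolding zc using False ev_eq_0_iff[OF h] ev_eq_0_iff[OF fg(2)] fg(3) by simp
        ultimately show ?thesis by simp
      qed
      ultimately show ?thesis using V.nonunit_iff_v[of "z - c"] Vinf_valuation[of "z - c"] c by auto
    qed
  qed
qed

lemma all_places_rational: "rational_places k F = places k F"
proof -
  have "place_degree_is k F (nonunits V) 1" if V: "V \<in> valuation_rings k F" for V
  proof -
    interpret V: valuation_subring k F V by (rule valuation_subring.intro[OF F V])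
    show ?thesis unfolding V.place_degree_one_iff[OF k]
      using V
      by (rule valuation_ring_cases)
        (use Vinf_rational weierstrass_point.local_ring_rational[OF weierstrass_pointI] in blast)+
  qed
  then show ?thesis by (auto simp: rational_places_def places_iff[OF F])
qed

text \<open>
  Reducing a denominator to \<open>x - a\<close>, suppose that \<open>(c + e y) / (x - a)\<close> is regular. Then \<open>c + e y\<close>
  vanishes at both points over \<open>a\<close>, so they coincide; but there \<open>x - a\<close> has valuation \<open>2\<close> and
  \<open>c + e y\<close> only \<open>1\<close>.
\<close>

lemma regular_imp_coord_ring:
  assumes f: "f \<in> F" and reg: "\<And>a b. a \<in> k \<Longrightarrow> b \<in> k \<Longrightarrow> on_curve a b \<Longrightarrow> f \<in> R a b"
  shows "\<exists>h\<in>pp. f = ev h x y"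
proof -
  obtain g0 g1 where g01: "g0 \<in> pp" "g1 \<in> pp" "g1 \<noteq> (0, 0)" "f = ev g0 x y / ev g1 x y" by (rule F_fractions[OF f])
  have "ev g1 x y \<noteq> 0" "ev (pconj g1) x y \<noteq> 0"
    using ev_eq_0_iff g01(2,3) pp_closed(3)[OF g01(2)] by (auto simp: pconj_def prod_eq_iff)
  \<comment> \<open>Extending the fraction by the conjugate of the denominator makes the denominator
    a polynomial in \<open>x\<close>; the induction then removes its roots one at a time.\<close>
  then have "f = ev (pmul g0 (pconj g1)) x y / poly (pnorm g1) x"
    using g01(4) ev_pconj[OF curve, of g1, symmetric] by (simp add: ev_pmul[OF curve])
  moreover have "\<exists>h\<in>pp. f = ev h x y" if "g \<in> pp" "d \<in> polys k" "d \<noteq> 0" "f = ev g x y / poly d x" for g d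
    using that
  proof (induction "Polynomial.degree d" arbitrary: g d rule: less_induct)
    case less
    obtain p q where pq: "g = (p, q)" "p \<in> polys k" "q \<in> polys k" using less.prems by (auto simp: pp_def)
    show ?case
    proof (cases "Polynomial.degree d = 0")
      case True
      then obtain c where c: "d = [:c:]" by (metis degree_eq_zeroE)
      then have "c \<in> k" "c \<noteq> 0" using less.prems polys_pCons_iff[OF kr] by auto
      then show ?thesis using less.prems(1,4) pp_closed(1)[OF pp_closed(4)] k_closed(7)
        by (intro bexI[of _ "pmul (pconst (inverse c)) g"]) (auto simp: c ev_pmul[OF curve] divide_inverse)
    next
      case False
      then obtain a where a: "a \<in> k" "poly d a = 0" using root less.prems by blast
      define d1 p1 q1 where "d1 = synthetic_div d a" and "p1 = synthetic_div p a" and "q1 = synthetic_div q a"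
      have closed: "d1 \<in> polys k" "p1 \<in> polys k" "q1 \<in> polys k"
        using synthetic_div_polys[OF kr a(1)] less.prems(2) pq by (auto simp: d1_def p1_def q1_def)
      have d1: "d = [:- a, 1:] * d1" unfolding d1_def by (rule poly_factor_root[OF a(2)])
      have dx: "poly d x = (x - a) * poly d1 x" by (simp add: d1 algebra_simps)
      have d1_nz: "d1 \<noteq> 0" using d1 less.prems(3) by auto
      have d1x: "poly d1 x \<noteq> 0" using transc[OF closed(1)] d1_nz by auto
      have xa: "x - a \<noteq> 0"
        using transc[of "[:- a, 1:]"] a(1) k_closed(1-3) by (auto simp: polys_pCons_iff[OF kr] polys_0[OF kr])
      define c e where "c = poly p a" and "e = poly q a"
      have ce: "c \<in> k" "e \<in> k" using poly_in_subrng[OF kr _ a(1)] pq by (auto simp: c_def e_def)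
      have gx: "ev g x y = (x - a) * ev (p1, q1) x y + (c + e * y)"
        unfolding ev_def pq fst_conv snd_conv poly_synthetic_div[of p x a] poly_synthetic_div[of q x a] p1_def q1_def c_def e_def
        by (simp add: algebra_simps)
      show ?thesis
      proof (cases "c = 0 \<and> e = 0")
        case True
        then have "f = ev (p1, q1) x y / poly d1 x"
          using less.prems(4) gx dx xa by simp
        then show ?thesis using less.hyps[of d1 "(p1, q1)"] closed d1_nz degree_synthetic_div_less[of d a] False
          by (auto simp: pp_def d1_def)
      next
        case nz: False
        define u where "u = f * poly d1 x - ev (p1, q1) x y"
        have u: "c + e * y = (x - a) * u"
          using less.prems(4) gx dx xa d1x by (simp add: u_def field_simps)
        \<comment> \<open>At a point over \<open>a\<close> the function \<open>u\<close> is regular,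
          so \<open>c + e * y\<close> vanishes there. As \<open>c\<close> and \<open>e\<close> are
          not both zero, the second coordinate is determined.\<close>
        have point: "e \<noteq> 0 \<and> b = - c / e \<and> u \<in> R a b" if b: "b \<in> k" "on_curve a b" for b
        proof -
          interpret P: weierstrass_point k F x y a1 a2 a3 a4 a6 a b by (rule weierstrass_pointI[OF a(1) b])
          have "poly d1 x \<in> R a b" "ev (p1, q1) x y \<in> R a b"
            using P.residue_is_ev[OF pp_closed(7)[OF closed(1)]] P.residue_is_ev[of "(p1, q1)"] closed
            by (auto simp: P.local_ring_def pp_def)
          then have uR: "u \<in> R a b"
            unfolding u_def using reg[OF a(1) b] by (intro P.loc.V_closed(5,6))

          have "P.residue_is (c + e * y) (c + e * b)"
            by (intro P.residue_is_add P.residue_is_mult P.residue_is_const P.residue_is_y ce)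
          moreover have "c + e * y \<in> nonunits (R a b)"
            unfolding u using P.loc.nonunits_mult[OF _ uR, of "x - a"] P.residue_nonunit_iff[OF P.residue_xa]
            by (simp add: mult.commute)
          ultimately have "c + e * b = 0" using P.residue_nonunit_iff by blast
          then have be: "b * e = - c" by (simp add: add_eq_0_iff mult.commute)
          then have "e \<noteq> 0" using nz by auto
          moreover from this have "b = - c / e" unfolding be[symmetric] by simp
          ultimately show ?thesis using uR by simp
        qed
        define m where "m = [:- poly cub a, poly lin a, 1:]"
        have m: "m \<in> polys k" "Polynomial.degree m > 0"
          using poly_in_subrng[OF kr cub_polys a(1)] poly_in_subrng[OF kr lin_polys a(1)] k_closed(1-3)
          by (auto simp: m_def polys_pCons_iff[OF kr] polys_0[OF kr])
        obtain b where "b \<in> k" "poly m b = 0" using root[OF m] by blast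
        then have b: "b \<in> k" "on_curve a b" unfolding on_curve_iff by (auto simp: m_def algebra_simps)
        \<comment> \<open>The roots of the quadratic \<open>m\<close> have sum
          \<open>- poly lin a\<close>, so this is the other one.\<close>
        define b' where "b' = - b - poly lin a"
        have b': "b' \<in> k" "on_curve a b'"
          using b poly_in_subrng[OF kr lin_polys a(1)] k_closed(3,6) unfolding on_curve_iff
          by (auto simp: b'_def algebra_simps)
        interpret P: weierstrass_point k F x y a1 a2 a3 a4 a6 a b by (rule weierstrass_pointI[OF a(1) b])
        \<comment> \<open>Equality of the two roots means \<open>2 * b + poly lin a = 0\<close>, and
          the left side is \<open>dv\<close>.\<close>
        have "b' = b" using point[OF b] point[OF b'] by simp
        then have "P.dv = 0 \<longleftrightarrow> True" by (simp add: b'_def P.dv_def lin_def algebra_simps)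
        then have dv: "P.dv = 0" by simp
        have e: "e \<noteq> 0" "c = - (e * b)" and uR: "u \<in> R a b" using point[OF b] by auto
        have uF: "u \<noteq> 0" "u \<in> F"
          using u e P.yb_nz P.loc.V_in_F[OF uR] by (auto simp: algebra_simps)
        \<comment> \<open>Here \<open>c + e * y\<close> is \<open>e * (y - b)\<close>; a regular
          quotient by \<open>x - a\<close> would require that 1, the order of \<open>y - b\<close>,
          is at least 2, the order of \<open>x - a\<close>.\<close>
        have "y - b = (x - a) * (u * inverse e)" using u e by (simp add: field_simps)
        moreover have xaF: "x - a \<in> F - {0}" using xa F_closed(6)[OF x] a(1) kF by auto
        moreover have ueF: "u * inverse e \<in> F - {0}" using uF e(1) ce(2) kF F_closed(5)[of u "inverse e"] F_closed(7)[of e] by auto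
        ultimately have "P.loc.v (y - b) = P.loc.v (x - a) + P.loc.v (u * inverse e)" using P.loc.v_mult by simp
        moreover have "u * inverse e \<in> R a b"
          using uR P.loc.V_closed(5) P.loc.k_V k_closed(7)[OF ce(2)] by blast
        ultimately have "P.loc.v (y - b) \<ge> P.loc.v (x - a)" using P.loc.in_V_iff_v[OF ueF] by simp
        then show ?thesis using P.v_xa P.v_yb_ramified dv by simp
      qed
    qed
  qed
  ultimately show ?thesis
    using pp_closed(1)[OF g01(1) pp_closed(3)[OF g01(2)]] pnorm_polys[OF g01(2)] pnorm_nz_degree[OF g01(3)] by blast
qed

lemma places_eq: "places k F = insert (nonunits Vinf) {nonunits (R a b) | a b. a \<in> k \<and> b \<in> k \<and> on_curve a b}"
proof -
  have "nonunits (R a b) \<in> places k F" if "a \<in> k" "b \<in> k" "on_curve a b" for a b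
    using weierstrass_point.local_ring_valuation_ring[OF weierstrass_pointI[OF that]] places_iff[OF F] by blast
  moreover have "nonunits Vinf \<in> places k F" using Vinf_valuation_ring places_iff[OF F] by blast
  moreover have "P = nonunits Vinf \<or> (\<exists>a b. a \<in> k \<and> b \<in> k \<and> on_curve a b \<and> P = nonunits (R a b))" if "P \<in> places k F" for P
    using that valuation_ring_cases unfolding places_iff[OF F] by metis
  ultimately show ?thesis by blast
qed

lemma regular_at_affine_places:
  assumes f: "f \<in> F - {0}" and "\<And>P. P \<in> places k F \<Longrightarrow> P \<noteq> nonunits Vinf \<Longrightarrow> valuation F P f \<ge> 0"
  shows "\<exists>h\<in>pp. f = ev h x y"
proof (rule regular_imp_coord_ring)
  fix a b assume ab: "a \<in> k" "b \<in> k" "on_curve a b"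
  interpret P: weierstrass_point k F x y a1 a2 a3 a4 a6 a b by (rule weierstrass_pointI[OF ab])
  have "R a b \<noteq> Vinf"
    using P.residue_is_x x_notin_Vinf by (auto simp: P.local_ring_def)
  moreover have "ring_of_place F (nonunits Vinf) = Vinf"
    using valuation_subring.ring_of_place_nonunits[OF valuation_subring.intro[OF F Vinf_valuation_ring]] .
  ultimately have "nonunits (R a b) \<noteq> nonunits Vinf" using P.loc.ring_of_place_nonunits by metis
  then have "P.loc.v f \<ge> 0" using assms(2) P.loc.nonunits_in_places by auto
  then show "f \<in> R a b" using P.loc.in_V_iff_v[OF f] by simp
qed (use f in auto)

text \<open>Regularity at the affine places puts \<open>f\<close> into the coordinate ring, and
  order 0 at infinity means weight 0, which only constants have.\<close>

lemma valuation_0_imp_const: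
  assumes f: "f \<in> F - {0}" and "\<And>P. P \<in> places k F \<Longrightarrow> valuation F P f = 0"
  shows "f \<in> k"
proof -
  have "\<exists>h\<in>pp. f = ev h x y"
    by (rule regular_at_affine_places[OF f]) (simp add: assms(2))
  then obtain h where h: "h \<in> pp" "f = ev h x y" by blast
  have h0: "h \<noteq> (0, 0)" using f h by (auto simp: ev_def)
  have "vinf f = 0" using assms(2)[of "nonunits Vinf"] Vinf_valuation[OF f] places_eq by simp
  then have "weight h = 0" using vinf_ev[OF h(1) h0] h(2) by simp
  then have "snd h = 0" "Polynomial.degree (fst h) = 0" by (auto simp: weight_def split: if_splits)
  then obtain c where "fst h = [:c:]" "snd h = 0" by (metis degree_eq_zeroE)
  then show ?thesis using h polys_pCons_iff[OF kr] by (auto simp: ev_def pp_def)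
qed

text \<open>
  If \<open>f\<close> has its only pole at \<open>(a, b)\<close>, then \<open>f (x - a)\<close> has order at most \<open>2\<close> at infinity and no
  other poles, hence is linear in \<open>x\<close>. So \<open>f\<close> also has a pole at the conjugate point over \<open>a\<close>.
\<close>

lemma no_simple_pole:
  assumes RS: "P \<in> places k F" "S \<in> places k F" "P \<noteq> S" and f: "f \<in> F - {0}"
    and v: "\<And>Q. Q \<in> places k F \<Longrightarrow> valuation F Q f = (if Q = P then 1 else 0) - (if Q = S then 1 else 0)"
  shows False
proof -
  from RS(2) consider "S = nonunits Vinf" | a b where "a \<in> k" "b \<in> k" "on_curve a b" "S = nonunits (R a b)"
    unfolding places_eq by blast
  then show False
  proof cases
    case 1
    have "\<exists>h\<in>pp. f = ev h x y"
    proof (rule regular_at_affine_places[OF f])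
      show "valuation F Q f \<ge> 0" if "Q \<in> places k F" "Q \<noteq> nonunits Vinf" for Q
        using v[OF that(1)] that(2) 1 by simp
    qed
    then obtain h where h: "h \<in> pp" "f = ev h x y" by blast
    have h0: "h \<noteq> (0, 0)" using f h by (auto simp: ev_def)
    have "vinf f = - 1" using v[OF RS(2)] RS(3) Vinf_valuation[OF f] 1 by simp
    then have "weight h = 1" using vinf_ev[OF h(1) h0] h(2) by simp
    \<comment> \<open>A weight is even or at least 3, so it is never 1. This gap at 1 is where
      positive genus shows.\<close>
    then show False unfolding weight_def max_def by (auto split: if_splits)
  next
    case (2 a b)
    interpret S: weierstrass_point k F x y a1 a2 a3 a4 a6 a b by (rule weierstrass_pointI[OF 2(1-3)])
    have xa: "x - a \<in> F - {0}" using S.xa_nz F_closed(6)[OF x] 2(1) kF by auto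
    have vS: "S.loc.v f = - 1" using v[OF RS(2)] RS(3) 2(4) by simp
    have Sinf: "nonunits Vinf \<noteq> S"
    proof
      assume "nonunits Vinf = S"
      then have "x - a \<in> nonunits Vinf" using 2(4) S.residue_nonunit_iff[OF S.residue_xa] by simp
      moreover have "a \<in> Vinf" using Vinf_valuation_ring 2(1) by (auto simp: valuation_rings_def)
      ultimately have "(x - a) + a \<in> Vinf"
        using valuation_subring.V_closed(4)[OF valuation_subring.intro[OF F Vinf_valuation_ring], of "x - a" a]
          nonunits_subset[of Vinf] by blast
      then show False using x_notin_Vinf by simp
    qed
    define g where "g = f * (x - a)"
    have gF: "g \<in> F - {0}" using f xa F_closed(5) by (auto simp: g_def)
    have "\<exists>h\<in>pp. g = ev h x y"
    proof (rule regular_at_affine_places[OF gF])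
      fix Q assume Q: "Q \<in> places k F" "Q \<noteq> nonunits Vinf"
      then obtain a' b' where Q': "a' \<in> k" "b' \<in> k" "on_curve a' b'" "Q = nonunits (R a' b')" unfolding places_eq by blast
      interpret Q: weierstrass_point k F x y a1 a2 a3 a4 a6 a' b' by (rule weierstrass_pointI[OF Q'(1-3)])
      have "Q.residue_is (x - a) (a' - a)" by (intro Q.residue_is_diff Q.residue_is_x Q.residue_is_const 2(1))
      then have "x - a \<in> R a' b'" by (auto simp: Q.local_ring_def)
      then have "Q.loc.v (x - a) \<ge> 0" using Q.loc.in_V_iff_v[OF xa] by simp
      moreover have "Q.loc.v (x - a) > 0" if "Q = S"
        using that Q'(4) 2(4) Q.loc.nonunit_iff_v[OF xa] S.residue_nonunit_iff[OF S.residue_xa] by auto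
      moreover have "Q.loc.v f \<ge> (if Q = S then - 1 else 0)" using v[OF Q(1)] Q'(4) by auto
      ultimately show "valuation F Q g \<ge> 0" unfolding g_def Q'(4) Q.loc.v_mult[OF f xa] using Q'(4) by (auto split: if_splits)
    qed
    then obtain h where h: "h \<in> pp" "g = ev h x y" by blast
    have h0: "h \<noteq> (0, 0)" using gF h by (auto simp: ev_def)
    interpret I: discrete_valuation_subring k F Vinf "x / y"
      by (rule discrete_valuation_subringI[OF F Vinf_valuation_ring Vinf_uniformizer])
    have "vinf (x - a) = - 2"
    proof -
      have "([:- a, 1:], 0) \<in> pp" using 2(1) k_closed(1-3) by (auto simp: pp_def polys_pCons_iff[OF kr] polys_0[OF kr])
      from vinf_ev[OF this] show ?thesis by (simp add: weight_def)
    qed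
    moreover have "vinf f \<ge> 0" using v[of "nonunits Vinf"] Vinf_valuation[OF f] places_eq Sinf by simp
    moreover have "vinf g = vinf f + vinf (x - a)"
      using I.v_mult[OF f xa] Vinf_valuation f xa gF by (simp add: g_def)
    ultimately have "weight h \<le> 2" using vinf_ev[OF h(1) h0] h(2) by simp
    then have sh: "snd h = 0" "Polynomial.degree (fst h) \<le> 1" by (auto simp: weight_def split: if_splits)
    obtain c r where cr: "fst h = pCons c r" by (cases "fst h")
    have "Polynomial.degree r = 0" using sh(2) by (auto simp: cr split: if_splits)
    then obtain d where cd: "fst h = [:c, d:]" using cr by (metis degree_eq_zeroE)
    have cdk: "c \<in> k" "d \<in> k" using h(1) cd polys_pCons_iff[OF kr] by (auto simp: pp_def)
    \<comment> \<open>The value of the linear polynomial at \<open>a\<close>. Were it zero,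
      \<open>f\<close> would be the constant \<open>d\<close> and have no pole.\<close>
    define c' where "c' = c + d * a"
    have c'k: "c' \<in> k" using cdk 2(1) k_closed by (simp add: c'_def)
    have g_eq: "f * (x - a) = c' + d * (x - a)"
      using h(2) by (simp add: g_def ev_def sh cd c'_def algebra_simps)
    have c'0: "c' \<noteq> 0"
    proof
      assume "c' = 0"
      then have "f = d" using g_eq S.xa_nz by simp
      then have "f \<in> R a b - nonunits (R a b)"
        unfolding S.loc.unit_iff using f cdk k_closed(7) S.loc.k_V by auto
      then show False using S.loc.unit_iff_v[OF f] vS by simp
    qed
    \<comment> \<open>At every point over \<open>a\<close> the function \<open>f * (x - a)\<close>
      has the nonzero residue \<open>c'\<close>, so the orders of its two factors are
      opposite.\<close>
    have val: "valuation F (nonunits (R a b'')) f = - valuation F (nonunits (R a b'')) (x - a)" if b'': "b'' \<in> k" "on_curve a b''" for b''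
    proof -
      interpret Q: weierstrass_point k F x y a1 a2 a3 a4 a6 a b'' by (rule weierstrass_pointI[OF 2(1) b''])
      have "Q.residue_is (c' + d * (x - a)) (c' + d * 0)"
        by (intro Q.residue_is_add Q.residue_is_mult Q.residue_is_const Q.residue_xa c'k cdk)
      then have "f * (x - a) \<in> R a b'' - nonunits (R a b'')"
        using Q.residue_nonunit_iff[of "f * (x - a)"] c'0 g_eq by (auto simp: Q.local_ring_def)
      then have "Q.loc.v (f * (x - a)) = 0" by (rule Q.loc.v_unit)
      then show ?thesis using Q.loc.v_mult[OF f xa] by simp
    qed
    \<comment> \<open>The pole at \<open>S\<close> is simple, so \<open>x - a\<close> has order 1
      there. Thus \<open>dv\<close> is nonzero, and the conjugate point is a different
      point.\<close>
    have "S.loc.v (x - a) = 1" using val[OF 2(2,3)] vS by simp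
    then have dv: "S.dv \<noteq> 0" using S.v_xa by (auto split: if_splits)
    define b' where "b' = - b - poly lin a"
    have b': "b' \<in> k" "on_curve a b'"
      using 2(2,3) poly_in_subrng[OF kr lin_polys 2(1)] k_closed(3,6) unfolding on_curve_iff
      by (auto simp: b'_def algebra_simps)
    have "b - b' = S.dv" by (simp add: b'_def S.dv_def lin_def algebra_simps)
    then have bb: "b \<noteq> b'" using dv by auto
    interpret S': weierstrass_point k F x y a1 a2 a3 a4 a6 a b' by (rule weierstrass_pointI[OF 2(1) b'])
    have "nonunits (R a b') \<noteq> S"
    proof
      assume e: "nonunits (R a b') = S"
      have "S'.residue_is (y - b) (b' - b)" by (intro S'.residue_is_diff S'.residue_is_y S'.residue_is_const 2(2))
      then have "y - b \<notin> nonunits (R a b')" using S'.residue_nonunit_iff bb by auto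
      then show False using e 2(4) S.residue_nonunit_iff[OF S.residue_yb] by simp
    qed
    then have "S'.loc.v f \<ge> 0" using v[OF S'.loc.nonunits_in_places] by auto
    then show False using val[OF b'] S'.v_xa by (auto split: if_splits)
  qed
qed

end

section \<open>Automorphisms of function fields\<close>

locale field_automorphism =
  fixes k F :: "'a::field set" and \<sigma> :: "'a \<Rightarrow> 'a"
  assumes F: "subfld F" and \<sigma>: "\<sigma> \<in> field_auts k F"
begin

lemmas F_closed = subrngD[OF subfld_subrng[OF F]] subfldD[OF F] subfld_powi[OF F]

lemma add: "z \<in> F \<Longrightarrow> w \<in> F \<Longrightarrow> \<sigma> (z + w) = \<sigma> z + \<sigma> w"
  and mult: "z \<in> F \<Longrightarrow> w \<in> F \<Longrightarrow> \<sigma> (z * w) = \<sigma> z * \<sigma> w"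
  and one: "\<sigma> 1 = 1"
  and const: "c \<in> k \<Longrightarrow> \<sigma> c = c"
  and bij: "bij_betw \<sigma> F F"
  and ext: "\<sigma> \<in> extensional F"
  using \<sigma> by (auto simp: field_auts_def ring_iso_def ring_hom_def)

lemma in_F: "z \<in> F \<Longrightarrow> \<sigma> z \<in> F"
  using bij by (auto simp: bij_betw_def)

lemma inj: "inj_on \<sigma> F" and image_F: "\<sigma> ` F = F"
  using bij by (auto simp: bij_betw_def)

lemma zero: "\<sigma> 0 = 0"
proof -
  have "\<sigma> 0 + 0 = \<sigma> 0 + \<sigma> 0" using add[OF F_closed(1) F_closed(1)] by (simp only: add_0_right)
  then show ?thesis by (simp only: add_left_cancel)
qed

lemma uminus: "z \<in> F \<Longrightarrow> \<sigma> (- z) = - \<sigma> z"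
  using add[of z "- z"] F_closed(3)[of z] zero by (simp add: eq_neg_iff_add_eq_0 add.commute)

lemma diff: "z \<in> F \<Longrightarrow> w \<in> F \<Longrightarrow> \<sigma> (z - w) = \<sigma> z - \<sigma> w"
  using add[of z "- w"] uminus[of w] F_closed(3)[of w] by simp

lemma eq_0_iff: "z \<in> F \<Longrightarrow> \<sigma> z = 0 \<longleftrightarrow> z = 0"
  using inj zero F_closed(1) by (metis inj_onD)

lemma inverse: "z \<in> F \<Longrightarrow> \<sigma> (inverse z) = inverse (\<sigma> z)"
proof (cases "z = 0")
  case False
  assume "z \<in> F"
  then have "\<sigma> z * \<sigma> (inverse z) = 1" using mult[of z "inverse z"] F_closed(7)[of z] one False by simp
  then show ?thesis by (metis inverse_unique)
qed (simp add: zero)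

lemma power: "z \<in> F \<Longrightarrow> \<sigma> (z ^ n) = \<sigma> z ^ n"
  by (induction n) (auto simp: one mult subrng_power[OF subfld_subrng[OF F]])

lemma powi: "z \<in> F \<Longrightarrow> \<sigma> (z powi n) = \<sigma> z powi n"
  using power[of z "nat n"] power[of "inverse z" "nat (- n)"] F_closed(7)[of z] inverse[of z]
  by (simp add: power_int_def)

lemma poly: "p \<in> polys k \<Longrightarrow> k \<subseteq> F \<Longrightarrow> z \<in> F \<Longrightarrow> \<sigma> (poly p z) = poly p (\<sigma> z)"
proof (induction p)
  case (pCons c p)
  have c: "c \<in> k" "p \<in> polys k" using pCons.prems(1) by (auto simp: polys_def coeff_pCons split: nat.splits dest: spec[of _ "Suc _"] spec[of _ 0])
  have "p \<in> polys F" using c(2) polys_mono[OF pCons.prems(2)] by auto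
  then have "poly p z \<in> F" using poly_in_subrng[OF subfld_subrng[OF F] _ pCons.prems(3)] by blast
  then show ?case using pCons c add[of c "z * poly p z"] mult[of z "poly p z"] F_closed(5) const by auto
qed (simp add: zero)

context
  fixes V
  assumes kF: "k \<subseteq> F" and V: "V \<in> valuation_rings k F"
begin

interpretation V: valuation_subring k F V by (rule valuation_subring.intro[OF F V])

lemma image_iff: "z \<in> F \<Longrightarrow> \<sigma> z \<in> \<sigma> ` V \<longleftrightarrow> z \<in> V"
  using inj_on_image_mem_iff[OF inj, of z V] V.V_F by auto

lemma image_valuation_ring: "\<sigma> ` V \<in> valuation_rings k F"
  unfolding valuation_rings_def
proof (intro CollectI conjI ballI)
  show "subrng (\<sigma> ` V)"
  proof (rule subrngI)
    show "1 \<in> \<sigma> ` V" using one V.V_closed(2) by (metis imageI)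
    fix a b assume "a \<in> \<sigma> ` V" "b \<in> \<sigma> ` V"
    then obtain z w where zw: "z \<in> V" "a = \<sigma> z" "w \<in> V" "b = \<sigma> w" by auto
    have "a - b = \<sigma> (z - w)" "a * b = \<sigma> (z * w)" using zw V.V_in_F diff mult by auto
    then show "a - b \<in> \<sigma> ` V" "a * b \<in> \<sigma> ` V" using zw V.V_closed by auto
  qed
  have "c \<in> k \<longleftrightarrow> \<sigma> c \<in> k" if "c \<in> F" for c
    using const that inj kF by (metis inj_onD subsetD)
  moreover have "k \<subseteq> \<sigma> ` V"
  proof
    fix c assume "c \<in> k"
    then show "c \<in> \<sigma> ` V" using const[of c] V.k_V by (intro image_eqI[of _ _ c]) auto
  qed
  moreover obtain z where "z \<in> V" "z \<notin> k" using V.k_V by auto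
  ultimately show "k \<subset> \<sigma> ` V" using V.V_in_F by blast
  obtain w where "w \<in> F" "w \<notin> V" using V.V_F by auto
  then have "\<sigma> w \<in> F" "\<sigma> w \<notin> \<sigma> ` V" using image_iff in_F by auto
  moreover have "\<sigma> ` V \<subseteq> F" using V.V_in_F in_F by auto
  ultimately show "\<sigma> ` V \<subset> F" by blast
  fix z assume "z \<in> F"
  then obtain z' where z': "z' \<in> F" "z = \<sigma> z'" using image_F by auto
  then show "z \<in> \<sigma> ` V \<or> inverse z \<in> \<sigma> ` V"
    using V.V_or[OF z'(1)] inverse[OF z'(1)] by (metis imageI)
qed

lemma image_nonunits: "nonunits (\<sigma> ` V) = \<sigma> ` nonunits V"
proof (intro Set.set_eqI iffI)
  fix z assume "z \<in> nonunits (\<sigma> ` V)"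
  then obtain w where w: "w \<in> V" "z = \<sigma> w" "\<sigma> w = 0 \<or> inverse (\<sigma> w) \<notin> \<sigma> ` V" by (auto simp: nonunits_def)
  have wF: "w \<in> F" using V.V_in_F[OF w(1)] .
  then have "w \<in> nonunits V"
    using w eq_0_iff[OF wF] image_iff[OF F_closed(7)[OF wF]] inverse[OF wF] by (auto simp: nonunits_def)
  then show "z \<in> \<sigma> ` nonunits V" using w by auto
next
  fix z assume "z \<in> \<sigma> ` nonunits V"
  then obtain w where w: "w \<in> V" "z = \<sigma> w" "w = 0 \<or> inverse w \<notin> V" by (auto simp: nonunits_def)
  have wF: "w \<in> F" using V.V_in_F[OF w(1)] .
  then show "z \<in> nonunits (\<sigma> ` V)"
    using w zero image_iff[OF F_closed(7)[OF wF]] inverse[OF wF] by (auto simp: nonunits_def)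
qed

text \<open>\<sigma> carries a decomposition with respect to \<open>t\<close> to one with respect to
  \<open>\<sigma> t\<close>, which is a uniformizer of the image ring.\<close>

lemma image_valuation:
  assumes t: "uniformizer F V t" and z: "z \<in> F - {0}"
  shows "valuation F (\<sigma> ` nonunits V) (\<sigma> z) = valuation F (nonunits V) z"
proof -
  interpret V: discrete_valuation_subring k F V t by (rule discrete_valuation_subringI[OF F V t])
  have tF: "t \<in> F" using V.t_nonunit V.nonunits_in_V V.V_in_F by auto
  have units: "\<sigma> ` V - nonunits (\<sigma> ` V) = \<sigma> ` (V - nonunits V)"
    unfolding image_nonunits using inj_on_image_set_diff[OF inj, of V "nonunits V"] V.V_F by (auto simp: nonunits_def)
  have dec: "\<sigma> w = \<sigma> t powi n * \<sigma> u" if "w = t powi n * u" "u \<in> V - nonunits V" for w n u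
    using that mult[of "t powi n" u] powi[OF tF] F_closed(9)[OF tF] V.V_in_F by auto
  have t': "uniformizer F (\<sigma> ` V) (\<sigma> t)"
    unfolding uniformizer_def
  proof (intro conjI ballI)
    show "\<sigma> t \<noteq> 0" using eq_0_iff[OF tF] V.t_nz by simp
    show "\<sigma> t \<in> nonunits (\<sigma> ` V)" unfolding image_nonunits using V.t_nonunit by auto
    fix z assume "z \<in> F - {0}"
    then obtain w where w: "w \<in> F" "z = \<sigma> w" using image_F by auto
    then have "w \<noteq> 0" using \<open>z \<in> F - {0}\<close> zero by auto
    then obtain n u where "u \<in> V - nonunits V" "w = t powi n * u" using V.decompose w by blast
    then show "\<exists>n. \<exists>u\<in>\<sigma> ` V - nonunits (\<sigma> ` V). z = \<sigma> t powi n * u" unfolding units using dec w by blast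
  qed
  interpret V': discrete_valuation_subring k F "\<sigma> ` V" "\<sigma> t"
    by (rule discrete_valuation_subringI[OF F image_valuation_ring t'])
  obtain n u where nu: "u \<in> V - nonunits V" "z = t powi n * u" using V.decompose z by blast
  have "\<sigma> u \<in> \<sigma> ` V - nonunits (\<sigma> ` V)" unfolding units using nu by auto
  from V'.valuation_eqI[OF dec[OF nu(2,1)] this] V.valuation_eqI[OF nu(2,1)] show ?thesis
    by (simp add: image_nonunits)
qed

end

lemma image_place:
  assumes "k \<subseteq> F" "P \<in> places k F"
  shows "\<sigma> ` P \<in> places k F"
proof -
  obtain V where "V \<in> valuation_rings k F" "P = nonunits V" using assms(2) places_iff[OF F] by blast
  then show ?thesis using image_valuation_ring[OF assms(1)] image_nonunits[OF assms(1)] places_iff[OF F] by metis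
qed

end

lemma places_subset: "subfld F \<Longrightarrow> P \<in> places k F \<Longrightarrow> P \<subseteq> F"
  using places_iff[of F P k] by (auto simp: valuation_rings_def nonunits_def)

context
  fixes k F :: "'a::field set"
  assumes F: "subfld F" and kF: "k \<subseteq> F"
begin

lemma field_autsI:
  assumes "\<sigma> \<in> extensional F" "bij_betw \<sigma> F F" "\<And>c. c \<in> k \<Longrightarrow> \<sigma> c = c" "\<sigma> 1 = 1"
    and "\<And>z w. z \<in> F \<Longrightarrow> w \<in> F \<Longrightarrow> \<sigma> (z + w) = \<sigma> z + \<sigma> w" "\<And>z w. z \<in> F \<Longrightarrow> w \<in> F \<Longrightarrow> \<sigma> (z * w) = \<sigma> z * \<sigma> w"
  shows "\<sigma> \<in> field_auts k F"
  using assms by (auto simp: field_auts_def ring_iso_def ring_hom_def bij_betw_def)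

lemma subgroup_field_auts: "subgroup (field_auts k F) (BijGroup F)"
proof (rule group.subgroupI[OF group_BijGroup])
  have Bij: "\<sigma> \<in> Bij F" if "\<sigma> \<in> field_auts k F" for \<sigma>
    using that by (auto simp: field_auts_def ring_iso_def Bij_def)
  then show "field_auts k F \<subseteq> carrier (BijGroup F)" by (auto simp: BijGroup_def)
  note F_closed = subrngD[OF subfld_subrng[OF F]]
  have "(\<lambda>z\<in>F. z) \<in> field_auts k F"
    using kF F_closed by (intro field_autsI) (auto simp: bij_betw_def inj_on_def)
  then show "field_auts k F \<noteq> {}" by auto
  fix \<sigma> assume \<sigma>: "\<sigma> \<in> field_auts k F"
  interpret \<sigma>: field_automorphism k F \<sigma> by (rule field_automorphism.intro[OF F \<sigma>])
  have invF: "inv_into F \<sigma> z \<in> F" "\<sigma> (inv_into F \<sigma> z) = z" if "z \<in> F" for z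
    using that \<sigma>.image_F by (auto intro: inv_into_into f_inv_into_f)
  have inv_eq: "inv_into F \<sigma> z = w" if "w \<in> F" "\<sigma> w = z" for z w
    using that \<sigma>.inj by (auto intro: inv_into_f_eq)
  have "restrict (inv_into F \<sigma>) F \<in> field_auts k F"
  proof (rule field_autsI)
    show "bij_betw (restrict (inv_into F \<sigma>) F) F F"
      using bij_betw_inv_into[OF \<sigma>.bij] by (simp cong: bij_betw_cong)
    show "restrict (inv_into F \<sigma>) F c = c" if "c \<in> k" for c
      using that kF \<sigma>.const inv_eq by auto
    show "restrict (inv_into F \<sigma>) F 1 = 1" using F_closed(2) inv_eq \<sigma>.one by simp
    fix z w assume zw: "z \<in> F" "w \<in> F"
    have "inv_into F \<sigma> (z + w) = inv_into F \<sigma> z + inv_into F \<sigma> w"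
      using zw invF \<sigma>.add F_closed(4) by (intro inv_eq) auto
    moreover have "inv_into F \<sigma> (z * w) = inv_into F \<sigma> z * inv_into F \<sigma> w"
      using zw invF \<sigma>.mult F_closed(5) by (intro inv_eq) auto
    ultimately show "restrict (inv_into F \<sigma>) F (z + w) = restrict (inv_into F \<sigma>) F z + restrict (inv_into F \<sigma>) F w"
      "restrict (inv_into F \<sigma>) F (z * w) = restrict (inv_into F \<sigma>) F z * restrict (inv_into F \<sigma>) F w"
      using zw F_closed(4,5) by auto
  qed auto
  then show "inv\<^bsub>BijGroup F\<^esub> \<sigma> \<in> field_auts k F" using inv_BijGroup[OF Bij[OF \<sigma>]] by simp
  fix \<tau> assume \<tau>: "\<tau> \<in> field_auts k F"
  interpret \<tau>: field_automorphism k F \<tau> by (rule field_automorphism.intro[OF F \<tau>])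
  have "compose F \<sigma> \<tau> \<in> field_auts k F"
  proof (rule field_autsI)
    show "bij_betw (compose F \<sigma> \<tau>) F F" by (rule bij_betw_compose[OF \<tau>.bij \<sigma>.bij])
  qed (use \<sigma>.add \<sigma>.mult \<sigma>.one \<sigma>.const \<tau>.add \<tau>.mult \<tau>.one \<tau>.const \<tau>.in_F F_closed kF in \<open>auto simp: compose_def\<close>)
  then show "\<sigma> \<otimes>\<^bsub>BijGroup F\<^esub> \<tau> \<in> field_auts k F" using Bij \<sigma> \<tau> by (simp add: BijGroup_def)
qed

lemma group_aut_group: "group (aut_group k F)"
  unfolding aut_group_def by (rule group.subgroup_imp_group[OF group_BijGroup subgroup_field_auts])

lemma aut_group_carrier: "carrier (aut_group k F) = field_auts k F"
  by (simp add: aut_group_def)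

lemma aut_group_mult:
  assumes "\<sigma> \<in> field_auts k F" "\<tau> \<in> field_auts k F" "z \<in> F"
  shows "(\<sigma> \<otimes>\<^bsub>aut_group k F\<^esub> \<tau>) z = \<sigma> (\<tau> z)"
proof -
  have "\<rho> \<in> Bij F" if "\<rho> \<in> field_auts k F" for \<rho>
    using that by (auto simp: field_auts_def ring_iso_def Bij_def)
  then show ?thesis using assms by (simp add: aut_group_def BijGroup_def compose_def)
qed

lemma aut_group_one: "z \<in> F \<Longrightarrow> \<one>\<^bsub>aut_group k F\<^esub> z = z"
  by (simp add: aut_group_def BijGroup_def)

lemma aut_group_inv:
  assumes "\<sigma> \<in> field_auts k F"
  shows "inv\<^bsub>aut_group k F\<^esub> \<sigma> \<in> field_auts k F"
    and "z \<in> F \<Longrightarrow> \<sigma> ((inv\<^bsub>aut_group k F\<^esub> \<sigma>) z) = z"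
    and "z \<in> F \<Longrightarrow> (inv\<^bsub>aut_group k F\<^esub> \<sigma>) (\<sigma> z) = z"
proof -
  interpret group "aut_group k F" by (rule group_aut_group)
  show i: "inv\<^bsub>aut_group k F\<^esub> \<sigma> \<in> field_auts k F" using inv_closed[of \<sigma>] assms aut_group_carrier by simp
  show "z \<in> F \<Longrightarrow> \<sigma> ((inv\<^bsub>aut_group k F\<^esub> \<sigma>) z) = z"
    using aut_group_mult[OF assms i, of z] r_inv[of \<sigma>] assms aut_group_carrier aut_group_one by simp
  show "z \<in> F \<Longrightarrow> (inv\<^bsub>aut_group k F\<^esub> \<sigma>) (\<sigma> z) = z"
    using aut_group_mult[OF i assms, of z] l_inv[of \<sigma>] assms aut_group_carrier aut_group_one by simp
qed

end

section \<open>Automorphisms and sums of places over algebraically closed constants\<close>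

context weierstrass_closed
begin

lemma aut_fixing_places_is_id:
  assumes \<sigma>: "\<sigma> \<in> field_auts k F" and fix_pl: "\<And>P. P \<in> places k F \<Longrightarrow> \<sigma> ` P = P" and z: "z \<in> F"
  shows "\<sigma> z = z"
proof -
  interpret \<sigma>: field_automorphism k F \<sigma> by (rule field_automorphism.intro[OF F \<sigma>])
  have scal: "\<exists>c\<in>k. \<sigma> w = c * w" if w: "w \<in> F - {0}" for w
  proof
    have \<sigma>w: "\<sigma> w \<in> F - {0}" using w \<sigma>.in_F \<sigma>.eq_0_iff by auto
    have u: "\<sigma> w / w \<in> F - {0}" using w \<sigma>w F_closed(8) by auto
    show "\<sigma> w / w \<in> k"
    proof (rule valuation_0_imp_const[OF u])
      fix P assume P: "P \<in> places k F"
      then obtain V where V: "V \<in> valuation_rings k F" "P = nonunits V" using places_iff[OF F] by blast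
      obtain t where t: "uniformizer F V t" using valuation_ring_discrete[OF V(1)] by blast
      interpret V: discrete_valuation_subring k F V t by (rule discrete_valuation_subringI[OF F V(1) t])
      have "V.v (\<sigma> w) = V.v w" using \<sigma>.image_valuation[OF kF V(1) t w] fix_pl[OF P] V(2) by simp
      then show "valuation F P (\<sigma> w / w) = 0" unfolding V(2) using V.v_divide[OF \<sigma>w w] by simp
    qed
    show "\<sigma> w = \<sigma> w / w * w" using w by simp
  qed
  show ?thesis
  proof (cases "z \<in> k")
    case True
    then show ?thesis using \<sigma>.const by simp
  next
    case False
    then have z0: "z \<noteq> 0" "z + 1 \<noteq> 0"
      using k_closed(1,2,3) by (auto simp: add_eq_0_iff2)
    obtain c where c: "c \<in> k" "\<sigma> z = c * z" using scal z z0 by auto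
    obtain d where d: "d \<in> k" "\<sigma> (z + 1) = d * (z + 1)" using scal[of "z + 1"] z z0 F_closed(2,4) by auto
    \<comment> \<open>Additivity at \<open>z + 1\<close> compares the scalars of \<open>z\<close>,
      \<open>z + 1\<close> and 1. As \<open>z\<close> is not constant, \<open>c = d\<close>, and
      then \<open>d = 1\<close>.\<close>
    have eq: "(c - d) * z = d - 1" using c d \<sigma>.add[OF z F_closed(2)] \<sigma>.one by (simp add: algebra_simps)
    have "c = d"
    proof (rule ccontr)
      assume "c \<noteq> d"
      then have "z = (d - 1) / (c - d)" using eq by (simp add: field_simps)
      then show False using False c d k_closed(2,6,8) by auto
    qed
    then show ?thesis using eq c by simp
  qed
qed

text \<open>The quotient \<open>g / f\<close> of the two witnesses would have divisor
  \<open>W - S\<close>, hence a single simple pole.\<close>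

lemma linearly_equivalent_cancel:
  assumes RS: "W \<in> places k F" "S \<in> places k F"
    and 1: "linearly_equivalent k F D (frag_of W + D')" and 2: "linearly_equivalent k F D (frag_of S + D')"
  shows "W = S"
proof (rule ccontr)
  assume ne: "W \<noteq> S"
  obtain f where f: "f \<in> F - {0}" "\<And>P. P \<in> places k F \<Longrightarrow> Poly_Mapping.lookup (D - (frag_of W + D')) P = valuation F P f"
    using 1 unfolding linearly_equivalent_def by blast
  obtain g where g: "g \<in> F - {0}" "\<And>P. P \<in> places k F \<Longrightarrow> Poly_Mapping.lookup (D - (frag_of S + D')) P = valuation F P g"
    using 2 unfolding linearly_equivalent_def by blast
  have gf: "g / f \<in> F - {0}" using f g F_closed(8) by auto
  show False
  proof (rule no_simple_pole[OF RS ne gf])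
    fix P assume P: "P \<in> places k F"
    then obtain V where V: "V \<in> valuation_rings k F" "P = nonunits V" using places_iff[OF F] by blast
    obtain t where t: "uniformizer F V t" using valuation_ring_discrete[OF V(1)] by blast
    interpret V: discrete_valuation_subring k F V t by (rule discrete_valuation_subringI[OF F V(1) t])
    have "valuation F P (g / f) = valuation F P g - valuation F P f" unfolding V(2) using V.v_divide[OF g(1) f(1)] .
    then show "valuation F P (g / f) = (if P = W then 1 else 0) - (if P = S then 1 else 0)"
      using f(2)[OF P] g(2)[OF P] by (auto simp: lookup_minus lookup_add lookup_single when_def)
  qed
qed

lemma place_sum_unique:
  assumes "W \<in> places k F" "S \<in> places k F" "place_sum_is k F O' P Q W" "place_sum_is k F O' P Q S"
  shows "W = S"
  using linearly_equivalent_cancel[OF assms(1,2)] assms(3,4) unfolding place_sum_is_def by blast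

lemma place_sum_zero: "place_sum_is k F O' O' Q Q"
proof -
  have "valuation F P 1 = 0" if P: "P \<in> places k F" for P
  proof -
    obtain V where V: "V \<in> valuation_rings k F" "P = nonunits V" using P places_iff[OF F] by blast
    obtain t where t: "uniformizer F V t" using valuation_ring_discrete[OF V(1)] by blast
    interpret V: discrete_valuation_subring k F V t by (rule discrete_valuation_subringI[OF F V(1) t])
    show ?thesis unfolding V(2) using V.v_unit[of 1] V.V_closed(2) V.one_notin_nonunits by auto
  qed
  then show ?thesis unfolding place_sum_is_def linearly_equivalent_def
    using F_closed(2) by (intro bexI[of _ 1]) (auto simp: add.commute)
qed

text \<open>The witness \<open>f\<close> is carried to \<open>\<sigma> f\<close>, whose order at
  \<open>T\<close> is that of \<open>f\<close> at the preimage of \<open>T\<close>. Since \<sigma>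
  fixes \<open>O'\<close>, the transported relation refers to the same zero.\<close>

lemma place_sum_image:
  assumes \<sigma>: "\<sigma> \<in> field_auts k F" and O': "\<sigma> ` O' = O'" and pl: "P \<in> places k F" "Q \<in> places k F" "W \<in> places k F" "O' \<in> places k F"
    and sum: "place_sum_is k F O' P Q W"
  shows "place_sum_is k F O' (\<sigma> ` P) (\<sigma> ` Q) (\<sigma> ` W)"
proof -
  interpret \<sigma>: field_automorphism k F \<sigma> by (rule field_automorphism.intro[OF F \<sigma>])
  obtain f where f: "f \<in> F - {0}"
    "\<And>T. T \<in> places k F \<Longrightarrow> Poly_Mapping.lookup (frag_of P + frag_of Q - (frag_of W + frag_of O')) T = valuation F T f"
    using sum unfolding place_sum_is_def linearly_equivalent_def by blast
  have img: "\<sigma> ` S = \<sigma> ` T \<longleftrightarrow> S = T" if "S \<in> places k F" "T \<in> places k F" for S T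
    using inj_on_image_eq_iff[OF \<sigma>.inj] places_subset[OF F] that by metis
  have "Poly_Mapping.lookup (frag_of (\<sigma> ` P) + frag_of (\<sigma> ` Q) - (frag_of (\<sigma> ` W) + frag_of O')) T = valuation F T (\<sigma> f)"
    if T: "T \<in> places k F" for T
  proof -
    define T0 where "T0 = (inv\<^bsub>aut_group k F\<^esub> \<sigma>) ` T"
    note inv = aut_group_inv[OF F kF \<sigma>]
    have T0: "T0 \<in> places k F" unfolding T0_def
      using field_automorphism.image_place[OF field_automorphism.intro[OF F inv(1)] kF T] .
    have T_eq: "T = \<sigma> ` T0" unfolding T0_def image_image using inv(2) places_subset[OF F T] by force
    obtain V where V: "V \<in> valuation_rings k F" "T0 = nonunits V" using T0 places_iff[OF F] by blast
    obtain t where t: "uniformizer F V t" using valuation_ring_discrete[OF V(1)] by blast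
    have "valuation F T (\<sigma> f) = valuation F T0 f"
      using \<sigma>.image_valuation[OF kF V(1) t f(1)] by (simp add: T_eq V(2))
    moreover have lk: "Poly_Mapping.lookup (frag_of (\<sigma> ` S)) T = Poly_Mapping.lookup (frag_of S) T0" if "S \<in> places k F" for S
      unfolding T_eq lookup_single when_def using img[OF that T0] by simp
    moreover have "Poly_Mapping.lookup (frag_of O') T = Poly_Mapping.lookup (frag_of O') T0"
      using lk[OF pl(4)] O' by simp
    ultimately show ?thesis using f(2)[OF T0] pl by (simp only: lookup_minus lookup_add)
  qed
  moreover have "\<sigma> f \<in> F - {0}" using f(1) \<sigma>.in_F \<sigma>.eq_0_iff by auto
  ultimately show ?thesis unfolding place_sum_is_def linearly_equivalent_def by blast
qed

end

subsection \<open>Isomorphisms between Weierstrass models\<close>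

text \<open>Both pairs of generators satisfy the same equation, so elements written with the same
  pairs of polynomials can be matched. The notions \<open>pp\<close>, \<open>ev\<close> and
  \<open>pmul\<close> do not involve the generators and are shared by the two models.\<close>

lemma weierstrass_field_iso:
  assumes A: "weierstrass_field k F x y a1 a2 a3 a4 a6" and B: "weierstrass_field k F x' y' a1 a2 a3 a4 a6"
  shows "\<exists>\<phi>\<in>field_auts k F. \<phi> x = x' \<and> \<phi> y = y'"
proof -
  interpret A: weierstrass_field k F x y a1 a2 a3 a4 a6 by (rule A)
  interpret B: weierstrass_field k F x' y' a1 a2 a3 a4 a6 by (rule B)
  let ?P = "\<lambda>z w. \<exists>f\<in>A.pp. \<exists>g\<in>A.pp. g \<noteq> (0, 0) \<and> z = A.ev f x y / A.ev g x y \<and> w = A.ev f x' y' / A.ev g x' y'"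
  define \<phi> where "\<phi> = (\<lambda>z\<in>F. THE w. ?P z w)"
  \<comment> \<open>Equality of fractions is an identity of pairs in either model. One direction
    makes \<phi> well defined, the other makes it injective.\<close>
  have eqiff: "A.ev f x y / A.ev g x y = A.ev f' x y / A.ev g' x y \<longleftrightarrow>
      A.ev f x' y' / A.ev g x' y' = A.ev f' x' y' / A.ev g' x' y'"
    if "f \<in> A.pp" "g \<in> A.pp" "g \<noteq> (0, 0)" "f' \<in> A.pp" "g' \<in> A.pp" "g' \<noteq> (0, 0)" for f g f' g'
  proof -
    have "A.ev g x y \<noteq> 0" "A.ev g' x y \<noteq> 0" using A.ev_eq_0_iff that by auto
    then have "A.ev f x y / A.ev g x y = A.ev f' x y / A.ev g' x y \<longleftrightarrow> A.ev (A.pmul f g') x y = A.ev (A.pmul f' g) x y"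
      by (simp add: frac_eq_eq A.ev_pmul[OF A.curve])
    also have "\<dots> \<longleftrightarrow> A.pmul f g' = A.pmul f' g"
      using A.ev_inj[OF A.pp_closed(1) A.pp_closed(1)] that by metis
    also have "\<dots> \<longleftrightarrow> A.ev (A.pmul f g') x' y' = A.ev (A.pmul f' g) x' y'"
      using B.ev_inj[OF A.pp_closed(1) A.pp_closed(1)] that by metis
    also have "\<dots> \<longleftrightarrow> A.ev f x' y' / A.ev g x' y' = A.ev f' x' y' / A.ev g' x' y'"
    proof -
      have "A.ev g x' y' \<noteq> 0" "A.ev g' x' y' \<noteq> 0" using B.ev_eq_0_iff that by auto
      then show ?thesis by (simp add: frac_eq_eq B.ev_pmul[OF B.curve])
    qed
    finally show ?thesis .
  qed
  have \<phi>_eq: "\<phi> (A.ev f x y / A.ev g x y) = A.ev f x' y' / A.ev g x' y'"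
    if fg: "f \<in> A.pp" "g \<in> A.pp" "g \<noteq> (0, 0)" for f g
  proof -
    have "A.ev f x y / A.ev g x y \<in> F" using fg A.ev_in_F A.F_closed(8) by auto
    moreover have "(THE w. ?P (A.ev f x y / A.ev g x y) w) = A.ev f x' y' / A.ev g x' y'"
    proof (rule the_equality)
      fix w assume "?P (A.ev f x y / A.ev g x y) w"
      then obtain f' g' where *: "f' \<in> A.pp" "g' \<in> A.pp" "g' \<noteq> (0, 0)"
        "A.ev f x y / A.ev g x y = A.ev f' x y / A.ev g' x y" "w = A.ev f' x' y' / A.ev g' x' y'" by blast
      then show "w = A.ev f x' y' / A.ev g x' y'" using eqiff[OF fg *(1-3)] by simp
    qed (use fg in blast)
    ultimately show ?thesis by (simp add: \<phi>_def)
  qed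
  have one: "A.pconst 1 \<in> A.pp" "A.pconst 1 \<noteq> (0, 0)"
    using A.pp_closed(4)[OF A.k_closed(2)] by (auto simp: A.pconst_def)
  have \<phi>_ev: "\<phi> (A.ev f x y) = A.ev f x' y'" if "f \<in> A.pp" for f
    using \<phi>_eq[OF that one] by simp
  have hom: "\<phi> (z + w) = \<phi> z + \<phi> w \<and> \<phi> (z * w) = \<phi> z * \<phi> w" if zw: "z \<in> F" "w \<in> F" for z w
  proof -
    obtain f g where fg: "f \<in> A.pp" "g \<in> A.pp" "g \<noteq> (0, 0)" "z = A.ev f x y / A.ev g x y" by (rule A.F_fractions[OF zw(1)])
    obtain f' g' where fg': "f' \<in> A.pp" "g' \<in> A.pp" "g' \<noteq> (0, 0)" "w = A.ev f' x y / A.ev g' x y" by (rule A.F_fractions[OF zw(2)])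
    have nz: "A.ev g x y \<noteq> 0" "A.ev g' x y \<noteq> 0" "A.ev g x' y' \<noteq> 0" "A.ev g' x' y' \<noteq> 0"
      using A.ev_eq_0_iff B.ev_eq_0_iff fg fg' by auto
    let ?h = "A.padd (A.pmul f g') (A.pmul f' g)"
    have h: "?h \<in> A.pp" "A.pmul g g' \<in> A.pp" "A.pmul g g' \<noteq> (0, 0)" "A.pmul f f' \<in> A.pp"
      using fg fg' A.pp_closed(1,2) A.pmul_nz by auto
    have "z + w = A.ev ?h x y / A.ev (A.pmul g g') x y" "z * w = A.ev (A.pmul f f') x y / A.ev (A.pmul g g') x y"
      using nz by (simp_all add: fg(4) fg'(4) A.ev_padd A.ev_pmul[OF A.curve] add_frac_eq)
    then have "\<phi> (z + w) = A.ev ?h x' y' / A.ev (A.pmul g g') x' y'" "\<phi> (z * w) = A.ev (A.pmul f f') x' y' / A.ev (A.pmul g g') x' y'"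
      using \<phi>_eq[OF h(1-3)] \<phi>_eq[OF h(4,2,3)] by auto
    moreover have "\<phi> z = A.ev f x' y' / A.ev g x' y'" "\<phi> w = A.ev f' x' y' / A.ev g' x' y'"
      using \<phi>_eq fg fg' by auto
    ultimately show ?thesis using nz by (simp add: A.ev_padd A.ev_pmul[OF B.curve] add_frac_eq)
  qed
  have bij: "bij_betw \<phi> F F"
    unfolding bij_betw_def
  proof
    show "inj_on \<phi> F"
    proof (rule inj_onI)
      fix z w assume zw: "z \<in> F" "w \<in> F" "\<phi> z = \<phi> w"
      obtain f g where fg: "f \<in> A.pp" "g \<in> A.pp" "g \<noteq> (0, 0)" "z = A.ev f x y / A.ev g x y" by (rule A.F_fractions[OF zw(1)])
      obtain f' g' where fg': "f' \<in> A.pp" "g' \<in> A.pp" "g' \<noteq> (0, 0)" "w = A.ev f' x y / A.ev g' x y" by (rule A.F_fractions[OF zw(2)])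
      show "z = w" using eqiff[OF fg(1-3) fg'(1-3)] \<phi>_eq[OF fg(1-3)] \<phi>_eq[OF fg'(1-3)] zw(3) fg(4) fg'(4) by simp
    qed
    show "\<phi> ` F = F"
    proof
      show "\<phi> ` F \<subseteq> F"
      proof
        fix w assume "w \<in> \<phi> ` F"
        then obtain z where z: "z \<in> F" "w = \<phi> z" by auto
        obtain f g where fg: "f \<in> A.pp" "g \<in> A.pp" "g \<noteq> (0, 0)" "z = A.ev f x y / A.ev g x y" by (rule A.F_fractions[OF z(1)])
        show "w \<in> F" using \<phi>_eq[OF fg(1-3)] z fg B.ev_in_F A.F_closed(8) by auto
      qed
      show "F \<subseteq> \<phi> ` F"
      proof
        fix w assume w: "w \<in> F"
        obtain f g where fg: "f \<in> A.pp" "g \<in> A.pp" "g \<noteq> (0, 0)" "w = A.ev f x' y' / A.ev g x' y'" by (rule B.F_fractions[OF w])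
        have "A.ev f x y / A.ev g x y \<in> F" using fg A.ev_in_F A.F_closed(8) by auto
        then show "w \<in> \<phi> ` F" using \<phi>_eq[OF fg(1-3)] fg(4) by (intro image_eqI) auto
      qed
    qed
  qed
  have c: "\<phi> c = c" if "c \<in> k" for c using \<phi>_ev[OF A.pp_closed(4)[OF that]] by simp
  have "\<phi> \<in> field_auts k F"
    using hom bij c A.k_closed(2) by (intro field_autsI[OF A.F A.kF]) (auto simp: \<phi>_def)
  moreover have "\<phi> x = x'" "\<phi> y = y'" using \<phi>_ev[OF A.pp_closed(5)] \<phi>_ev[OF A.pp_closed(6)] by auto
  ultimately show ?thesis by blast
qed

section \<open>The constant field extension\<close>

lemma to_ac_vimage_subfld:
  assumes "subfld S"
  shows "subfld (to_ac -` S)"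
  using subrngD[OF subfld_subrng[OF assms]] subfldD[OF assms] by (intro subfldI) auto

lemma to_ac_poly: "to_ac (poly p z) = poly (map_poly to_ac p) (to_ac z)"
  by (induction p) (auto simp: map_poly_pCons)

lemma to_ac_weierstrass: "to_ac (weierstrass a1 a2 a3 a4 a6 u v) =
  weierstrass (to_ac a1) (to_ac a2) (to_ac a3) (to_ac a4) (to_ac a6) (to_ac u) (to_ac v)"
  by (simp add: weierstrass_def)

lemma const_closure_eq: "subfld K \<Longrightarrow> const_closure K = algebraics (to_ac ` K)"
  unfolding const_closure_def algebraics_def
  using algebraic_over_iff[OF subfld_subrng[OF to_ac_image_subfld]] by blast

locale constant_extension = E: weierstrass_field K UNIV x y a1 a2 a3 a4 a6
  for K :: "'a::field set" and x y a1 a2 a3 a4 a6 +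
  assumes fin: "finite K" and nonsing: "nonsingular_weierstrass K a1 a2 a3 a4 a6"
begin

abbreviation k' where "k' \<equiv> const_closure K"
abbreviation F' where "F' \<equiv> const_extension K"

lemma subfld_K': "subfld (to_ac ` K)" and fin_K': "finite (to_ac ` K)"
  using to_ac_image_subfld[OF E.k] fin by auto

lemma k'_eq: "k' = algebraics (to_ac ` K)"
  by (rule const_closure_eq[OF E.k])

lemma subfld_k': "subfld k'"
  unfolding k'_eq by (rule algebraics_subfld[OF subfld_K' fin_K'])

lemma K_k': "to_ac ` K \<subseteq> k'"
  unfolding k'_eq by (rule algebraics_superset[OF subfld_K' fin_K'])

lemma subfld_F': "subfld F'"
  unfolding const_extension_def by (rule generate_field_subfld)

lemma k'_F': "k' \<subseteq> F'" and to_ac_F': "to_ac z \<in> F'"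
  unfolding const_extension_def by (auto intro: generate_field.incl)

lemma range_F': "range to_ac \<subseteq> F'"
  using to_ac_F' by auto

lemma not_algebraic: "to_ac x \<notin> k'"
proof
  assume "to_ac x \<in> k'"
  then obtain p where p: "p \<in> polys (to_ac ` K)" "p \<noteq> 0" "poly p (to_ac x) = 0"
    by (auto simp: k'_eq algebraics_def)
  define q where "q = map_poly of_ac p"
  have c: "\<exists>c\<in>K. Polynomial.coeff p i = to_ac c" for i using p(1) by (auto simp: polys_def)
  have "p = map_poly to_ac q"
  proof (rule poly_eqI)
    fix i
    show "Polynomial.coeff p i = Polynomial.coeff (map_poly to_ac q) i"
      using c[of i] by (auto simp: q_def coeff_map_poly)
  qed
  moreover have "q \<in> polys K"
    unfolding polys_def q_def using c by (auto simp: coeff_map_poly) (metis of_ac_to_ac)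
  ultimately have "poly q x = 0" using p(3) to_ac_poly[of q x] by simp
  then have "q = 0" using E.transc \<open>q \<in> polys K\<close> by blast
  then show False using \<open>p = map_poly to_ac q\<close> p(2) by simp
qed

text \<open>A root of a nonzero polynomial over \<open>k'\<close> is algebraic over
  \<open>K\<close>, so \<open>x\<close> remains transcendental. A subfield containing
  \<open>k'\<close>, \<open>x\<close> and \<open>y\<close> contracts to a subfield of
  \<open>E\<close> that is all of \<open>E\<close>.\<close>

lemma F'_weierstrass: "weierstrass_field k' F' (to_ac x) (to_ac y) (to_ac a1) (to_ac a2) (to_ac a3) (to_ac a4) (to_ac a6)"
proof (rule weierstrass_field.intro)
  show "subfld k'" "subfld F'" "k' \<subseteq> F'" "to_ac x \<in> F'" "to_ac y \<in> F'"
    by (rule subfld_k' subfld_F' k'_F' to_ac_F')+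
  show "to_ac a1 \<in> k'" "to_ac a2 \<in> k'" "to_ac a3 \<in> k'" "to_ac a4 \<in> k'" "to_ac a6 \<in> k'"
    using E.coeffs K_k' by auto
  show "p = 0" if "p \<in> polys k'" "poly p (to_ac x) = 0" for p
    using root_over_algebraics[OF subfld_K' fin_K', of p "to_ac x"] that not_algebraic unfolding k'_eq by blast
  show "weierstrass (to_ac a1) (to_ac a2) (to_ac a3) (to_ac a4) (to_ac a6) (to_ac x) (to_ac y) = 0"
    using E.curve by (simp flip: to_ac_weierstrass)
  show "F' \<subseteq> S" if S: "subfld S" "k' \<subseteq> S" "to_ac x \<in> S" "to_ac y \<in> S" for S
  proof -
    have "K \<subseteq> to_ac -` S" using S(2) K_k' by blast
    then have "UNIV \<subseteq> to_ac -` S" using E.gen[OF to_ac_vimage_subfld[OF S(1)]] S(3,4) by auto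
    then have "k' \<union> range to_ac \<subseteq> S" using S(2) by auto
    then show ?thesis unfolding const_extension_def by (rule generate_field_minimal[OF S(1)])
  qed
qed

sublocale F': weierstrass_closed k' F' "to_ac x" "to_ac y" "to_ac a1" "to_ac a2" "to_ac a3" "to_ac a4" "to_ac a6"
proof (intro weierstrass_closed.intro F'_weierstrass weierstrass_closed_axioms.intro)
  show "\<exists>c\<in>k'. poly p c = 0" if p: "p \<in> polys k'" "Polynomial.degree p > 0" for p
  proof -
    obtain c where "poly p c = 0" using alg_closed_imp_poly_has_root[OF p(2)] by blast
    moreover have "p \<noteq> 0" using p(2) by auto
    ultimately have "c \<in> k'" using root_over_algebraics[OF subfld_K' fin_K', of p c] p(1) unfolding k'_eq by blast
    then show ?thesis using \<open>poly p c = 0\<close> by blast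
  qed
  show "\<not> weierstrass_singular (to_ac a1) (to_ac a2) (to_ac a3) (to_ac a4) (to_ac a6) u v" if "u \<in> k'" "v \<in> k'" for u v
    using nonsing that by (auto simp: nonsingular_weierstrass_def)
qed

lemma contraction_valuation_ring:
  assumes "V \<in> valuation_rings k' F'"
  shows "to_ac -` V \<in> valuation_rings K UNIV" "nonunits (to_ac -` V) = to_ac -` nonunits V"
    "uniformizer F' V s \<Longrightarrow> \<exists>t. uniformizer UNIV (to_ac -` V) t"
proof -
  note c = subfld_F' range_F' E.k K_k' assms
  show "to_ac -` V \<in> valuation_rings K UNIV" "nonunits (to_ac -` V) = to_ac -` nonunits V"
    "uniformizer F' V s \<Longrightarrow> \<exists>t. uniformizer UNIV (to_ac -` V) t"
    using vimage_valuation_ring[OF c] vimage_uniformizer[OF c] by (auto simp: nonunits_def)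
qed

text \<open>Discreteness of a place of \<open>E\<close> is inherited from an extension to
  \<open>F'\<close>, where every place has an explicit uniformizer.\<close>

lemma infinite_place_E: "infinite_place K UNIV x y = nonunits E.Vinf"
proof (rule E.infinite_place_eq)
  fix V assume V: "V \<in> valuation_rings K UNIV" "x \<in> V"
  obtain V' where V': "V' \<in> valuation_rings k' F'" "to_ac -` V' = V"
    using valuation_ring_extension[OF subfld_F' range_F' E.k k'_eq k'_F' V(1)] by blast
  obtain s where "uniformizer F' V' s" using F'.valuation_ring_discrete[OF V'(1)] by blast
  then show "\<exists>t. uniformizer UNIV V t" using contraction_valuation_ring(3)[OF V'(1)] V'(2) by blast
qed

lemma contraction_Vinf: "to_ac -` F'.Vinf = E.Vinf"
  by (rule E.Vinf_unique) (use contraction_valuation_ring(1)[OF F'.Vinf_valuation_ring] F'.x_notin_Vinf in auto)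

abbreviation O' where "O' \<equiv> infinite_place k' F' (to_ac x) (to_ac y)"

lemma extension_fixes_infinity:
  assumes \<sigma>: "\<sigma> \<in> field_auts K UNIV" "\<sigma> ` infinite_place K UNIV x y = infinite_place K UNIV x y"
    and \<sigma>': "\<sigma>' \<in> field_auts k' F'" "\<And>z. \<sigma>' (to_ac z) = to_ac (\<sigma> z)"
  shows "\<sigma>' ` O' = O'"
proof -
  interpret \<sigma>: field_automorphism K UNIV \<sigma> by (rule field_automorphism.intro[OF subfld_UNIV \<sigma>(1)])
  interpret \<sigma>': field_automorphism k' F' \<sigma>' by (rule field_automorphism.intro[OF subfld_F' \<sigma>'(1)])
  note VE = valuation_subring.intro[OF subfld_UNIV E.Vinf_valuation_ring]
  have im: "\<sigma> ` E.Vinf \<in> valuation_rings K UNIV"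
    by (rule \<sigma>.image_valuation_ring[OF _ E.Vinf_valuation_ring]) simp
  have "nonunits (\<sigma> ` E.Vinf) = nonunits E.Vinf"
    using \<sigma>(2) \<sigma>.image_nonunits[OF _ E.Vinf_valuation_ring] by (simp add: infinite_place_E)
  then have E_fix: "\<sigma> ` E.Vinf = E.Vinf"
    using valuation_subring.ring_of_place_nonunits[OF VE]
      valuation_subring.ring_of_place_nonunits[OF valuation_subring.intro[OF subfld_UNIV im]] by simp
  have "\<sigma>' ` F'.Vinf = F'.Vinf"
  proof (rule F'.Vinf_unique)
    show "\<sigma>' ` F'.Vinf \<in> valuation_rings k' F'"
      by (rule \<sigma>'.image_valuation_ring[OF k'_F' F'.Vinf_valuation_ring])
    show "to_ac x \<notin> \<sigma>' ` F'.Vinf"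
    proof
      assume "to_ac x \<in> \<sigma>' ` F'.Vinf"
      \<comment> \<open>\<open>w\<close> is the preimage of \<open>x\<close> under \<sigma>. Since
        \<sigma> fixes the place at infinity of \<open>E\<close>, \<open>w\<close> lies outside
        \<open>Vinf\<close>, as \<open>x\<close> does.\<close>
      moreover obtain w where w: "x = \<sigma> w" using \<sigma>.image_F by auto
      ultimately have "\<sigma>' (to_ac w) \<in> \<sigma>' ` F'.Vinf" using \<sigma>'(2) by simp
      then have "to_ac w \<in> F'.Vinf" using \<sigma>'.image_iff[OF k'_F' F'.Vinf_valuation_ring to_ac_F'] by simp
      then have "w \<in> E.Vinf" using contraction_Vinf by auto
      then show False using E_fix w E.x_notin_Vinf by auto
    qed
  qed
  then show ?thesis
    using \<sigma>'.image_nonunits[OF k'_F' F'.Vinf_valuation_ring] F'.infinite_place_closed by simp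
qed

text \<open>\<sigma> fixes the coefficients, so \<open>\<sigma> x\<close> and
  \<open>\<sigma> y\<close> generate a second model of \<open>E\<close> with the same equation.
  \<open>k'\<close> and \<open>F'\<close> do not depend on the model, so the isomorphism of models
  is an automorphism of \<open>F'\<close>; it agrees with \<sigma> on \<open>K\<close>,
  \<open>x\<close> and \<open>y\<close>, hence on \<open>E\<close>.\<close>

lemma extend_automorphism:
  assumes \<sigma>: "\<sigma> \<in> field_auts K UNIV"
  shows "\<exists>\<sigma>'\<in>field_auts k' F'. \<forall>z. \<sigma>' (to_ac z) = to_ac (\<sigma> z)"
proof -
  interpret \<sigma>: field_automorphism K UNIV \<sigma> by (rule field_automorphism.intro[OF subfld_UNIV \<sigma>])
  have W: "weierstrass_field K UNIV (\<sigma> x) (\<sigma> y) a1 a2 a3 a4 a6"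
  proof (rule weierstrass_field.intro)
    show "p = 0" if p: "p \<in> polys K" "poly p (\<sigma> x) = 0" for p
    proof -
      have "\<sigma> (poly p x) = 0" using \<sigma>.poly[OF p(1)] p(2) by simp
      then show ?thesis using \<sigma>.eq_0_iff E.transc[OF p(1)] by auto
    qed
    have "\<sigma> (weierstrass a1 a2 a3 a4 a6 x y) = weierstrass a1 a2 a3 a4 a6 (\<sigma> x) (\<sigma> y)"
      unfolding weierstrass_def using E.coeffs
      by (simp add: \<sigma>.add \<sigma>.diff \<sigma>.mult \<sigma>.power \<sigma>.const)
    then show "weierstrass a1 a2 a3 a4 a6 (\<sigma> x) (\<sigma> y) = 0" using E.curve \<sigma>.zero by simp
    show "UNIV \<subseteq> S" if S: "subfld S" "K \<subseteq> S" "\<sigma> x \<in> S" "\<sigma> y \<in> S" for S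
    proof -
      have "subfld (\<sigma> -` S)"
        using subrngD[OF subfld_subrng[OF S(1)]] subfldD[OF S(1)]
        by (intro subfldI) (auto simp: \<sigma>.one \<sigma>.diff \<sigma>.mult \<sigma>.inverse)
      moreover have "K \<subseteq> \<sigma> -` S" using S(2) \<sigma>.const by auto
      ultimately have "UNIV \<subseteq> \<sigma> -` S" using E.gen[of "\<sigma> -` S"] S by auto
      then have "\<sigma> z \<in> S" for z by auto
      then have "\<sigma> ` UNIV \<subseteq> S" by auto
      then show ?thesis by (simp only: \<sigma>.image_F)
    qed
  qed (use E.k E.F E.coeffs in auto)
  interpret C: constant_extension K "\<sigma> x" "\<sigma> y" a1 a2 a3 a4 a6
    by (intro constant_extension.intro W constant_extension_axioms.intro fin nonsing)
  obtain \<phi> where \<phi>: "\<phi> \<in> field_auts k' F'" "\<phi> (to_ac x) = to_ac (\<sigma> x)" "\<phi> (to_ac y) = to_ac (\<sigma> y)"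
    using weierstrass_field_iso[OF F'_weierstrass C.F'_weierstrass] by blast
  interpret \<phi>: field_automorphism k' F' \<phi> by (rule field_automorphism.intro[OF subfld_F' \<phi>(1)])
  define S where "S = {z. \<phi> (to_ac z) = to_ac (\<sigma> z)}"
  have "subfld S"
  proof (rule subfldI)
    fix a b assume "a \<in> S" "b \<in> S"
    then show "a - b \<in> S" "a * b \<in> S"
      using \<phi>.diff[OF to_ac_F' to_ac_F', of a b] \<phi>.mult[OF to_ac_F' to_ac_F', of a b] by (auto simp: S_def \<sigma>.diff \<sigma>.mult)
  next
    fix a assume "a \<in> S"
    then show "inverse a \<in> S" using \<phi>.inverse[OF to_ac_F', of a] by (simp add: S_def \<sigma>.inverse)
  qed (simp add: S_def \<phi>.one \<sigma>.one)
  moreover have "K \<subseteq> S" using \<phi>.const \<sigma>.const K_k' by (auto simp: S_def)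
  ultimately have "UNIV \<subseteq> S" using E.gen[of S] \<phi>(2,3) by (auto simp: S_def)
  then show ?thesis using \<phi>(1) by (auto simp: S_def)
qed

text \<open>A place of \<open>F'\<close> is at infinity or determined by its coordinates, the residues of \<open>x\<close> and \<open>y\<close>.\<close>

lemma rational_place_lift_unique:
  assumes Q: "Q \<in> rational_places K UNIV" and P: "P1 \<in> places k' F'" "P2 \<in> places k' F'"
    "to_ac -` P1 = Q" "to_ac -` P2 = Q"
  shows "P1 = P2"
proof -
  have "Q \<in> places K UNIV" using Q by (simp add: rational_places_def)
  then obtain V where V: "V \<in> valuation_rings K UNIV" "Q = nonunits V"
    using places_iff[OF subfld_UNIV] by blast
  interpret V: valuation_subring K UNIV V by (rule valuation_subring.intro[OF subfld_UNIV V(1)])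
  have res: "\<forall>z\<in>V. \<exists>c\<in>K. z - c \<in> Q"
    using Q V.place_degree_one_iff[OF E.k] by (simp add: rational_places_def V(2))
  obtain V1 where V1: "V1 \<in> valuation_rings k' F'" "P1 = nonunits V1" using P(1) places_iff[OF subfld_F'] by blast
  obtain V2 where V2: "V2 \<in> valuation_rings k' F'" "P2 = nonunits V2" using P(2) places_iff[OF subfld_F'] by blast
  have "to_ac -` W = V" if W: "W \<in> valuation_rings k' F'" "to_ac -` nonunits W = Q" for W
  proof -
    have "nonunits (to_ac -` W) = nonunits V" using contraction_valuation_ring(2)[OF W(1)] W(2) V(2) by simp
    then show ?thesis
      using V.ring_of_place_nonunits
        valuation_subring.ring_of_place_nonunits[OF valuation_subring.intro[OF subfld_UNIV contraction_valuation_ring(1)[OF W(1)]]]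
      by simp
  qed
  then have vim: "to_ac -` V1 = V" "to_ac -` V2 = V" using V1 V2 P by auto
  show ?thesis
  proof (cases "x \<in> V")
    case False
    then have "to_ac x \<notin> V1" "to_ac x \<notin> V2" using vim by auto
    then have "V1 = F'.Vinf" "V2 = F'.Vinf" using F'.Vinf_unique V1(1) V2(1) by blast+
    then show ?thesis using V1(2) V2(2) by simp
  next
    case True
    \<comment> \<open>As \<open>Q\<close> has degree one, the residues of \<open>x\<close> and
      \<open>y\<close> are constants \<open>c\<close> in \<open>K\<close> visible in
      \<open>Q\<close> itself. A nonzero difference \<open>a - to_ac c\<close> would be a unit
      inside the maximal ideal.\<close>
    have coord: "a = to_ac c" if ab: "a \<in> k'" "z - a \<in> nonunits W" and c: "c \<in> K" "to_ac (w - c) \<in> nonunits W" "z = to_ac w"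
      and W: "W \<in> valuation_rings k' F'" for a c z w W
    proof (rule ccontr)
      interpret W: valuation_subring k' F' W by (rule valuation_subring.intro[OF subfld_F' W])
      assume "a \<noteq> to_ac c"
      have ck: "to_ac c \<in> k'" using c K_k' by auto
      have "(z - to_ac c) - (z - a) \<in> nonunits W"
        using W.nonunits_diff[of "z - to_ac c" "z - a"] ab c by simp
      moreover have "a - to_ac c \<in> W - nonunits W"
        unfolding W.unit_iff using \<open>a \<noteq> to_ac c\<close> F'.k_closed(6,7) ab(1) ck W.k_V by auto
      ultimately show False by simp
    qed
    have local: "\<exists>a b. a \<in> k' \<and> b \<in> k' \<and> W = F'.R a b \<and> to_ac x - a \<in> nonunits W \<and> to_ac y - b \<in> nonunits W"
      if W: "W \<in> valuation_rings k' F'" "to_ac x \<in> W" for W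
    proof -
      obtain a b where ab: "a \<in> k'" "b \<in> k'" "F'.on_curve a b" "W = F'.R a b" using F'.affine_place[OF W] by blast
      interpret P: weierstrass_point k' F' "to_ac x" "to_ac y" "to_ac a1" "to_ac a2" "to_ac a3" "to_ac a4" "to_ac a6" a b
        by (rule F'.weierstrass_pointI[OF ab(1-3)])
      show ?thesis using ab P.residue_nonunit_iff[OF P.residue_xa] P.residue_nonunit_iff[OF P.residue_yb] by blast
    qed
    have xV: "to_ac x \<in> V1" "to_ac x \<in> V2" using vim True by (metis vimage_eq)+
    obtain a b where 1: "a \<in> k'" "b \<in> k'" "V1 = F'.R a b" "to_ac x - a \<in> nonunits V1" "to_ac y - b \<in> nonunits V1"
      using local[OF V1(1) xV(1)] by blast
    obtain a' b' where 2: "a' \<in> k'" "b' \<in> k'" "V2 = F'.R a' b'" "to_ac x - a' \<in> nonunits V2" "to_ac y - b' \<in> nonunits V2"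
      using local[OF V2(1) xV(2)] by blast
    obtain c where c: "c \<in> K" "x - c \<in> Q" using res True by blast
    interpret W: valuation_subring k' F' V1 by (rule valuation_subring.intro[OF subfld_F' V1(1)])
    have "(to_ac y - b) + b \<in> V1" using W.V_closed(4) 1(2,5) W.k_V W.nonunits_in_V by blast
    then have "y \<in> V" using vim by auto
    then obtain d where d: "d \<in> K" "y - d \<in> Q" using res by blast
    have q: "to_ac (x - c) \<in> nonunits V1" "to_ac (y - d) \<in> nonunits V1" "to_ac (x - c) \<in> nonunits V2" "to_ac (y - d) \<in> nonunits V2"
      using c(2) d(2) P(3,4) unfolding V1(2) V2(2) by (metis vimage_eq)+
    have "a = to_ac c" "b = to_ac d" by (rule coord[OF 1(1,4) c(1) q(1) refl V1(1)], rule coord[OF 1(2,5) d(1) q(2) refl V1(1)])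
    moreover have "a' = to_ac c" "b' = to_ac d" by (rule coord[OF 2(1,4) c(1) q(3) refl V2(1)], rule coord[OF 2(2,5) d(1) q(4) refl V2(1)])
    ultimately show ?thesis using 1(3) 2(3) V1 V2 by simp
  qed
qed

section \<open>Translations\<close>

text \<open>Names the witnesses hidden by the existential quantifiers of
  \<open>is_translation_by\<close>. Here \<open>Q'\<close> and \<open>P\<close> range over all
  places of \<open>F'\<close>, which is the same as the rational ones by
  \<open>all_places_rational\<close>.\<close>

definition lifts_translation :: "('a \<Rightarrow> 'a) \<Rightarrow> 'a alg_closure set \<Rightarrow> ('a alg_closure \<Rightarrow> 'a alg_closure) \<Rightarrow> bool" where
  "lifts_translation \<tau> Q' \<tau>' \<longleftrightarrow> \<tau>' \<in> field_auts k' F' \<and> (\<forall>z. \<tau>' (to_ac z) = to_ac (\<tau> z)) \<and>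
     Q' \<in> places k' F' \<and> (\<forall>P\<in>places k' F'. place_sum_is k' F' O' P Q' (\<tau>' ` P))"

lemma is_translation_iff:
  "is_translation_by K x y Q \<tau> \<longleftrightarrow> \<tau> \<in> field_auts K UNIV \<and> (\<exists>Q' \<tau>'. lifts_translation \<tau> Q' \<tau>' \<and> to_ac -` Q' = Q)"
  unfolding is_translation_by_def Let_def lifts_translation_def aut_group_carrier[OF subfld_UNIV subset_UNIV]
    aut_group_carrier[OF subfld_F' k'_F'] F'.all_places_rational
  by (rule iffI; elim conjE bexE exE) (intro conjI exI bexI; assumption)+

lemma O'_place: "O' \<in> places k' F'"
  using F'.places_eq F'.infinite_place_closed by simp

text \<open>Take \<open>P = O'\<close> in the translation property: \<open>O'\<close> is the zero of
  the addition and sums are unique. So the point of translation can be read off from the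
  lift.\<close>

lemma lifts_translation_O': "lifts_translation \<tau> Q' \<tau>' \<Longrightarrow> \<tau>' ` O' = Q'"
proof -
  assume "lifts_translation \<tau> Q' \<tau>'"
  then have *: "\<tau>' \<in> field_auts k' F'" "Q' \<in> places k' F'" "place_sum_is k' F' O' O' Q' (\<tau>' ` O')"
    using O'_place by (auto simp: lifts_translation_def)
  have "\<tau>' ` O' \<in> places k' F'"
    by (rule field_automorphism.image_place[OF field_automorphism.intro[OF subfld_F' *(1)] k'_F' O'_place])
  then show ?thesis using F'.place_sum_unique[OF _ *(2,3) F'.place_sum_zero] by blast
qed

text \<open>The inverse of \<tau>' followed after \<sigma>' fixes every place of \<open>F'\<close>,
  hence is the identity.\<close>

lemma aut_determined_by_places:
  assumes \<sigma>: "\<sigma> \<in> field_auts K UNIV" "\<sigma>' \<in> field_auts k' F'" "\<And>z. \<sigma>' (to_ac z) = to_ac (\<sigma> z)"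
    and \<tau>: "\<tau> \<in> field_auts K UNIV" "\<tau>' \<in> field_auts k' F'" "\<And>z. \<tau>' (to_ac z) = to_ac (\<tau> z)"
    and eq: "\<And>P. P \<in> places k' F' \<Longrightarrow> \<sigma>' ` P = \<tau>' ` P"
  shows "\<sigma> = \<tau>"
proof -
  let ?G = "aut_group k' F'"
  interpret G: group ?G by (rule group_aut_group[OF subfld_F' k'_F'])
  note inv = aut_group_inv[OF subfld_F' k'_F' \<tau>(2)]
  define \<rho> where "\<rho> = inv\<^bsub>?G\<^esub> \<tau>' \<otimes>\<^bsub>?G\<^esub> \<sigma>'"
  have \<rho>: "\<rho> \<in> field_auts k' F'"
    using G.m_closed[of "inv\<^bsub>?G\<^esub> \<tau>'" \<sigma>'] inv(1) \<sigma>(2) aut_group_carrier[OF subfld_F' k'_F'] by (simp add: \<rho>_def)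
  have \<rho>_eq: "\<rho> z = (inv\<^bsub>?G\<^esub> \<tau>') (\<sigma>' z)" if "z \<in> F'" for z
    unfolding \<rho>_def by (rule aut_group_mult[OF subfld_F' k'_F' inv(1) \<sigma>(2) that])
  have "\<rho> ` P = P" if P: "P \<in> places k' F'" for P
  proof -
    have "\<rho> ` P = (inv\<^bsub>?G\<^esub> \<tau>') ` (\<sigma>' ` P)" unfolding image_image using \<rho>_eq places_subset[OF subfld_F' P] by force
    also have "\<dots> = P" unfolding eq[OF P] image_image using inv(3) places_subset[OF subfld_F' P] by force
    finally show ?thesis .
  qed
  then have id: "\<rho> z = z" if "z \<in> F'" for z using F'.aut_fixing_places_is_id[OF \<rho> _ that] by blast
  interpret \<sigma>': field_automorphism k' F' \<sigma>' by (rule field_automorphism.intro[OF subfld_F' \<sigma>(2)])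
  have "\<sigma> z = \<tau> z" for z
  proof -
    have "\<tau>' (\<rho> (to_ac z)) = \<sigma>' (to_ac z)"
      unfolding \<rho>_eq[OF to_ac_F'] by (rule inv(2)[OF \<sigma>'.in_F[OF to_ac_F']])
    then show ?thesis using id[OF to_ac_F'] \<sigma>(3) \<tau>(3) by simp
  qed
  then show ?thesis by auto
qed

lemma lifts_translation_unique:
  assumes "\<sigma> \<in> field_auts K UNIV" "lifts_translation \<sigma> Q' \<sigma>'" "\<tau> \<in> field_auts K UNIV" "lifts_translation \<tau> Q' \<tau>'"
  shows "\<sigma> = \<tau>"
proof (rule aut_determined_by_places)
  show "\<sigma>' ` P = \<tau>' ` P" if P: "P \<in> places k' F'" for P
  proof (rule F'.place_sum_unique)
    show "\<sigma>' ` P \<in> places k' F'" "\<tau>' ` P \<in> places k' F'"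
      using field_automorphism.image_place[OF field_automorphism.intro[OF subfld_F'] k'_F' P] assms(2,4)
      by (auto simp: lifts_translation_def)
    show "place_sum_is k' F' O' P Q' (\<sigma>' ` P)" "place_sum_is k' F' O' P Q' (\<tau>' ` P)"
      using assms(2,4) P by (auto simp: lifts_translation_def)
  qed
qed (use assms in \<open>auto simp: lifts_translation_def\<close>)

text \<open>Two translations by \<open>Q\<close> might use different places of \<open>F'\<close>
  over \<open>Q\<close>; rationality of \<open>Q\<close> forces these to agree, and then the images
  of all places agree.\<close>

lemma translation_unique:
  assumes "Q \<in> rational_places K UNIV" "is_translation_by K x y Q \<sigma>" "is_translation_by K x y Q \<tau>"
  shows "\<sigma> = \<tau>"
proof -
  obtain Q1 \<sigma>' where 1: "\<sigma> \<in> field_auts K UNIV" "lifts_translation \<sigma> Q1 \<sigma>'" "to_ac -` Q1 = Q"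
    using assms(2) is_translation_iff by blast
  obtain Q2 \<tau>' where 2: "\<tau> \<in> field_auts K UNIV" "lifts_translation \<tau> Q2 \<tau>'" "to_ac -` Q2 = Q"
    using assms(3) is_translation_iff by blast
  have "Q1 = Q2" using rational_place_lift_unique[OF assms(1)] 1 2 by (auto simp: lifts_translation_def)
  then show ?thesis using lifts_translation_unique 1 2 by blast
qed

text \<open>The two lifts differ by an extension of \<alpha>, which fixes \<open>O'\<close>. So both
  send \<open>O'\<close> to the same place and are translations by the same point of
  \<open>F'\<close>.\<close>

lemma translations_differing_by_stabilizer:
  assumes \<sigma>: "is_translation_by K x y Q1 \<sigma>" and \<tau>: "is_translation_by K x y Q2 \<tau>"
    and \<alpha>: "\<alpha> \<in> field_auts K UNIV" "\<alpha> ` infinite_place K UNIV x y = infinite_place K UNIV x y"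
    and eq: "\<And>z. \<sigma> z = \<tau> (\<alpha> z)"
  shows "\<sigma> = \<tau>"
proof -
  obtain S \<sigma>' where 1: "\<sigma> \<in> field_auts K UNIV" "lifts_translation \<sigma> S \<sigma>'" using \<sigma> is_translation_iff by blast
  obtain T \<tau>' where 2: "\<tau> \<in> field_auts K UNIV" "lifts_translation \<tau> T \<tau>'" using \<tau> is_translation_iff by blast
  have \<sigma>': "\<sigma>' \<in> field_auts k' F'" "\<And>z. \<sigma>' (to_ac z) = to_ac (\<sigma> z)" and \<tau>': "\<tau>' \<in> field_auts k' F'" "\<And>z. \<tau>' (to_ac z) = to_ac (\<tau> z)"
    using 1 2 by (auto simp: lifts_translation_def)
  let ?G = "aut_group k' F'"
  interpret G: group ?G by (rule group_aut_group[OF subfld_F' k'_F'])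
  note inv = aut_group_inv[OF subfld_F' k'_F' \<tau>'(1)]
  interpret \<sigma>': field_automorphism k' F' \<sigma>' by (rule field_automorphism.intro[OF subfld_F' \<sigma>'(1)])
  define \<alpha>' where "\<alpha>' = inv\<^bsub>?G\<^esub> \<tau>' \<otimes>\<^bsub>?G\<^esub> \<sigma>'"
  have \<alpha>': "\<alpha>' \<in> field_auts k' F'"
    using G.m_closed[of "inv\<^bsub>?G\<^esub> \<tau>'" \<sigma>'] inv(1) \<sigma>'(1) aut_group_carrier[OF subfld_F' k'_F'] by (simp add: \<alpha>'_def)
  have \<alpha>'_eq: "\<alpha>' z = (inv\<^bsub>?G\<^esub> \<tau>') (\<sigma>' z)" if "z \<in> F'" for z
    unfolding \<alpha>'_def by (rule aut_group_mult[OF subfld_F' k'_F' inv(1) \<sigma>'(1) that])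
  have "\<alpha>' (to_ac z) = to_ac (\<alpha> z)" for z
    using \<alpha>'_eq[OF to_ac_F', of z] inv(3)[OF to_ac_F', of "\<alpha> z"] \<sigma>'(2)[of z] \<tau>'(2)[of "\<alpha> z"] eq[of z] by simp
  from extension_fixes_infinity[OF \<alpha> \<alpha>' this] have fixO: "\<alpha>' ` O' = O'" .
  have "\<sigma>' ` O' = \<tau>' ` (\<alpha>' ` O')"
    unfolding image_image using \<alpha>'_eq inv(2) \<sigma>'.in_F places_subset[OF subfld_F' O'_place] by force
  then have "S = T" using fixO lifts_translation_O'[OF 1(2)] lifts_translation_O'[OF 2(2)] by simp
  then show ?thesis using lifts_translation_unique 1 2 by blast
qed

lemma translation_conjugate:
  assumes \<tau>: "is_translation_by K x y Q \<tau>"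
    and \<sigma>: "\<sigma> \<in> field_auts K UNIV" "\<sigma> ` infinite_place K UNIV x y = infinite_place K UNIV x y"
  defines "\<sigma>i \<equiv> inv\<^bsub>aut_group K UNIV\<^esub> \<sigma>"
  shows "is_translation_by K x y (\<sigma>i ` Q) (\<sigma>i \<otimes>\<^bsub>aut_group K UNIV\<^esub> \<tau> \<otimes>\<^bsub>aut_group K UNIV\<^esub> \<sigma>)"
proof -
  let ?G = "aut_group K UNIV" and ?G' = "aut_group k' F'"
  interpret G: group ?G by (rule group_aut_group[OF subfld_UNIV subset_UNIV])
  interpret G': group ?G' by (rule group_aut_group[OF subfld_F' k'_F'])
  note car = aut_group_carrier[OF subfld_UNIV subset_UNIV, of K] and car' = aut_group_carrier[OF subfld_F' k'_F']
  obtain Q' \<tau>' where T: "\<tau> \<in> field_auts K UNIV" "lifts_translation \<tau> Q' \<tau>'" "to_ac -` Q' = Q"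
    using \<tau> is_translation_iff by blast
  have \<tau>': "\<tau>' \<in> field_auts k' F'" "\<And>z. \<tau>' (to_ac z) = to_ac (\<tau> z)" "Q' \<in> places k' F'"
    "\<And>P. P \<in> places k' F' \<Longrightarrow> place_sum_is k' F' O' P Q' (\<tau>' ` P)"
    using T(2) by (auto simp: lifts_translation_def)
  obtain \<sigma>' where \<sigma>': "\<sigma>' \<in> field_auts k' F'" "\<And>z. \<sigma>' (to_ac z) = to_ac (\<sigma> z)"
    using extend_automorphism[OF \<sigma>(1)] by blast
  define \<sigma>i' where "\<sigma>i' = inv\<^bsub>?G'\<^esub> \<sigma>'"
  note inv = aut_group_inv[OF subfld_UNIV subset_UNIV \<sigma>(1), folded \<sigma>i_def]
  note inv' = aut_group_inv[OF subfld_F' k'_F' \<sigma>'(1), folded \<sigma>i'_def]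
  have fixO: "\<sigma>' ` O' = O'" by (rule extension_fixes_infinity[OF \<sigma> \<sigma>'])
  have fixOi: "\<sigma>i' ` O' = O'"
  proof -
    have "\<sigma>i' ` (\<sigma>' ` O') = O'" unfolding image_image using inv'(3) places_subset[OF subfld_F' O'_place] by force
    then show ?thesis by (simp add: fixO)
  qed
  have \<sigma>i'_to_ac: "\<sigma>i' (to_ac z) = to_ac (\<sigma>i z)" for z
    using inv'(3)[OF to_ac_F', of "\<sigma>i z"] \<sigma>'(2)[of "\<sigma>i z"] inv(2)[of z] by simp
  interpret \<sigma>': field_automorphism k' F' \<sigma>' by (rule field_automorphism.intro[OF subfld_F' \<sigma>'(1)])
  interpret \<sigma>i': field_automorphism k' F' \<sigma>i' by (rule field_automorphism.intro[OF subfld_F' inv'(1)])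
  interpret \<tau>': field_automorphism k' F' \<tau>' by (rule field_automorphism.intro[OF subfld_F' \<tau>'(1)])
  define \<rho> \<rho>' where "\<rho> = \<sigma>i \<otimes>\<^bsub>?G\<^esub> \<tau> \<otimes>\<^bsub>?G\<^esub> \<sigma>" and "\<rho>' = \<sigma>i' \<otimes>\<^bsub>?G'\<^esub> \<tau>' \<otimes>\<^bsub>?G'\<^esub> \<sigma>'"
  have m1: "\<sigma>i \<otimes>\<^bsub>?G\<^esub> \<tau> \<in> field_auts K UNIV" "\<sigma>i' \<otimes>\<^bsub>?G'\<^esub> \<tau>' \<in> field_auts k' F'"
    using G.m_closed[of \<sigma>i \<tau>] G'.m_closed[of \<sigma>i' \<tau>'] inv(1) inv'(1) T(1) \<tau>'(1) car car' by auto
  have \<rho>_in: "\<rho> \<in> field_auts K UNIV" "\<rho>' \<in> field_auts k' F'"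
    using G.m_closed[OF _ _, of "\<sigma>i \<otimes>\<^bsub>?G\<^esub> \<tau>" \<sigma>] G'.m_closed[of "\<sigma>i' \<otimes>\<^bsub>?G'\<^esub> \<tau>'" \<sigma>'] m1 \<sigma>(1) \<sigma>'(1) car car'
    by (auto simp: \<rho>_def \<rho>'_def)
  have \<rho>_eq: "\<rho> z = \<sigma>i (\<tau> (\<sigma> z))" for z
    unfolding \<rho>_def using aut_group_mult[OF subfld_UNIV subset_UNIV m1(1) \<sigma>(1)]
      aut_group_mult[OF subfld_UNIV subset_UNIV inv(1) T(1)] by simp
  have \<rho>'_eq: "\<rho>' z = \<sigma>i' (\<tau>' (\<sigma>' z))" if "z \<in> F'" for z
    unfolding \<rho>'_def using aut_group_mult[OF subfld_F' k'_F' m1(2) \<sigma>'(1) that]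
      aut_group_mult[OF subfld_F' k'_F' inv'(1) \<tau>'(1) \<sigma>'.in_F[OF that]] by simp
  have "lifts_translation \<rho> (\<sigma>i' ` Q') \<rho>'"
    unfolding lifts_translation_def
  proof (intro conjI allI ballI)
    show "\<rho>' (to_ac z) = to_ac (\<rho> z)" for z
      using \<rho>'_eq[OF to_ac_F'] \<rho>_eq by (simp add: \<sigma>'(2) \<tau>'(2) \<sigma>i'_to_ac)
    show "\<sigma>i' ` Q' \<in> places k' F'" by (rule \<sigma>i'.image_place[OF k'_F' \<tau>'(3)])
    fix P assume P: "P \<in> places k' F'"
    have \<sigma>P: "\<sigma>' ` P \<in> places k' F'" by (rule \<sigma>'.image_place[OF k'_F' P])
    have "place_sum_is k' F' O' (\<sigma>i' ` (\<sigma>' ` P)) (\<sigma>i' ` Q') (\<sigma>i' ` (\<tau>' ` (\<sigma>' ` P)))"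
      by (rule F'.place_sum_image[OF inv'(1) fixOi \<sigma>P \<tau>'(3) \<tau>'.image_place[OF k'_F' \<sigma>P] O'_place \<tau>'(4)[OF \<sigma>P]])
    moreover have "\<sigma>i' ` (\<sigma>' ` P) = P" unfolding image_image using inv'(3) places_subset[OF subfld_F' P] by force
    moreover have "\<sigma>i' ` (\<tau>' ` (\<sigma>' ` P)) = \<rho>' ` P" unfolding image_image using \<rho>'_eq places_subset[OF subfld_F' P] by force
    ultimately show "place_sum_is k' F' O' P (\<sigma>i' ` Q') (\<rho>' ` P)" by simp
  qed (rule \<rho>_in)
  moreover have "to_ac -` (\<sigma>i' ` Q') = \<sigma>i ` Q"
  proof (intro Set.set_eqI iffI)
    fix z assume "z \<in> to_ac -` (\<sigma>i' ` Q')"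
    then obtain w where w: "w \<in> Q'" "to_ac z = \<sigma>i' w" by auto
    have "w \<in> F'" using w places_subset[OF subfld_F' \<tau>'(3)] by auto
    then have "w = \<sigma>' (to_ac z)" using inv'(2) w(2) by simp
    then have "\<sigma> z \<in> Q" using w(1) \<sigma>'(2) T(3) by auto
    then show "z \<in> \<sigma>i ` Q" using inv(3)[of z] by (metis UNIV_I imageI)
  next
    fix z assume "z \<in> \<sigma>i ` Q"
    then obtain w where "w \<in> Q" "z = \<sigma>i w" by auto
    then show "z \<in> to_ac -` (\<sigma>i' ` Q')" using \<sigma>i'_to_ac[of w] T(3) by (auto intro!: image_eqI[of _ _ "to_ac w"])
  qed
  ultimately show ?thesis using \<rho>_in(1) is_translation_iff unfolding \<rho>_def by blast
qed

end

section \<open>The group-theoretic argument\<close>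

lemma elliptic_function_fieldE:
  assumes "elliptic_function_field K x y"
  obtains a1 a2 a3 a4 a6 where "constant_extension K x y a1 a2 a3 a4 a6"
proof -
  obtain a1 a2 a3 a4 a6 where a: "a1 \<in> K" "a2 \<in> K" "a3 \<in> K" "a4 \<in> K" "a6 \<in> K"
    "nonsingular_weierstrass K a1 a2 a3 a4 a6" "weierstrass a1 a2 a3 a4 a6 x y = 0"
    using assms unfolding elliptic_function_field_def by blast
  have K: "subfld K" "finite K" "(ring.transcendental ring_of_type_algebra over K) x"
    "generate_field ring_of_type_algebra (K \<union> {x, y}) = UNIV"
    using assms by (auto simp: elliptic_function_field_def)
  have nalg: "\<not> (ring.algebraic ring_of_type_algebra over K) x" using K(3) by (simp add: over_def)
  have "weierstrass_field K UNIV x y a1 a2 a3 a4 a6"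
  proof (rule weierstrass_field.intro)
    show "p = 0" if "p \<in> polys K" "poly p x = 0" for p
      using nalg that algebraic_over_iff[OF subfld_subrng[OF K(1)], of x] by blast
    show "UNIV \<subseteq> S" if "subfld S" "K \<subseteq> S" "x \<in> S" "y \<in> S" for S
      using generate_field_minimal[OF that(1), of "K \<union> {x, y}"] that K(4) by auto
  qed (use a K subfld_UNIV in auto)
  then show thesis
    by (rule that[OF constant_extension.intro[OF _ constant_extension_axioms.intro[OF K(2) a(6)]]])
qed

text \<open>\<open>A\<close> is closed under inverses, so the hypothesis also gives conjugation in
  the opposite direction; that direction serves for products, the given one for inverses.\<close>

lemma (in group) set_mult_subgroup_if_normalizes:
  assumes T: "subgroup T G" and A: "subgroup A G"
    and norm: "\<And>\<tau> \<sigma>. \<tau> \<in> T \<Longrightarrow> \<sigma> \<in> A \<Longrightarrow> inv \<sigma> \<otimes> \<tau> \<otimes> \<sigma> \<in> T"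
  shows "subgroup (T <#> A) G"
proof -
  interpret T: subgroup T G by (rule T)
  interpret A: subgroup A G by (rule A)
  have TA: "z \<in> T <#> A \<longleftrightarrow> (\<exists>\<tau>\<in>T. \<exists>\<alpha>\<in>A. z = \<tau> \<otimes> \<alpha>)" for z
    by (auto simp: set_mult_def)
  have norm': "\<sigma> \<otimes> \<tau> \<otimes> inv \<sigma> \<in> T" if "\<tau> \<in> T" "\<sigma> \<in> A" for \<sigma> \<tau>
    using norm[OF that(1) A.m_inv_closed[OF that(2)]] that(2) by simp
  show ?thesis
  proof (rule subgroupI)
    show "T <#> A \<subseteq> carrier G" by (auto simp: TA)
    show "T <#> A \<noteq> {}" using TA T.one_closed A.one_closed by blast
    fix z w assume "z \<in> T <#> A" "w \<in> T <#> A"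
    then obtain t s u v where tsuv: "t \<in> T" "s \<in> A" "z = t \<otimes> s" "u \<in> T" "v \<in> A" "w = u \<otimes> v" unfolding TA by blast
    have "z \<otimes> w = (t \<otimes> (s \<otimes> u \<otimes> inv s)) \<otimes> (s \<otimes> v)"
      using tsuv by (simp add: m_assoc inv_solve_left)
    then show "z \<otimes> w \<in> T <#> A" unfolding TA using norm'[OF tsuv(4,2)] tsuv by blast
  next
    fix z assume "z \<in> T <#> A"
    then obtain t s where ts: "t \<in> T" "s \<in> A" "z = t \<otimes> s" unfolding TA by blast
    have "inv z = (inv s \<otimes> inv t \<otimes> s) \<otimes> inv s"
      using ts by (simp add: m_assoc inv_mult_group)
    then show "inv z \<in> T <#> A"
      unfolding TA using norm[OF T.m_inv_closed[OF ts(1)] ts(2)] A.m_inv_closed[OF ts(2)] by blast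
  qed
qed

lemma (in group) conjugate_in_set_mult:
  assumes T: "subgroup T G" and A: "subgroup A G" and TA: "subgroup (T <#> A) G"
    and "\<tau> \<in> T" "\<sigma> \<in> A"
  shows "inv \<sigma> \<otimes> \<tau> \<otimes> \<sigma> \<in> T <#> A"
proof -
  interpret T: subgroup T G by (rule T)
  interpret A: subgroup A G by (rule A)
  interpret TA: subgroup "T <#> A" G by (rule TA)
  have "\<sigma> = \<one> \<otimes> \<sigma>" using assms(5) by simp
  then have "\<sigma> \<in> T <#> A" unfolding set_mult_def using T.one_closed assms(5) by blast
  moreover have "\<tau> \<otimes> \<sigma> \<in> T <#> A" unfolding set_mult_def using assms(4,5) by blast
  ultimately have "inv \<sigma> \<otimes> (\<tau> \<otimes> \<sigma>) \<in> T <#> A" using TA.m_closed[OF TA.m_inv_closed] by blast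
  then show ?thesis using assms(4,5) by (simp add: m_assoc)
qed

theorem theorem3p5:
  fixes K :: "'a::field set" and x y :: 'a
  assumes "elliptic_function_field K x y"
    and "subgroup T (aut_group K UNIV)" and "T \<subseteq> translation_group K x y"
    and "subgroup A (aut_group K UNIV)"
    and "A \<subseteq> place_stabilizer K UNIV (infinite_place K UNIV x y)"
  shows "subgroup (T <#>\<^bsub>aut_group K UNIV\<^esub> A) (aut_group K UNIV) \<longleftrightarrow>
    (\<forall>\<sigma>\<in>A. \<forall>Q\<in>rational_places K UNIV.
       translation K x y Q \<in> T \<longrightarrow>
       translation K x y ((inv\<^bsub>aut_group K UNIV\<^esub> \<sigma>) ` Q) \<in> T)"
proof -
  obtain a1 a2 a3 a4 a6 where "constant_extension K x y a1 a2 a3 a4 a6"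
    using elliptic_function_fieldE[OF assms(1)] by blast
  then interpret constant_extension K x y a1 a2 a3 a4 a6 .
  define G where "G = aut_group K (UNIV :: 'a set)"
  interpret G: group G unfolding G_def by (rule group_aut_group[OF subfld_UNIV subset_UNIV])
  interpret T: subgroup T G unfolding G_def by (rule assms(2))
  interpret A: subgroup A G unfolding G_def by (rule assms(4))
  have car: "carrier G = field_auts K UNIV" unfolding G_def by (rule aut_group_carrier[OF subfld_UNIV subset_UNIV])
  have A_fix: "\<sigma> \<in> field_auts K UNIV" "\<sigma> ` infinite_place K UNIV x y = infinite_place K UNIV x y" if "\<sigma> \<in> A" for \<sigma>
    using assms(5) that by (auto simp: place_stabilizer_def aut_group_carrier[OF subfld_UNIV subset_UNIV])
  have conj: "is_translation_by K x y ((inv\<^bsub>G\<^esub> \<sigma>) ` Q) (inv\<^bsub>G\<^esub> \<sigma> \<otimes>\<^bsub>G\<^esub> \<tau> \<otimes>\<^bsub>G\<^esub> \<sigma>)"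
    if "is_translation_by K x y Q \<tau>" "\<sigma> \<in> A" for \<sigma> Q \<tau>
    unfolding G_def by (rule translation_conjugate[OF that(1) A_fix[OF that(2)]])
  have in_G: "\<tau> \<in> carrier G" if "is_translation_by K x y Q \<tau>" for Q \<tau>
    using that is_translation_iff car by simp
  \<comment> \<open>An equivalence is required, because the descriptions for \<open>Q\<close> and
    for its image have to correspond even when no translation by \<open>Q\<close> exists.\<close>
  have conj_iff: "is_translation_by K x y ((inv\<^bsub>G\<^esub> \<sigma>) ` Q) \<rho> \<longleftrightarrow>
      (\<exists>\<tau>. is_translation_by K x y Q \<tau> \<and> \<rho> = inv\<^bsub>G\<^esub> \<sigma> \<otimes>\<^bsub>G\<^esub> \<tau> \<otimes>\<^bsub>G\<^esub> \<sigma>)"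
    if \<sigma>: "\<sigma> \<in> A" for \<sigma> Q \<rho>
  proof
    assume \<rho>: "is_translation_by K x y ((inv\<^bsub>G\<^esub> \<sigma>) ` Q) \<rho>"
    have c: "\<sigma> \<in> carrier G" "\<rho> \<in> carrier G" using \<sigma> in_G[OF \<rho>] by auto
    have i: "inv\<^bsub>G\<^esub> (inv\<^bsub>G\<^esub> \<sigma>) = \<sigma>" using c by simp
    have "\<sigma> ` (inv\<^bsub>G\<^esub> \<sigma>) ` Q = Q"
      using aut_group_inv(2)[OF subfld_UNIV subset_UNIV, of \<sigma>] A_fix(1)[OF \<sigma>] unfolding image_image G_def by simp
    then have "is_translation_by K x y Q (\<sigma> \<otimes>\<^bsub>G\<^esub> \<rho> \<otimes>\<^bsub>G\<^esub> inv\<^bsub>G\<^esub> \<sigma>)"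
      using conj[OF \<rho> A.m_inv_closed[OF \<sigma>]] by (simp add: i)
    moreover have "\<rho> = inv\<^bsub>G\<^esub> \<sigma> \<otimes>\<^bsub>G\<^esub> (\<sigma> \<otimes>\<^bsub>G\<^esub> \<rho> \<otimes>\<^bsub>G\<^esub> inv\<^bsub>G\<^esub> \<sigma>) \<otimes>\<^bsub>G\<^esub> \<sigma>"
      using c by (simp add: G.m_assoc G.inv_solve_left)
    ultimately show "\<exists>\<tau>. is_translation_by K x y Q \<tau> \<and> \<rho> = inv\<^bsub>G\<^esub> \<sigma> \<otimes>\<^bsub>G\<^esub> \<tau> \<otimes>\<^bsub>G\<^esub> \<sigma>" by blast
  qed (use conj \<sigma> in blast)
  have translation_eq: "translation K x y Q = \<tau>" if "Q \<in> rational_places K UNIV" "is_translation_by K x y Q \<tau>" for Q \<tau>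
    unfolding translation_def using that translation_unique[OF that(1)] by blast
  have translation_conj: "translation K x y ((inv\<^bsub>G\<^esub> \<sigma>) ` Q) = inv\<^bsub>G\<^esub> \<sigma> \<otimes>\<^bsub>G\<^esub> \<tau> \<otimes>\<^bsub>G\<^esub> \<sigma>"
    if "Q \<in> rational_places K UNIV" "is_translation_by K x y Q \<tau>" "\<sigma> \<in> A" for Q \<tau> \<sigma>
    unfolding translation_def
  proof (rule the_equality)
    show "is_translation_by K x y ((inv\<^bsub>G\<^esub> \<sigma>) ` Q) (inv\<^bsub>G\<^esub> \<sigma> \<otimes>\<^bsub>G\<^esub> \<tau> \<otimes>\<^bsub>G\<^esub> \<sigma>)" by (rule conj[OF that(2,3)])
    \<comment> \<open>Uniqueness is pulled back along \<open>conj_iff\<close> to translations by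
      \<open>Q\<close>, which is known to be rational.\<close>
    show "\<rho> = inv\<^bsub>G\<^esub> \<sigma> \<otimes>\<^bsub>G\<^esub> \<tau> \<otimes>\<^bsub>G\<^esub> \<sigma>" if "is_translation_by K x y ((inv\<^bsub>G\<^esub> \<sigma>) ` Q) \<rho>" for \<rho>
      using that conj_iff[OF \<open>\<sigma> \<in> A\<close>] translation_unique[OF \<open>Q \<in> rational_places K UNIV\<close> \<open>is_translation_by K x y Q \<tau>\<close>] by blast
  qed
  have "subgroup (T <#>\<^bsub>G\<^esub> A) G \<longleftrightarrow>
    (\<forall>\<sigma>\<in>A. \<forall>Q\<in>rational_places K UNIV. translation K x y Q \<in> T \<longrightarrow> translation K x y ((inv\<^bsub>G\<^esub> \<sigma>) ` Q) \<in> T)"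
  proof (intro iffI ballI impI)
    assume TA: "subgroup (T <#>\<^bsub>G\<^esub> A) G"
    fix \<sigma> Q assume \<sigma>: "\<sigma> \<in> A" and Q: "Q \<in> rational_places K UNIV" and QT: "translation K x y Q \<in> T"
    show "translation K x y ((inv\<^bsub>G\<^esub> \<sigma>) ` Q) \<in> T"
    proof (cases "\<exists>\<tau>. is_translation_by K x y Q \<tau>")
      case False
      \<comment> \<open>There is no translation by the conjugate place either: both sides are the same unspecified value.\<close>
      then have "is_translation_by K x y ((inv\<^bsub>G\<^esub> \<sigma>) ` Q) = is_translation_by K x y Q"
        using conj_iff[OF \<sigma>] by (auto simp: fun_eq_iff)
      then show ?thesis using QT by (simp add: translation_def)
    next
      case True
      then obtain \<tau> where \<tau>: "is_translation_by K x y Q \<tau>" by blast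
      have \<tau>T: "\<tau> \<in> T" using QT translation_eq[OF Q \<tau>] by simp
      define \<rho> where "\<rho> = inv\<^bsub>G\<^esub> \<sigma> \<otimes>\<^bsub>G\<^esub> \<tau> \<otimes>\<^bsub>G\<^esub> \<sigma>"
      have \<rho>: "is_translation_by K x y ((inv\<^bsub>G\<^esub> \<sigma>) ` Q) \<rho>" unfolding \<rho>_def by (rule conj[OF \<tau> \<sigma>])
      have "\<rho> \<in> T <#>\<^bsub>G\<^esub> A"
        unfolding \<rho>_def by (rule G.conjugate_in_set_mult[OF T.subgroup_axioms A.subgroup_axioms TA \<tau>T \<sigma>])
      then obtain \<tau>2 \<alpha> where ta: "\<tau>2 \<in> T" "\<alpha> \<in> A" "\<rho> = \<tau>2 \<otimes>\<^bsub>G\<^esub> \<alpha>"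
        by (auto simp: set_mult_def)
      obtain Q2 where Q2: "is_translation_by K x y Q2 \<tau>2" using ta(1) assms(3) by (auto simp: translation_group_def)
      \<comment> \<open>Both are translations and they differ by \<alpha>, which fixes the place at
        infinity; so \<rho> itself lies in \<open>T\<close>.\<close>
      have "\<rho> = \<tau>2"
      proof (rule translations_differing_by_stabilizer[OF \<rho> Q2 A_fix[OF ta(2)]])
        show "\<rho> z = \<tau>2 (\<alpha> z)" for z
          unfolding ta(3) G_def using aut_group_mult[OF subfld_UNIV subset_UNIV, of \<tau>2 K \<alpha> z] A_fix(1)[OF ta(2)] T.mem_carrier[OF ta(1)] car by simp
      qed
      then show ?thesis using translation_conj[OF Q \<tau> \<sigma>] ta(1) \<rho>_def by simp
    qed
  next
    assume r: "\<forall>\<sigma>\<in>A. \<forall>Q\<in>rational_places K UNIV. translation K x y Q \<in> T \<longrightarrow> translation K x y ((inv\<^bsub>G\<^esub> \<sigma>) ` Q) \<in> T"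
    have norm: "inv\<^bsub>G\<^esub> \<sigma> \<otimes>\<^bsub>G\<^esub> \<tau> \<otimes>\<^bsub>G\<^esub> \<sigma> \<in> T" if "\<tau> \<in> T" "\<sigma> \<in> A" for \<sigma> \<tau>
    proof -
      obtain Q where Q: "Q \<in> rational_places K UNIV" "is_translation_by K x y Q \<tau>"
        using subsetD[OF assms(3) \<open>\<tau> \<in> T\<close>] by (auto simp: translation_group_def)
      then show ?thesis using r that translation_eq[OF Q] translation_conj[OF Q that(2)] by metis
    qed
    show "subgroup (T <#>\<^bsub>G\<^esub> A) G"
      by (rule G.set_mult_subgroup_if_normalizes[OF T.subgroup_axioms A.subgroup_axioms norm])
  qed
  then show ?thesis unfolding G_def .
qed

end
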